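(* Let $B=\{(x,y)\in\mathbb{R}^2 : x^2+y^2<1\}$ be the Euclidean unit disk, let $n\ge 1$, and let $H_{jkl}=(H^1_{jkl},\dots,H^n_{jkl})\in C^1(B,\mathbb{R}^n)$, $j,k,l=1,\dots,n$, be given with $\sup_{B,i,j,k,l}|H^i_{jkl}|<\infty$ and $\sup_{B,i,j,k,l}|\nabla H^i_{jkl}|<\infty$. Let $\psi=(\psi^1,\dots,\psi^n)$ be a solution of $$\partial\!\!\!/\,\psi=H_{jkl}\langle\psi^j,\psi^k\rangle\psi^l$$ which is smooth on $B\setminus\{0\}$ (the equation being satisfied on $B\setminus\{0\}$). If $$\int_B|\psi|^4<\infty,$$ then $\psi$ extends to a smooth solution of the same equation on the whole of $B$.
   Context: $\Sigma$ denotes the spinor bundle of $B$ for its (unique) spin structure; it is trivial with fibre $\mathbb{C}^2$ and carries a Hermitian metric $\langle\cdot,\cdot\rangle$ compatible with the spin connection $\nabla$. $\psi=(\psi^1,\dots,\psi^n)$ is an $n$-tuple of spinor fields (sections of $\Sigma$ over $B\setminus\{0\}$), and $|\psi|=(\sum_{i=1}^n\langle\psi^i,\psi^i\rangle)^{1/2}$. The Dirac operator is $\partial\!\!\!/=e_\alpha\cdot\nabla_{e_\alpha}$ (sum over $\alpha=1,2$) for an orthonormal frame $\{e_1,e_2\}$, where $\cdot$ is Clifford multiplication; it acts componentwise on $\psi$. On the Euclidean disk, for a spinor field with components $(\psi_1,\psi_2)^T$, one may take $$\partial\!\!\!/\begin{pmatrix}\psi_1\\ \psi_2\end{pmatrix}=\begin{pmatrix}0&1\\-1&0\end{pmatrix}\partial_x\begin{pmatrix}\psi_1\\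 \psi_2\end{pmatrix}+\begin{pmatrix}0&i\\ i&0\end{pmatrix}\partial_y\begin{pmatrix}\psi_1\\ \psi_2\end{pmatrix}.$$ The summation convention is used, and the equation means componentwise $\partial\!\!\!/\,\psi^i=\sum_{j,k,l}H^i_{jkl}\langle\psi^j,\psi^k\rangle\psi^l$ for $i=1,\dots,n$.
   Formalization: "Smooth" is read as C¹ and of class C^r for every r for which all H_{jkl} are C^r (so infinitely differentiable when H is), since for H only C¹ an infinitely differentiable extension across 0 can fail. *)

theory Defs
  imports "HOL-Analysis.Analysis"
begin

definition unit_disk :: "(real \<times> real) set" where
  "unit_disk = {(x, y). x\<^sup>2 + y\<^sup>2 < 1}"

lemma unit_disk_eq_ball: "unit_disk = ball 0 1"
  by (auto simp: unit_disk_def dist_norm norm_Pair)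

text \<open>
  Continuous differentiability of order \<open>k\<close>; meant for open sets \<open>S\<close>, since derivatives
  are taken in the ambient space.
\<close>

primrec C_k_on :: "nat \<Rightarrow> ('a::real_normed_vector \<Rightarrow> 'b::real_normed_vector) \<Rightarrow> 'a set \<Rightarrow> bool" where
  "C_k_on 0 f S \<longleftrightarrow> continuous_on S f"
| "C_k_on (Suc k) f S \<longleftrightarrow>
     (\<forall>x\<in>S. f differentiable (at x)) \<and> (\<forall>v. C_k_on k (\<lambda>x. frechet_derivative f (at x) v) S)"

definition partial_x :: "(real \<times> real \<Rightarrow> 'b::real_normed_vector) \<Rightarrow> real \<times> real \<Rightarrow> 'b" where
  "partial_x f z = frechet_derivative f (at z) (1, 0)"

definition partial_y :: "(real \<times> real \<Rightarrow> 'b::real_normed_vector) \<Rightarrow> real \<times> real \<Rightarrow> 'b" where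
  "partial_y f z = frechet_derivative f (at z) (0, 1)"

definition grad :: "(real \<times> real \<Rightarrow> real) \<Rightarrow> real \<times> real \<Rightarrow> real \<times> real" where
  "grad f z = (partial_x f z, partial_y f z)"

text \<open>
  The Hermitian metric on the fibre, complex linear in the first argument. The opposite
  convention amounts to interchanging the indices \<open>j\<close> and \<open>k\<close> of the coefficients \<open>H\<close> below.
\<close>

definition hermitian :: "complex^2 \<Rightarrow> complex^2 \<Rightarrow> complex" where
  "hermitian \<phi> \<eta> = (\<Sum>a\<in>UNIV. \<phi> $ a * cnj (\<eta> $ a))"

text \<open>
  Spinor tuples take values in \<open>complex^2^'n\<close>, whose library norm is the norm of the tuple
  defined from the Hermitian metric.
\<close>

lemma norm_square_eq_hermitian:
  fixes \<psi> :: "complex^2^'n"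
  shows "complex_of_real ((norm \<psi>)\<^sup>2) = (\<Sum>i\<in>UNIV. hermitian (\<psi> $ i) (\<psi> $ i))"
proof -
  have *: "hermitian \<phi> \<phi> = of_real ((norm \<phi>)\<^sup>2)" for \<phi> :: "complex^2"
    by (simp add: hermitian_def norm_vec_def L2_set_def sum_nonneg flip: complex_norm_square)
  show ?thesis
    by (simp add: * norm_vec_def[of \<psi>] L2_set_def sum_nonneg)
qed

text \<open>
  The two matrices are Clifford multiplication by the coordinate fields, which are
  orthonormal and for which the spin connection of the flat disk is the trivial one.
\<close>

definition dirac :: "(real \<times> real \<Rightarrow> complex^2) \<Rightarrow> real \<times> real \<Rightarrow> complex^2" where
  "dirac \<phi> z =
     (vector [vector [0, 1], vector [-1, 0]] :: complex^2^2) *v partial_x \<phi> z +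
     (vector [vector [0, \<i>], vector [\<i>, 0]] :: complex^2^2) *v partial_y \<phi> z"

text \<open>\<open>H j k l z $ i\<close> is the coefficient with lower indices \<open>j\<close>, \<open>k\<close>, \<open>l\<close> and upper index \<open>i\<close>.\<close>

definition solves_dirac ::
  "('n \<Rightarrow> 'n \<Rightarrow> 'n \<Rightarrow> real \<times> real \<Rightarrow> real^'n) \<Rightarrow> (real \<times> real) set \<Rightarrow>
     (real \<times> real \<Rightarrow> complex^2^'n) \<Rightarrow> bool" where
  "solves_dirac H S \<psi> \<longleftrightarrow>
     (\<forall>z\<in>S. \<forall>i. dirac (\<lambda>w. \<psi> w $ i) z =
        (\<Sum>j\<in>UNIV. \<Sum>k\<in>UNIV. \<Sum>l\<in>UNIV.
           (of_real (H j k l z $ i) * hermitian (\<psi> z $ j) (\<psi> z $ k)) *s (\<psi> z $ l)))"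

text \<open>
  Smoothness of a solution is understood relative to the smoothness of the coefficients:
  a smooth solution is a classical (that is, continuously differentiable) one which is
  moreover of class \<open>C\<^sup>r\<close> for every \<open>r\<close> such that \<open>H\<close> is of class \<open>C\<^sup>r\<close>; for
  infinitely differentiable \<open>H\<close> it is thus infinitely differentiable. For coefficients
  that are only \<open>C\<^sup>1\<close>, infinite differentiability across the origin is false in general.
  With \<open>n = 1\<close> and small \<open>\<epsilon> > 0\<close>, let \<open>b(r) = \<epsilon> r (1 + r\<^sup>3)\<close>, let \<open>a > 0\<close> satisfy
  \<open>a(0) = 1\<close> and \<open>a a' = - b (b' + b/r)\<close>, and let \<open>H = (b' + b/r) / (a (a\<^sup>2 + b\<^sup>2))\<close>.
  Then \<open>\<psi> = (a, b e\<^bsup>-i\<theta>\<^esup>)\<close> is a bounded solution that is infinitely differentiable off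
  the origin, and \<open>H\<close> is \<open>C\<^sup>1\<close> with bounded gradient, but the second component
  \<open>\<epsilon> (x - i y) (1 + r\<^sup>3)\<close> of \<open>\<psi>\<close> is not infinitely differentiable at the origin.
\<close>

definition smooth_solution ::
  "('n \<Rightarrow> 'n \<Rightarrow> 'n \<Rightarrow> real \<times> real \<Rightarrow> real^'n) \<Rightarrow> (real \<times> real) set \<Rightarrow>
     (real \<times> real \<Rightarrow> complex^2^'n) \<Rightarrow> bool" where
  "smooth_solution H S \<psi> \<longleftrightarrow>
     C_k_on 1 \<psi> S \<and>
     (\<forall>r. (\<forall>j k l. C_k_on r (H j k l) S) \<longrightarrow> C_k_on r \<psi> S) \<and>
     solves_dirac H S \<psi>"

lemma smooth_solutionI:
  assumes "\<And>r. C_k_on r \<psi> S" and "solves_dirac H S \<psi>"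
  shows "smooth_solution H S \<psi>"
  using assms by (simp add: smooth_solution_def del: C_k_on.simps One_nat_def)

lemma smooth_solution_smooth_coeffs:
  assumes "\<And>r j k l. C_k_on r (H j k l) S"
  shows "smooth_solution H S \<psi> \<longleftrightarrow> (\<forall>r. C_k_on r \<psi> S) \<and> solves_dirac H S \<psi>"
  using assms by (auto simp: smooth_solution_def simp del: C_k_on.simps One_nat_def)

end

theory Submission
  imports Defs
begin

text \<open>
  Put \<open>u = \<psi>\<^sup>i\<^sub>2\<close> and \<open>u = cnj \<psi>\<^sup>i\<^sub>1\<close> for all \<open>i\<close>. With \<open>dbar = \<partial>\<^sub>x + \<i> \<partial>\<^sub>y\<close> the system becomes
  \<open>dbar u = F\<close>, where \<open>F\<close> is cubic in the \<open>u\<close> and their conjugates with coefficients \<open>H\<close>.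

  Everything rests on one elementary fact: the derivative in the radius of the mean of \<open>f\<close> over
  a circle is bounded by the mean of \<open>\<bar>dbar f\<bar>\<close> over it, because the tangential derivative
  integrates to zero. Hence \<open>f(z)\<close> differs from the mean of \<open>f\<close> over circles or disks of radius
  \<open>s\<close> about \<open>z\<close> by at most \<open>s sup \<bar>dbar f\<bar>\<close>, and by a constant times \<open>s\<^bsup>1/4\<^esup>\<close> if only
  \<open>\<bar>dbar f(w)\<bar> \<le> \<bar>w\<bar>\<^bsup>-3/4\<^esup>\<close>; the circles may sweep over finitely many singular points
  (\<open>cmean_bound\<close>, \<open>disk_avg_bound\<close>). Disk averages of a bounded function in turn are Lipschitz
  in the centre (\<open>disk_avg_shift\<close>).

  \<^emph>\<open>Boundedness.\<close> The form of the equation and the \<open>L\<^sup>4\<close> norm are invariant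
  under \<open>u(z) \<mapsto> t\<^bsup>1/2\<^esup> u(t z)\<close>, \<open>H(z) \<mapsto> H(t z)\<close>. Picking a point where the scale invariant size of \<open>u\<close> is maximal and
  comparing with the average over a small disk there, one gets \<open>\<bar>z\<bar>\<^bsup>1/2\<^esup> \<bar>u(z)\<bar> \<longlonglongrightarrow> 0\<close> from
  \<open>u \<in> L\<^sup>4\<close> (\<open>critical_decay\<close>). Now \<open>z u(z)\<close> is continuous with value \<open>0\<close> at the origin, and
  the two-point estimate at the scale of a large multiple of \<open>\<bar>z\<bar>\<close> shows that the supremum of
  \<open>\<bar>z\<bar>\<^bsup>1/2\<^esup> \<bar>u(z)\<bar>\<close> decreases geometrically over nested disks; this gives
  \<open>u = O(\<bar>z\<bar>\<^bsup>-1/4\<^esup>)\<close> (\<open>removable_decay\<close>). Then \<open>dbar u = O(\<bar>z\<bar>\<^bsup>-3/4\<^esup>)\<close>, and the mean over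
  circles of a fixed radius bounds \<open>u\<close> (\<open>removable_bounded\<close>).

  \<^emph>\<open>Regularity.\<close> For a bounded family whose \<open>dbar\<close> is Lipschitz in the point and in the family
  itself, the same comparison applied to \<open>f(\<cdot> + h) - f\<close> gives a Lipschitz bound, as the
  contribution of \<open>dbar\<close> is absorbed on small disks (\<open>punctured_lipschitz\<close>); applied once more it
  gives a gradient that is Hoelder continuous with exponent \<open>1/2\<close> (\<open>punctured_gradient_holder\<close>).
  So the family and its first derivatives have limits at the origin. The derivatives of the \<open>u\<close> of order
  at most \<open>k\<close> form such a family as soon as they are bounded and \<open>H\<close> is of class \<open>C\<^bsup>k+1\<^esup>\<close>, so
  that induction on \<open>k\<close> yields limits at the origin for all derivatives up to the class of \<open>H\<close>
  (\<open>derivs_limits\<close>). A function with this property extends in the class \<open>C\<^sup>r\<close>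
  (\<open>C_k_on_puncture\<close>), and the equation at the origin follows by continuity.
\<close>

section \<open>Means over circles\<close>

text \<open>
  Continuous differentiability on \<open>S\<close> through the partial derivatives, for open \<open>S\<close>; a rendering of
  \<open>C_k_on 1\<close> suited to functions on the plane.
\<close>

definition C1_on :: "(real \<times> real \<Rightarrow> complex) \<Rightarrow> (real \<times> real) set \<Rightarrow> bool" where
  "C1_on f S \<longleftrightarrow> (\<forall>z\<in>S. f differentiable (at z)) \<and>
     continuous_on S (partial_x f) \<and> continuous_on S (partial_y f)"

text \<open>
  Twice the Cauchy--Riemann operator; it annihilates holomorphic functions.
\<close>

definition dbar :: "(real \<times> real \<Rightarrow> complex) \<Rightarrow> real \<times> real \<Rightarrow> complex" where
  "dbar f z = partial_x f z + \<i> * partial_y f z"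

lemma frechet_derivative_partials:
  fixes f :: "real \<times> real \<Rightarrow> 'b::real_normed_vector"
  assumes "f differentiable (at z)"
  shows "frechet_derivative f (at z) v = fst v *\<^sub>R partial_x f z + snd v *\<^sub>R partial_y f z"
proof -
  have l: "linear (frechet_derivative f (at z))"
    using assms by (simp add: linear_frechet_derivative)
  have "v = fst v *\<^sub>R (1, 0) + snd v *\<^sub>R (0, 1)"
    by (simp add: prod_eq_iff)
  then have "frechet_derivative f (at z) v = frechet_derivative f (at z) (fst v *\<^sub>R (1, 0) + snd v *\<^sub>R (0, 1))"
    by simp
  then show ?thesis
    by (simp only: linear_add[OF l] linear_scale[OF l] partial_x_def partial_y_def)
qed

lemma has_derivative_partials:
  fixes f :: "real \<times> real \<Rightarrow> 'b::real_normed_vector"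
  assumes "f differentiable (at z)"
  shows "(f has_derivative (\<lambda>v. fst v *\<^sub>R partial_x f z + snd v *\<^sub>R partial_y f z)) (at z)"
proof -
  have "(f has_derivative frechet_derivative f (at z)) (at z)"
    using assms frechet_derivative_works by blast
  moreover have "frechet_derivative f (at z) = (\<lambda>v. fst v *\<^sub>R partial_x f z + snd v *\<^sub>R partial_y f z)"
    using frechet_derivative_partials[OF assms] by blast
  ultimately show ?thesis by simp
qed

lemma has_derivative_partials_unique:
  assumes "(f has_derivative D) (at z)"
  shows "partial_x f z = D (1, 0)" "partial_y f z = D (0, 1)"
  using frechet_derivative_at[OF assms] by (simp_all add: partial_x_def partial_y_def)

lemma cball_subset_ball_0:
  fixes z :: "real \<times> real"
  assumes "norm z + s < r"
  shows "cball z s \<subseteq> ball 0 r"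
proof
  fix x assume "x \<in> cball z s"
  then have "norm x \<le> norm z + s" using norm_triangle_sub[of x z] by (simp add: dist_norm norm_minus_commute)
  then show "x \<in> ball 0 r" using assms by simp
qed

lemma norm_le_sum_norm:
  assumes "finite S" "f \<in> S"
  shows "norm (f w) \<le> (\<Sum>g\<in>S. norm (g w))"
  using assms member_le_sum[of f S "\<lambda>g. norm (g w)"] by simp

lemma C1_on_subset: "C1_on f S \<Longrightarrow> T \<subseteq> S \<Longrightarrow> C1_on f T"
  unfolding C1_on_def by (meson continuous_on_subset subsetD)

lemma C1_on_continuous: "C1_on f S \<Longrightarrow> continuous_on S f"
  unfolding C1_on_def
  by (meson continuous_at_imp_continuous_on differentiable_imp_continuous_within)

lemma C1_on_dbar_continuous: "C1_on f S \<Longrightarrow> continuous_on S (dbar f)"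
  unfolding C1_on_def dbar_def by (intro continuous_intros) auto

text \<open>
  Rotation about the origin by the angle \<open>\<theta>\<close>.
\<close>

definition rot :: "real \<Rightarrow> real \<times> real \<Rightarrow> real \<times> real" where
  "rot \<theta> x = (cos \<theta> * fst x - sin \<theta> * snd x, sin \<theta> * fst x + cos \<theta> * snd x)"

lemma norm_rot [simp]: "norm (rot \<theta> x) = norm x"
proof -
  have "(cos \<theta> * a - sin \<theta> * b)\<^sup>2 + (sin \<theta> * a + cos \<theta> * b)\<^sup>2
      = ((sin \<theta>)\<^sup>2 + (cos \<theta>)\<^sup>2) * (a\<^sup>2 + b\<^sup>2)" for a b
    by (simp only: power2_eq_square) algebra
  then show ?thesis
    by (cases x) (simp add: rot_def norm_Pair)
qed

lemma rot_scaleR: "rot \<theta> (t *\<^sub>R x) = t *\<^sub>R rot \<theta> x"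
  by (simp add: rot_def algebra_simps)

lemma rot_zero [simp]: "rot \<theta> 0 = 0"
  by (simp add: rot_def zero_prod_def)

lemma continuous_on_rot [continuous_intros]:
  fixes f :: "'a::t2_space \<Rightarrow> real"
  assumes "continuous_on S f" "continuous_on S g"
  shows "continuous_on S (\<lambda>w. rot (f w) (g w))"
  unfolding rot_def using assms by (intro continuous_intros)

lemma rot_has_vector_derivative:
  "((\<lambda>\<theta>. rot \<theta> x) has_vector_derivative rot \<theta> (- snd x, fst x)) (at \<theta> within T)"
  unfolding rot_def has_vector_derivative_def
  by (rule has_derivative_eq_rhs, (rule derivative_intros)+) (auto simp: algebra_simps fun_eq_iff)

text \<open>
  The mean of \<open>f\<close> over the circle about \<open>z\<close> through \<open>z + x\<close>. It is based at \<open>x\<close>, and not at a fixed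
  direction, so that averaging over \<open>x\<close> in a disk needs no polar coordinates.
\<close>

definition cmean :: "(real \<times> real \<Rightarrow> complex) \<Rightarrow> real \<times> real \<Rightarrow> real \<times> real \<Rightarrow> complex" where
  "cmean f z x = (1 / (2 * pi)) *\<^sub>R integral {0..2*pi} (\<lambda>\<theta>. f (z + rot \<theta> x))"

text \<open>
  In polar coordinates \<open>\<partial>\<^sub>r f = e\<^bsup>-i\<theta>\<^esup> dbar f - (i/r) \<partial>\<^sub>\<theta> f\<close>, and the last term has mean zero.
\<close>

lemma cmean_has_vector_derivative:
  assumes f: "C1_on f S" and x: "norm x = 1" and t0: "t0 \<in> {a<..<b}" and "0 \<le> a"
    and S: "\<And>t \<theta>. t \<in> {a<..<b} \<Longrightarrow> z + t *\<^sub>R rot \<theta> x \<in> S"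
  shows "\<exists>D. ((\<lambda>t. cmean f z (t *\<^sub>R x)) has_vector_derivative D) (at t0) \<and>
    norm D \<le> (1 / (2 * pi)) * integral {0..2*pi} (\<lambda>\<theta>. norm (dbar f (z + t0 *\<^sub>R rot \<theta> x)))"
proof -
  define J where "J = (- snd x, fst x)"
  define e where "e \<theta> = rot \<theta> x" for \<theta>
  define e' where "e' \<theta> = rot \<theta> J" for \<theta>
  have e': "e' \<theta> = (- snd (e \<theta>), fst (e \<theta>))" for \<theta>
    by (simp add: e_def e'_def J_def rot_def)
  have [simp]: "norm (e \<theta>) = 1" for \<theta> using x by (simp add: e_def)
  let ?D = "\<lambda>z v. fst v *\<^sub>R partial_x f z + snd v *\<^sub>R partial_y f z"
  have fD: "(f has_derivative ?D w) (at w)" if "w \<in> S" for w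
    using f that by (intro has_derivative_partials) (auto simp: C1_on_def)
  have cfx: "continuous_on S (partial_x f)" and cfy: "continuous_on S (partial_y f)"
    using f by (auto simp: C1_on_def)
  have cf: "continuous_on S f" using f by (rule C1_on_continuous)
  have ce: "continuous_on T e" for T unfolding e_def by (intro continuous_intros)
  have t0pos: "0 < t0" using t0 \<open>0 \<le> a\<close> by auto
  have Se: "z + t *\<^sub>R e \<theta> \<in> S" if "t \<in> {a<..<b}" for t \<theta> using S[OF that] by (simp add: e_def)
  \<comment> \<open>differentiation under the integral sign\<close>
  have "((\<lambda>t. integral (cbox 0 (2*pi)) (\<lambda>\<theta>. f (z + t *\<^sub>R e \<theta>))) has_vector_derivative
      integral (cbox 0 (2*pi)) (\<lambda>\<theta>. ?D (z + t0 *\<^sub>R e \<theta>) (e \<theta>))) (at t0 within {a<..<b})"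
  proof (rule leibniz_rule_vector_derivative[where fx = "\<lambda>t \<theta>. ?D (z + t *\<^sub>R e \<theta>) (e \<theta>)"])
    fix t \<theta> :: real assume t: "t \<in> {a<..<b}"
    have "((\<lambda>t. z + t *\<^sub>R e \<theta>) has_derivative (\<lambda>h. h *\<^sub>R e \<theta>)) (at t within {a<..<b})"
      by (auto intro!: derivative_eq_intros)
    from has_derivative_compose[OF this fD[OF Se[OF t]]]
    show "((\<lambda>t. f (z + t *\<^sub>R e \<theta>)) has_vector_derivative ?D (z + t *\<^sub>R e \<theta>) (e \<theta>)) (at t within {a<..<b})"
      unfolding has_vector_derivative_def
      by (rule has_derivative_eq_rhs) (auto simp: fun_eq_iff algebra_simps scaleR_conv_of_real)
  next
    fix t assume t: "t \<in> {a<..<b}"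
    have "continuous_on (cbox 0 (2*pi)) (\<lambda>\<theta>. f (z + t *\<^sub>R e \<theta>))"
      by (rule continuous_on_compose2[OF cf]) (use Se[OF t] in \<open>auto intro!: continuous_intros ce\<close>)
    then show "(\<lambda>\<theta>. f (z + t *\<^sub>R e \<theta>)) integrable_on cbox 0 (2*pi)"
      by (rule integrable_continuous)
  next
    have ce2: "continuous_on T (\<lambda>p. e (snd p))" for T :: "(real \<times> real) set"
      unfolding e_def by (intro continuous_intros)
    have "continuous_on ({a<..<b} \<times> cbox 0 (2*pi)) (\<lambda>p. ?D (z + fst p *\<^sub>R e (snd p)) (e (snd p)))"
      by (intro continuous_intros ce2 continuous_on_compose2[OF cfx] continuous_on_compose2[OF cfy])
        (use Se in auto)
    then show "continuous_on ({a<..<b} \<times> cbox 0 (2*pi)) (\<lambda>(t, \<theta>). ?D (z + t *\<^sub>R e \<theta>) (e \<theta>))"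
      by (simp add: split_beta)
  qed (use t0 in auto)
  then have der: "((\<lambda>t. integral {0..2*pi} (\<lambda>\<theta>. f (z + t *\<^sub>R e \<theta>))) has_vector_derivative
      integral {0..2*pi} (\<lambda>\<theta>. ?D (z + t0 *\<^sub>R e \<theta>) (e \<theta>))) (at t0)"
    using t0 by (simp add: at_within_open[of t0 "{a<..<b}"])
  \<comment> \<open>the tangential derivative integrates to zero over the circle\<close>
  have tang: "((\<lambda>\<theta>. ?D (z + t0 *\<^sub>R e \<theta>) (t0 *\<^sub>R e' \<theta>)) has_integral
      f (z + t0 *\<^sub>R e (2*pi)) - f (z + t0 *\<^sub>R e 0)) {0..2*pi}"
  proof (rule fundamental_theorem_of_calculus)
    fix \<theta> :: real
    have "((\<lambda>\<theta>. z + t0 *\<^sub>R e \<theta>) has_derivative (\<lambda>h. t0 *\<^sub>R (h *\<^sub>R e' \<theta>))) (at \<theta> within {0..2*pi})"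
      using rot_has_vector_derivative[of x \<theta> "{0..2*pi}"]
      unfolding e_def e'_def J_def has_vector_derivative_def
      by (auto intro!: derivative_eq_intros)
    from has_derivative_compose[OF this fD[OF Se[OF t0]]]
    show "((\<lambda>\<theta>. f (z + t0 *\<^sub>R e \<theta>)) has_vector_derivative ?D (z + t0 *\<^sub>R e \<theta>) (t0 *\<^sub>R e' \<theta>)) (at \<theta> within {0..2*pi})"
      unfolding has_vector_derivative_def
      by (rule has_derivative_eq_rhs) (auto simp: fun_eq_iff algebra_simps scaleR_conv_of_real)
  qed simp
  have "e (2*pi) = e 0" by (simp add: e_def rot_def)
  then have "((\<lambda>\<theta>. ?D (z + t0 *\<^sub>R e \<theta>) (t0 *\<^sub>R e' \<theta>)) has_integral 0) {0..2*pi}"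
    using tang by simp
  from has_integral_mult_right[OF this, of "\<i> / t0"]
  have tang0: "((\<lambda>\<theta>. \<i> / t0 * ?D (z + t0 *\<^sub>R e \<theta>) (t0 *\<^sub>R e' \<theta>)) has_integral 0) {0..2*pi}"
    by simp
  have scale: "\<i> / t0 * ?D w (t0 *\<^sub>R v) = \<i> * ?D w v" for w v
    using t0pos by (simp add: scaleR_conv_of_real field_simps)
  note tang0 = tang0[unfolded scale]
  have cD: "continuous_on {0..2*pi} (\<lambda>\<theta>. ?D (z + t0 *\<^sub>R e \<theta>) (e \<theta>))"
    by (intro continuous_intros ce continuous_on_compose2[OF cfx] continuous_on_compose2[OF cfy])
      (use Se[OF t0] in auto)
  let ?I = "integral {0..2*pi} (\<lambda>\<theta>. ?D (z + t0 *\<^sub>R e \<theta>) (e \<theta>))"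
  have "((\<lambda>\<theta>. ?D (z + t0 *\<^sub>R e \<theta>) (e \<theta>)) has_integral ?I) {0..2*pi}"
    using cD integrable_continuous_real integrable_integral by blast
  from has_integral_add[OF this tang0]
  have hI: "((\<lambda>\<theta>. Complex (fst (e \<theta>)) (- snd (e \<theta>)) * dbar f (z + t0 *\<^sub>R e \<theta>)) has_integral ?I) {0..2*pi}"
    by (simp add: e' dbar_def scaleR_conv_of_real Complex_eq algebra_simps)
  have cg: "continuous_on {0..2*pi} (\<lambda>\<theta>. dbar f (z + t0 *\<^sub>R e \<theta>))"
    by (rule continuous_on_compose2[OF C1_on_dbar_continuous[OF f]])
      (use Se[OF t0] in \<open>auto intro!: continuous_intros ce\<close>)
  have "norm (integral {0..2*pi} (\<lambda>\<theta>. Complex (fst (e \<theta>)) (- snd (e \<theta>)) * dbar f (z + t0 *\<^sub>R e \<theta>)))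
      \<le> integral {0..2*pi} (\<lambda>\<theta>. norm (dbar f (z + t0 *\<^sub>R e \<theta>)))"
  proof (rule integral_norm_bound_integral)
    show "(\<lambda>\<theta>. Complex (fst (e \<theta>)) (- snd (e \<theta>)) * dbar f (z + t0 *\<^sub>R e \<theta>)) integrable_on {0..2*pi}"
      using hI by blast
    show "(\<lambda>\<theta>. norm (dbar f (z + t0 *\<^sub>R e \<theta>))) integrable_on {0..2*pi}"
      by (intro integrable_continuous_real continuous_intros cg)
    fix \<theta>
    have "norm (Complex (fst (e \<theta>)) (- snd (e \<theta>))) = norm (e \<theta>)"
      by (cases "e \<theta>") (simp add: norm_Pair cmod_def)
    then show "norm (Complex (fst (e \<theta>)) (- snd (e \<theta>)) * dbar f (z + t0 *\<^sub>R e \<theta>)) \<le> norm (dbar f (z + t0 *\<^sub>R e \<theta>))"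
      by (simp add: norm_mult)
  qed
  then have nI: "norm ?I \<le> integral {0..2*pi} (\<lambda>\<theta>. norm (dbar f (z + t0 *\<^sub>R e \<theta>)))"
    using hI by (simp add: integral_unique)
  have cm: "(\<lambda>t. cmean f z (t *\<^sub>R x)) = (\<lambda>t. (1/(2*pi)) *\<^sub>R integral {0..2*pi} (\<lambda>\<theta>. f (z + t *\<^sub>R e \<theta>)))"
    by (simp add: cmean_def rot_scaleR e_def)
  have "((\<lambda>t. cmean f z (t *\<^sub>R x)) has_vector_derivative (1/(2*pi)) *\<^sub>R ?I) (at t0)"
    unfolding cm by (rule has_vector_derivative_scaleR[OF DERIV_const der, simplified])
  moreover have "norm ((1/(2*pi)) *\<^sub>R ?I) \<le> (1 / (2 * pi)) * integral {0..2*pi} (\<lambda>\<theta>. norm (dbar f (z + t0 *\<^sub>R rot \<theta> x)))"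
    using nI by (simp add: e_def divide_right_mono)
  ultimately show ?thesis by blast
qed

lemma quarter_le_abs_sin:
  assumes "\<bar>x\<bar> \<le> pi/2"
  shows "\<bar>x\<bar> / 4 \<le> \<bar>sin x\<bar>"
proof -
  have *: "y / 4 \<le> sin y" if "0 \<le> y" "y \<le> pi/2" for y :: real
  proof (cases "y \<le> pi/3")
    case True
    have "\<exists>g. sin y - sin 0 = (y - 0) * g \<and> 1/2 \<le> g" if "0 < y"
    proof -
      have "\<exists>c>0. c < y \<and> sin y - sin 0 = (y - 0) * cos c"
        by (rule MVT2[OF \<open>0 < y\<close>]) (auto intro!: derivative_eq_intros)
      then obtain c where c: "0 < c" "c < y" "sin y - sin 0 = (y - 0) * cos c" by blast
      have "cos (pi/3) \<le> cos c" using c True by (intro cos_monotone_0_pi_le) auto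
      then show ?thesis using c by (auto simp: cos_60)
    qed
    then show ?thesis using that
      by (cases "y = 0") (auto simp: mult.commute intro: order_trans[of _ "y * (1/2)"] mult_left_mono)
  next
    case False
    have "sin (pi/6) \<le> sin y" using False that by (intro sin_monotone_2pi_le) auto
    moreover have "y / 4 \<le> 1/2" using that pi_less_4 by auto
    ultimately show ?thesis by (simp add: sin_30)
  qed
  have "\<bar>x\<bar> / 4 \<le> sin \<bar>x\<bar>" using assms by (intro *) auto
  also have "\<dots> \<le> \<bar>sin x\<bar>" by (cases "0 \<le> x") auto
  finally show ?thesis .
qed

lemma abs_sin_lower:
  assumes "0 \<le> \<phi>" "\<phi> \<le> 4 * pi"
  shows "\<exists>k\<in>{0..4::nat}. \<bar>\<phi> - real k * pi\<bar> / 4 \<le> \<bar>sin \<phi>\<bar>"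
proof -
  define k where "k = nat \<lfloor>\<phi> / pi + 1/2\<rfloor>"
  have nn: "0 \<le> \<lfloor>\<phi> / pi + 1/2\<rfloor>" using assms by (simp add: add_nonneg_nonneg)
  have "\<phi> * 2 < pi * 9" using assms pi_gt_zero by linarith
  then have "\<phi> / pi + 1/2 < 5" by (simp add: field_simps)
  then have "\<lfloor>\<phi> / pi + 1/2\<rfloor> < 5" by linarith
  then have "k \<le> 4" unfolding k_def by linarith
  then have k4: "k \<in> {0..4}" by simp
  have rk: "real k = of_int \<lfloor>\<phi> / pi + 1/2\<rfloor>" using nn by (simp add: k_def)
  have "real k \<le> \<phi> / pi + 1/2" "\<phi> / pi + 1/2 < real k + 1" unfolding rk by linarith+
  then have "real k * pi \<le> \<phi> + pi/2" "\<phi> + pi/2 < real k * pi + pi" by (simp_all add: field_simps)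
  then have "\<bar>\<phi> - real k * pi\<bar> \<le> pi/2" by linarith
  then have "\<bar>\<phi> - real k * pi\<bar> / 4 \<le> \<bar>sin (\<phi> - real k * pi)\<bar>" by (rule quarter_le_abs_sin)
  also have "\<dots> = \<bar>sin \<phi>\<bar>" by (simp add: sin_diff abs_mult cos_npi sin_npi)
  finally show ?thesis using k4 by blast
qed

text \<open>
  The exponent \<open>-3/4\<close> is the singularity of \<open>dbar u\<close> once \<open>u = O(\<bar>z\<bar>\<^bsup>-1/4\<^esup>)\<close>.
\<close>

lemma abs_powr_integrable:
  fixes c :: real
  assumes "a \<le> b"
  shows "(\<lambda>x. \<bar>x - c\<bar> powr (-3/4)) integrable_on {a..b}"
proof -
  define F where "F x = (if x \<le> c then - 4 * (c - x) powr (1/4) else 4 * (x - c) powr (1/4))" for x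
  have "((\<lambda>x. \<bar>x - c\<bar> powr (-3/4)) has_integral (F b - F a)) {a..b}"
  proof (rule fundamental_theorem_of_calculus_interior_strong[where S = "{c}"])
    have "continuous_on ({..c} \<union> {c..}) F"
      unfolding F_def
      by (rule continuous_on_cases) (auto intro!: continuous_intros continuous_on_powr')
    then show "continuous_on {a..b} F"
      by (rule continuous_on_subset) auto
  next
    fix x assume "x \<in> {a<..<b} - {c}"
    then consider "x < c" | "x > c" by force
    then show "(F has_vector_derivative \<bar>x - c\<bar> powr (-3/4)) (at x)"
    proof cases
      case 1
      have "((\<lambda>x. - 4 * (c - x) powr (1/4)) has_real_derivative \<bar>x - c\<bar> powr (-3/4)) (at x)"
        using 1 by (auto intro!: derivative_eq_intros simp: abs_if)
      moreover have "\<forall>\<^sub>F y in nhds x. F y = - 4 * (c - y) powr (1/4)"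
        using 1 by (intro eventually_nhds_in_open[of "{..<c}", THEN eventually_mono])
          (auto simp: F_def)
      ultimately have "(F has_real_derivative \<bar>x - c\<bar> powr (-3/4)) (at x)"
        by (subst DERIV_cong_ev[OF refl _ refl]) auto
      then show ?thesis by (simp add: has_real_derivative_iff_has_vector_derivative)
    next
      case 2
      have "((\<lambda>x. 4 * (x - c) powr (1/4)) has_real_derivative \<bar>x - c\<bar> powr (-3/4)) (at x)"
        using 2 by (auto intro!: derivative_eq_intros simp: abs_if)
      moreover have "\<forall>\<^sub>F y in nhds x. F y = 4 * (y - c) powr (1/4)"
        using 2 by (intro eventually_nhds_in_open[of "{c<..}", THEN eventually_mono])
          (auto simp: F_def)
      ultimately have "(F has_real_derivative \<bar>x - c\<bar> powr (-3/4)) (at x)"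
        by (subst DERIV_cong_ev[OF refl _ refl]) auto
      then show ?thesis by (simp add: has_real_derivative_iff_has_vector_derivative)
    qed
  qed (use assms in auto)
  then show ?thesis by blast
qed

text \<open>
  An integrable majorant of \<open>\<bar>sin\<bar>\<^bsup>-3/4\<^esup>\<close> on \<open>[0, 4\<pi>]\<close> away from the zeros of the sine, with one
  summand for each zero.
\<close>

definition kern :: "real \<Rightarrow> real" where
  "kern \<phi> = (\<Sum>k\<in>{0..4::nat}. (\<bar>\<phi> - real k * pi\<bar> / 4) powr (-3/4))"

lemma kern_nonneg: "0 \<le> kern \<phi>"
  unfolding kern_def by (intro sum_nonneg) simp

lemma kern_integrable:
  assumes "a \<le> b" shows "kern integrable_on {a..b}"
proof -
  have "(\<lambda>\<phi>. (\<bar>\<phi> - real k * pi\<bar> / 4) powr (-3/4)) integrable_on {a..b}" for k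
    using integrable_on_cmult_left[OF abs_powr_integrable[OF assms, of "real k * pi"], of "(1/4) powr (-3/4)"]
    by (simp add: powr_mult[symmetric])
  then show ?thesis unfolding kern_def by (intro integrable_sum) auto
qed

lemma kern_bound:
  assumes "0 \<le> \<phi>" "\<phi> \<le> 4 * pi" "sin \<phi> \<noteq> 0"
  shows "\<bar>sin \<phi>\<bar> powr (-3/4) \<le> kern \<phi>"
proof -
  obtain k where k: "k \<in> {0..4::nat}" "\<bar>\<phi> - real k * pi\<bar> / 4 \<le> \<bar>sin \<phi>\<bar>"
    using abs_sin_lower assms by blast
  have "\<phi> \<noteq> real k * pi" using assms(3) by (auto simp: sin_npi)
  then have "\<bar>sin \<phi>\<bar> powr (-3/4) \<le> (\<bar>\<phi> - real k * pi\<bar> / 4) powr (-3/4)"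
    using k by (intro powr_mono2') auto
  also have "\<dots> \<le> kern \<phi>"
    unfolding kern_def using k by (intro member_le_sum) auto
  finally show ?thesis .
qed

text \<open>
  A bound for the mass of the majorant over a full turn, whatever the initial angle.
\<close>

definition kint :: real where "kint = integral {0..4*pi} kern"

lemma kint_nonneg: "0 \<le> kint"
  unfolding kint_def by (intro integral_nonneg kern_integrable) (auto simp: kern_nonneg)

lemma kern_shift_integrable: "(\<lambda>\<theta>. kern (\<theta> + \<alpha>)) integrable_on {a..b}"
proof (cases "a \<le> b")
  case True
  have "kern integrable_on {a+\<alpha>..b+\<alpha>}" using True by (intro kern_integrable) auto
  then show ?thesis
    using integrable_on_shift_Icc_real[of kern \<alpha> a b] by (simp add: o_def add.commute)
qed auto

lemma kern_shift_integral_le: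
  assumes "0 \<le> \<alpha>" "\<alpha> \<le> 2 * pi"
  shows "integral {0..2*pi} (\<lambda>\<theta>. kern (\<theta> + \<alpha>)) \<le> kint"
proof -
  have "integral {0..2*pi} (\<lambda>\<theta>. kern (\<theta> + \<alpha>)) = integral {0+\<alpha>..2*pi+\<alpha>} kern"
    using integral_shift_real_ivl[of "0+\<alpha>" "\<alpha>" "2*pi+\<alpha>" kern] by simp
  also have "\<dots> \<le> kint"
    unfolding kint_def using assms
    by (intro integral_subset_le kern_integrable) (auto simp: kern_nonneg)
  finally show ?thesis .
qed

text \<open>
  The points of a circle about \<open>z\<close> keep a distance to the origin controlled by the angle: the
  component of \<open>z + t rot \<theta> x\<close> orthogonal to \<open>z\<close> has length \<open>t \<bar>sin (\<theta> + \<alpha>)\<bar>\<close>. This makes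
  \<open>\<bar>w\<bar>\<^bsup>-3/4\<^esup>\<close> integrable over every circle, uniformly in its centre.
\<close>

lemma circle_distance:
  assumes x: "norm x = 1"
  shows "\<exists>\<alpha>. 0 \<le> \<alpha> \<and> \<alpha> \<le> 2*pi \<and> (\<forall>t \<theta>. t * \<bar>sin (\<theta> + \<alpha>)\<bar> \<le> norm (z + t *\<^sub>R rot \<theta> x))"
proof (cases "z = 0")
  case True
  have "t * \<bar>sin (\<theta> + 0)\<bar> \<le> norm (z + t *\<^sub>R rot \<theta> x)" for t \<theta>
  proof -
    have "t * \<bar>sin \<theta>\<bar> \<le> \<bar>t\<bar> * 1" by (intro mult_mono) auto
    then show ?thesis using True x by simp
  qed
  then show ?thesis by (intro exI[of _ 0]) auto
next
  case False
  define n where "n = norm z"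
  have n: "n > 0" using False by (simp add: n_def)
  define p where "p = (fst z * fst x + snd z * snd x) / n"
  define q where "q = (fst z * snd x - snd z * fst x) / n"
  have x2: "fst x ^ 2 + snd x ^ 2 = 1" using x by (cases x) (simp add: norm_Pair)
  have z2: "fst z ^ 2 + snd z ^ 2 = n^2" by (cases z) (simp add: n_def norm_Pair)
  have "(p * n)^2 + (q * n)^2 = (fst x ^ 2 + snd x ^ 2) * (fst z ^ 2 + snd z ^ 2)"
    using n by (simp add: p_def q_def) algebra
  then have "(p^2 + q^2) * n^2 = n^2" by (simp add: x2 z2 algebra_simps power_mult_distrib)
  then have pq: "p^2 + q^2 = 1" using n by simp
  obtain \<alpha> where \<alpha>: "0 \<le> \<alpha>" "\<alpha> < 2*pi" "p = cos \<alpha>" "q = sin \<alpha>"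
    using sincos_total_2pi[OF pq] by metis
  have "t * \<bar>sin (\<theta> + \<alpha>)\<bar> \<le> norm (z + t *\<^sub>R rot \<theta> x)" for t \<theta>
  proof -
    have np: "n * cos \<alpha> = fst z * fst x + snd z * snd x" "n * sin \<alpha> = fst z * snd x - snd z * fst x"
      using n unfolding \<alpha>(3,4)[symmetric] by (simp_all add: p_def q_def)
    have "n * cos (\<theta> + \<alpha>) = cos \<theta> * (n * cos \<alpha>) - sin \<theta> * (n * sin \<alpha>)"
      by (simp add: cos_add algebra_simps)
    then have c: "n * cos (\<theta> + \<alpha>) = fst z * fst (rot \<theta> x) + snd z * snd (rot \<theta> x)"
      unfolding np by (simp add: rot_def algebra_simps)
    have r2: "fst (rot \<theta> x) ^ 2 + snd (rot \<theta> x) ^ 2 = 1"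
      using norm_rot[of \<theta> x] x by (cases "rot \<theta> x") (simp add: norm_Pair)
    have "(norm (z + t *\<^sub>R rot \<theta> x))^2 = (fst z + t * fst (rot \<theta> x))^2 + (snd z + t * snd (rot \<theta> x))^2"
      by (cases z, cases "rot \<theta> x") (simp add: norm_Pair)
    also have "\<dots> = (fst z ^ 2 + snd z ^ 2) + 2 * t * (n * cos (\<theta> + \<alpha>)) + t^2 * (fst (rot \<theta> x) ^ 2 + snd (rot \<theta> x) ^ 2)"
      unfolding c by algebra
    also have "\<dots> = n^2 + 2 * t * (n * cos (\<theta> + \<alpha>)) + t^2 * ((sin (\<theta> + \<alpha>))^2 + (cos (\<theta> + \<alpha>))^2)"
      by (simp only: z2 r2 sin_cos_squared_add)
    also have "\<dots> = (n + t * cos (\<theta> + \<alpha>))^2 + (t * sin (\<theta> + \<alpha>))^2"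
      by algebra
    finally have "(t * sin (\<theta> + \<alpha>))^2 \<le> (norm (z + t *\<^sub>R rot \<theta> x))^2" by simp
    then have "\<bar>t * sin (\<theta> + \<alpha>)\<bar> \<le> norm (z + t *\<^sub>R rot \<theta> x)"
      by (metis abs_le_square_iff abs_norm_cancel)
    moreover have "t * \<bar>sin (\<theta> + \<alpha>)\<bar> \<le> \<bar>t * sin (\<theta> + \<alpha>)\<bar>"
      by (simp add: abs_mult mult_right_mono)
    ultimately show ?thesis by linarith
  qed
  then show ?thesis using \<alpha>(1,2) by (intro exI[of _ \<alpha>]) auto
qed

lemma finite_sin_zeros:
  fixes \<alpha> :: real
  shows "finite {\<theta>\<in>{a..b}. sin (\<theta> + \<alpha>) = 0}"
proof -
  have "{\<theta>\<in>{a..b}. sin (\<theta> + \<alpha>) = 0} \<subseteq> (\<lambda>i::int. i * pi - \<alpha>) ` {\<lfloor>(a + \<alpha>)/pi\<rfloor>..\<lceil>(b+\<alpha>)/pi\<rceil>}"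
  proof
    fix \<theta> assume "\<theta> \<in> {\<theta>\<in>{a..b}. sin (\<theta> + \<alpha>) = 0}"
    then have \<theta>: "a \<le> \<theta>" "\<theta> \<le> b" "sin (\<theta> + \<alpha>) = 0" by auto
    then obtain i :: int where i: "\<theta> + \<alpha> = i * pi" using sin_zero_iff_int2 by blast
    have "real_of_int i = (\<theta> + \<alpha>) / pi" using i by simp
    then have "(a + \<alpha>)/pi \<le> i" "i \<le> (b + \<alpha>)/pi" using \<theta> by (simp_all add: divide_right_mono)
    then have "\<lfloor>(a + \<alpha>)/pi\<rfloor> \<le> i" "i \<le> \<lceil>(b+\<alpha>)/pi\<rceil>" by linarith+
    moreover have "\<theta> = i * pi - \<alpha>" using i by simp
    ultimately show "\<theta> \<in> (\<lambda>i::int. i * pi - \<alpha>) ` {\<lfloor>(a + \<alpha>)/pi\<rfloor>..\<lceil>(b+\<alpha>)/pi\<rceil>}" by auto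
  qed
  then show ?thesis using finite_subset by blast
qed

lemma finite_circle_hits:
  assumes x: "norm x = 1" and P: "finite P" and t: "t \<noteq> 0"
  shows "finite {\<theta>\<in>{0..2*pi}. z + t *\<^sub>R rot \<theta> x \<in> P}"
proof -
  have 1: "finite {\<theta>\<in>{0..2*pi}. z + t *\<^sub>R rot \<theta> x = p}" for p
  proof (cases "{\<theta>\<in>{0..2*pi}. z + t *\<^sub>R rot \<theta> x = p} = {}")
    case False
    then obtain \<theta>' where \<theta>': "z + t *\<^sub>R rot \<theta>' x = p" by blast
    have x2: "fst x ^ 2 + snd x ^ 2 = 1" using x by (cases x) (simp add: norm_Pair)
    have "sin (\<theta> + - \<theta>') = 0" if "z + t *\<^sub>R rot \<theta> x = p" for \<theta>
    proof -
      have "rot \<theta> x = rot \<theta>' x" using that \<theta>' t by (metis add_left_cancel scaleR_cancel_left)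
      then have a: "cos \<theta> * fst x - sin \<theta> * snd x = cos \<theta>' * fst x - sin \<theta>' * snd x"
        "sin \<theta> * fst x + cos \<theta> * snd x = sin \<theta>' * fst x + cos \<theta>' * snd x"
        by (simp_all add: rot_def)
      have "sin \<theta> * cos \<theta>' - cos \<theta> * sin \<theta>' = (sin \<theta> * cos \<theta>' - cos \<theta> * sin \<theta>') * (fst x ^ 2 + snd x ^ 2)"
        using x2 by simp
      also have "\<dots> = (sin \<theta> * fst x + cos \<theta> * snd x) * (cos \<theta>' * fst x - sin \<theta>' * snd x)
          - (cos \<theta> * fst x - sin \<theta> * snd x) * (sin \<theta>' * fst x + cos \<theta>' * snd x)"
        by algebra
      also have "\<dots> = 0" unfolding a by simp
      finally show ?thesis by (simp add: sin_diff)
    qed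
    then have "{\<theta>\<in>{0..2*pi}. z + t *\<^sub>R rot \<theta> x = p} \<subseteq> {\<theta>\<in>{0..2*pi}. sin (\<theta> + - \<theta>') = 0}" by blast
    then show ?thesis using finite_sin_zeros finite_subset by blast
  qed (simp only: finite.emptyI)
  have "{\<theta>\<in>{0..2*pi}. z + t *\<^sub>R rot \<theta> x \<in> P} = (\<Union>p\<in>P. {\<theta>\<in>{0..2*pi}. z + t *\<^sub>R rot \<theta> x = p})" by auto
  then show ?thesis using P 1 by simp
qed

lemma powr_circle_bound:
  assumes "t * \<bar>sin (\<theta> + \<alpha>)\<bar> \<le> norm w" "0 < t" "0 \<le> \<alpha>" "\<alpha> \<le> 2*pi" "0 \<le> \<theta>" "\<theta> \<le> 2*pi" "sin (\<theta> + \<alpha>) \<noteq> 0"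
  shows "norm w powr (-3/4) \<le> t powr (-3/4) * kern (\<theta> + \<alpha>)"
proof -
  have "norm w powr (-3/4) \<le> (t * \<bar>sin (\<theta> + \<alpha>)\<bar>) powr (-3/4)"
    using assms by (intro powr_mono2') auto
  also have "\<dots> = t powr (-3/4) * \<bar>sin (\<theta> + \<alpha>)\<bar> powr (-3/4)"
    using assms by (intro powr_mult)
  also have "\<dots> \<le> t powr (-3/4) * kern (\<theta> + \<alpha>)"
    using assms by (intro mult_left_mono kern_bound) auto
  finally show ?thesis .
qed

lemma cmean_close:
  assumes c: "continuous_on {0..2*pi} (\<lambda>\<theta>. f (z + rot \<theta> y))"
    and e: "\<And>\<theta>. norm (f (z + rot \<theta> y) - c) \<le> e"
  shows "norm (cmean f z y - c) \<le> e"
proof -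
  have i: "(\<lambda>\<theta>. f (z + rot \<theta> y)) integrable_on {0..2*pi}"
    using c by (rule integrable_continuous_real)
  have "integral {0..2*pi} (\<lambda>\<theta>. f (z + rot \<theta> y) - c) = integral {0..2*pi} (\<lambda>\<theta>. f (z + rot \<theta> y)) - (2*pi) *\<^sub>R c"
    using i by (subst integral_diff) auto
  then have "cmean f z y - c = (1/(2*pi)) *\<^sub>R integral {0..2*pi} (\<lambda>\<theta>. f (z + rot \<theta> y) - c)"
    by (simp add: cmean_def scaleR_diff_right)
  moreover have "norm (integral {0..2*pi} (\<lambda>\<theta>. f (z + rot \<theta> y) - c)) \<le> integral {0..2*pi} (\<lambda>_. e)"
    using i e by (intro integral_norm_bound_integral integrable_diff) auto
  ultimately show ?thesis by (simp add: field_simps)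
qed

text \<open>
  The mean depends continuously on the radius even where the circle runs through singular points or the
  origin; there the function is dominated by the kernel.
\<close>

lemma cmean_continuous:
  assumes f: "continuous_on (U - P) f" and U: "open U" and P: "finite P"
    and s: "cball z s \<subseteq> U" and z: "z \<notin> P" and x: "norm x = 1"
    and fb: "\<And>w. w \<in> cball z s - P \<Longrightarrow> norm (f w) \<le> A * (1 + norm w powr (-3/4))"
  shows "continuous_on {0..s} (\<lambda>t. cmean f z (t *\<^sub>R x))"
proof (cases "0 \<le> s")
  case True
  obtain \<alpha> where \<alpha>: "0 \<le> \<alpha>" "\<alpha> \<le> 2*pi" "\<And>t \<theta>. t * \<bar>sin (\<theta> + \<alpha>)\<bar> \<le> norm (z + t *\<^sub>R rot \<theta> x)"
    using circle_distance[OF x] by blast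
  have A: "0 \<le> A"
  proof -
    have "0 \<le> A * (1 + norm z powr (-3/4))" using order_trans[OF norm_ge_zero fb[of z]] z True by simp
    moreover have "0 < 1 + norm z powr (-3/4)" by (simp add: add_pos_nonneg)
    ultimately show ?thesis by (simp add: zero_le_mult_iff)
  qed
  define Z where "Z = {\<theta>\<in>{0..2*pi}. sin (\<theta> + \<alpha>) = 0}"
  have Z: "finite Z" unfolding Z_def by (rule finite_sin_zeros)
  have opn: "open (U - P)" using U P by (simp add: finite_imp_closed open_Diff)
  have incball: "z + t *\<^sub>R rot \<theta> x \<in> cball z s" if "0 \<le> t" "t \<le> s" for t \<theta>
    using that x by (simp add: dist_norm)
  have "isCont f w" if "w \<in> U - P" for w
    using f opn that continuous_on_eq_continuous_at by blast
  note fc = this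
  show ?thesis
    unfolding continuous_on_sequentially
  proof (intro allI ballI impI)
    fix X :: "nat \<Rightarrow> real" and t0
    assume "t0 \<in> {0..s}" and X: "(\<forall>n. X n \<in> {0..s}) \<and> X \<longlonglongrightarrow> t0"
    show "((\<lambda>t. cmean f z (t *\<^sub>R x)) \<circ> X) \<longlonglongrightarrow> cmean f z (t0 *\<^sub>R x)"
    proof (cases "t0 = 0")
      case True
      have zU: "z \<in> U - P" using s z \<open>0 \<le> s\<close> by auto
      have c0: "cmean f z (t0 *\<^sub>R x) = f z" using True by (simp add: cmean_def rot_scaleR)
      show ?thesis unfolding c0 o_def
      proof (rule LIMSEQ_I)
        fix r :: real assume "r > 0"
        then obtain d where d: "d > 0" "\<And>w. dist w z < d \<Longrightarrow> norm (f w - f z) < r/2"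
          using fc[OF zU] unfolding continuous_at dist_norm[symmetric]
          by (metis half_gt_zero_iff LIM_def dist_self fc[OF zU] isCont_def)
        obtain d' where d': "d' > 0" "ball z d' \<subseteq> U - P" using opn zU open_contains_ball by blast
        obtain n0 where n0: "\<And>n. n \<ge> n0 \<Longrightarrow> norm (X n - t0) < min d d'"
          using X LIMSEQ_D[of X t0 "min d d'"] d d' by auto
        have "norm (cmean f z (X n *\<^sub>R x) - f z) < r" if "n \<ge> n0" for n
        proof -
          have Xn: "\<bar>X n\<bar> < d" "\<bar>X n\<bar> < d'" using n0[OF that] True by auto
          have "norm (cmean f z (X n *\<^sub>R x) - f z) \<le> r/2"
          proof (rule cmean_close)
            show "continuous_on {0..2*pi} (\<lambda>\<theta>. f (z + rot \<theta> (X n *\<^sub>R x)))"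
            proof (rule continuous_on_compose2[OF f])
              have "z + rot \<theta> (X n *\<^sub>R x) \<in> ball z d'" for \<theta>
                using Xn x by (simp add: dist_norm)
              then show "(\<lambda>\<theta>. z + rot \<theta> (X n *\<^sub>R x)) ` {0..2*pi} \<subseteq> U - P" using d'(2) by blast
            qed (intro continuous_intros)
            show "norm (f (z + rot \<theta> (X n *\<^sub>R x)) - f z) \<le> r / 2" for \<theta>
              using d(2)[of "z + rot \<theta> (X n *\<^sub>R x)"] Xn x by (simp add: dist_norm)
          qed
          then show ?thesis using \<open>r > 0\<close> by simp
        qed
        then show "\<exists>no. \<forall>n\<ge>no. norm (cmean f z (X n *\<^sub>R x) - f z) < r" by blast
      qed
    next
      case False
      then have t0: "0 < t0" "t0 \<le> s" using \<open>t0 \<in> {0..s}\<close> by auto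
      define T where "T = dist z ` P - {t0}"
      have "open ({t0/2<..} - T)" unfolding T_def using P by (intro open_Diff finite_imp_closed) auto
      moreover have "t0 \<in> {t0/2<..} - T" using t0 by (auto simp: T_def)
      ultimately have "\<forall>\<^sub>F n in sequentially. X n \<in> {t0/2<..} - T"
        using X topological_tendstoD by blast
      then obtain n0 where n0: "\<And>n. n \<ge> n0 \<Longrightarrow> X n \<in> {t0/2<..} - T"
        unfolding eventually_sequentially by blast
      define Y where "Y n = X (n + n0)" for n
      have Y: "t0/2 < Y n" "Y n \<notin> T" "Y n \<le> s" for n using n0[of "n+n0"] X by (auto simp: Y_def)
      have Yt: "Y \<longlonglongrightarrow> t0" unfolding Y_def using X LIMSEQ_ignore_initial_segment by blast
      \<comment> \<open>the angles at which the circle of radius \<open>t0\<close> meets \<open>P\<close>; those of other nearby radii do not\<close>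
      define D where "D = {\<theta>\<in>{0..2*pi}. z + t0 *\<^sub>R rot \<theta> x \<in> P}"
      have D: "finite D" unfolding D_def using finite_circle_hits[OF x P] t0 by simp
      define S where "S = {0..2*pi} - (Z \<union> D)"
      have Sfin: "negligible (Z \<union> D)" using Z D by (simp add: negligible_finite)
      define h where "h \<theta> = A * (1 + (t0/2) powr (-3/4) * kern (\<theta> + \<alpha>))" for \<theta>
      have hI: "h integrable_on S"
      proof -
        have "h integrable_on {0..2*pi}"
          unfolding h_def by (intro integrable_on_mult_right integrable_add kern_shift_integrable) auto
        then show ?thesis unfolding S_def
          by (rule integrable_spike_set) (auto intro: negligible_subset[OF Sfin])
      qed
      have inS: "z + Y n *\<^sub>R rot \<theta> x \<in> U - P" if "\<theta> \<in> S" for n \<theta>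
      proof -
        have "z + Y n *\<^sub>R rot \<theta> x \<in> cball z s" using incball Y(1,3)[of n] t0 by auto
        moreover have "z + Y n *\<^sub>R rot \<theta> x \<notin> P"
        proof
          assume *: "z + Y n *\<^sub>R rot \<theta> x \<in> P"
          have "dist z (z + Y n *\<^sub>R rot \<theta> x) = Y n" using x Y(1)[of n] t0 by (simp add: dist_norm)
          then have "Y n \<in> dist z ` P" using * by force
          then have "Y n = t0" using Y(2)[of n] by (auto simp: T_def)
          then show False using * that by (auto simp: S_def D_def)
        qed
        ultimately show ?thesis using s by auto
      qed
      have bnd: "norm (f (z + Y n *\<^sub>R rot \<theta> x)) \<le> h \<theta>" if "\<theta> \<in> S" for n \<theta>
      proof -
        have "norm (z + Y n *\<^sub>R rot \<theta> x) powr (-3/4) \<le> (t0/2) powr (-3/4) * kern (\<theta> + \<alpha>)"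
        proof (rule powr_circle_bound)
          have "t0/2 * \<bar>sin (\<theta> + \<alpha>)\<bar> \<le> Y n * \<bar>sin (\<theta> + \<alpha>)\<bar>" using Y(1)[of n] by (intro mult_right_mono) auto
          then show "t0/2 * \<bar>sin (\<theta> + \<alpha>)\<bar> \<le> norm (z + Y n *\<^sub>R rot \<theta> x)" using \<alpha>(3)[of "Y n" \<theta>] by linarith
        qed (use that t0 \<alpha> in \<open>auto simp: S_def Z_def\<close>)
        moreover have "norm (f (z + Y n *\<^sub>R rot \<theta> x)) \<le> A * (1 + norm (z + Y n *\<^sub>R rot \<theta> x) powr (-3/4))"
          using inS[OF that, of n] incball[of "Y n" \<theta>] Y(1,3)[of n] t0 by (intro fb) auto
        ultimately show ?thesis unfolding h_def using A
          by (meson add_left_mono mult_left_mono order_trans)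
      qed
      have "(\<lambda>n. integral S (\<lambda>\<theta>. f (z + Y n *\<^sub>R rot \<theta> x))) \<longlonglongrightarrow> integral S (\<lambda>\<theta>. f (z + t0 *\<^sub>R rot \<theta> x))"
      proof (rule dominated_convergence(2)[OF _ hI])
        fix n
        show "(\<lambda>\<theta>. f (z + Y n *\<^sub>R rot \<theta> x)) integrable_on S"
        proof (rule measurable_bounded_by_integrable_imp_integrable[OF _ hI])
          have Sl: "S \<in> sets lebesgue" unfolding S_def using Z D by (intro sets.Diff) (auto intro: negligible_imp_sets negligible_finite)
          show "S \<in> sets lebesgue" by fact
          show "(\<lambda>\<theta>. f (z + Y n *\<^sub>R rot \<theta> x)) \<in> borel_measurable (lebesgue_on S)"
            by (rule continuous_imp_measurable_on_sets_lebesgue[OF _ Sl], rule continuous_on_compose2[OF f])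
              (use inS in \<open>auto intro!: continuous_intros\<close>)
        qed (use bnd in auto)
      next
        fix n \<theta> assume "\<theta> \<in> S" then show "norm (f (z + Y n *\<^sub>R rot \<theta> x)) \<le> h \<theta>" by (rule bnd)
      next
        fix \<theta> assume \<theta>: "\<theta> \<in> S"
        have "z + t0 *\<^sub>R rot \<theta> x \<in> U - P" using incball[of t0 \<theta>] t0 s \<theta> by (auto simp: S_def D_def)
        moreover have "(\<lambda>n. z + Y n *\<^sub>R rot \<theta> x) \<longlonglongrightarrow> z + t0 *\<^sub>R rot \<theta> x"
          by (intro tendsto_intros Yt)
        ultimately show "(\<lambda>n. f (z + Y n *\<^sub>R rot \<theta> x)) \<longlonglongrightarrow> f (z + t0 *\<^sub>R rot \<theta> x)"
          using fc isCont_tendsto_compose by blast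
      qed
      moreover have "integral S g = integral {0..2*pi} g" for g :: "real \<Rightarrow> complex"
        unfolding S_def by (rule integral_spike_set) (auto intro: negligible_subset[OF Sfin])
      ultimately have "(\<lambda>n. cmean f z (Y n *\<^sub>R x)) \<longlonglongrightarrow> cmean f z (t0 *\<^sub>R x)"
        unfolding cmean_def rot_scaleR by (intro tendsto_intros) simp
      then show ?thesis unfolding Y_def o_def by (rule LIMSEQ_offset)
    qed
  qed
qed auto

lemma powr_has_integral:
  fixes s :: real
  assumes "0 \<le> s"
  shows "((\<lambda>t. t powr (-3/4)) has_integral (4 * s powr (1/4))) {0..s}"
proof -
  have "((\<lambda>t. t powr (-3/4)) has_integral (4 * s powr (1/4) - 4 * 0 powr (1/4))) {0..s}"
  proof (rule fundamental_theorem_of_calculus_interior)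
    show "continuous_on {0..s} (\<lambda>t. 4 * t powr (1/4))"
      by (auto intro!: continuous_intros continuous_on_powr')
    show "((\<lambda>t. 4 * t powr (1/4)) has_vector_derivative t powr (-3/4)) (at t)" if "t \<in> {0<..<s}" for t
      unfolding has_real_derivative_iff_has_vector_derivative[symmetric]
      using that by (auto intro!: derivative_eq_intros)
  qed (use assms in auto)
  then show ?thesis by simp
qed

text \<open>
  The constant in front of \<open>s\<^bsup>1/4\<^esup>\<close> in the mean value estimates.
\<close>

definition sing_const :: real where "sing_const = 2 * kint / pi"

lemma sing_const_nonneg: "0 \<le> sing_const"
  unfolding sing_const_def using kint_nonneg by simp

text \<open>
  The mean value estimate over circles. The radii at which the circle hits \<open>P\<close> are finitely many, and
  the circle mean is continuous there, so the fundamental theorem of calculus applies across them.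
\<close>

theorem cmean_bound:
  assumes f: "C1_on f (U - P)" and U: "open U" and P: "finite P"
    and s: "cball z s \<subseteq> U" "0 \<le> s" and z: "z \<notin> P" and x: "norm x = 1"
    and fb: "\<And>w. w \<in> cball z s - P \<Longrightarrow> norm (f w) \<le> A * (1 + norm w powr (-3/4))"
    and gb: "\<And>w. w \<in> cball z s - P \<Longrightarrow> norm (dbar f w) \<le> B + C * norm w powr (-3/4)"
    and C: "0 \<le> C"
  shows "norm (cmean f z (s *\<^sub>R x) - f z) \<le> s * B + sing_const * C * s powr (1/4)"
proof -
  obtain \<alpha> where \<alpha>: "0 \<le> \<alpha>" "\<alpha> \<le> 2*pi" "\<And>t \<theta>. t * \<bar>sin (\<theta> + \<alpha>)\<bar> \<le> norm (z + t *\<^sub>R rot \<theta> x)"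
    using circle_distance[OF x] by blast
  define Z where "Z = {\<theta>\<in>{0..2*pi}. sin (\<theta> + \<alpha>) = 0}"
  have Z: "finite Z" unfolding Z_def by (rule finite_sin_zeros)
  define G where "G t = cmean f z (t *\<^sub>R x)" for t
  \<comment> \<open>the radii of the circles that meet \<open>P\<close>\<close>
  define T where "T = dist z ` P"
  have T: "finite T" using P by (simp add: T_def)
  define b where "b t = B + (C * kint / (2*pi)) * t powr (-3/4)" for t
  have avoid: "z + t *\<^sub>R rot \<theta> x \<in> cball z s - P" if "0 < t" "t \<le> s" "t \<notin> T" for t \<theta>
  proof -
    have "dist z (z + t *\<^sub>R rot \<theta> x) = t" using x that by (simp add: dist_norm)
    then show ?thesis using that by (force simp: T_def)
  qed
  have ex: "\<exists>D. (G has_vector_derivative D) (at t) \<and> norm D \<le> b t" if t: "t \<in> {0<..<s} - T" for t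
  proof -
    have "open ({0<..<s} - T)" using T by (intro open_Diff finite_imp_closed) auto
    then obtain e where e: "e > 0" "ball t e \<subseteq> {0<..<s} - T" using t open_contains_ball by blast
    have sub: "{t-e<..<t+e} \<subseteq> {0<..<s} - T" using e(2) by (simp add: ball_eq_greaterThanLessThan)
    have "0 \<le> t - e"
    proof (rule ccontr)
      assume "\<not> 0 \<le> t - e"
      then have "0 \<in> {t-e<..<t+e}" using t e(1) by auto
      from subsetD[OF sub this] show False by simp
    qed
    have inU: "z + \<tau> *\<^sub>R rot \<theta> x \<in> U - P" if "\<tau> \<in> {t-e<..<t+e}" for \<tau> \<theta>
    proof -
      have "\<tau> \<in> {0<..<s} - T" using sub that by blast
      then show ?thesis using avoid[of \<tau> \<theta>] s by auto
    qed
    have "t \<in> {t-e<..<t+e}" using e(1) by simp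
    from cmean_has_vector_derivative[OF f x this \<open>0 \<le> t - e\<close> inU]
    obtain D where D: "(G has_vector_derivative D) (at t)"
      "norm D \<le> (1 / (2 * pi)) * integral {0..2*pi} (\<lambda>\<theta>. norm (dbar f (z + t *\<^sub>R rot \<theta> x)))"
      unfolding G_def by blast
    let ?S = "{0..2*pi} - Z"
    let ?h = "\<lambda>\<theta>. B + C * (t powr (-3/4) * kern (\<theta> + \<alpha>))"
    have sp: "integral ?S g = integral {0..2*pi} g" for g :: "real \<Rightarrow> real"
      by (rule integral_spike_set) (auto intro: negligible_subset[OF negligible_finite[OF Z]])
    have spi: "g integrable_on ?S" if "g integrable_on {0..2*pi}" for g :: "real \<Rightarrow> real"
      using that by (rule integrable_spike_set) (auto intro: negligible_subset[OF negligible_finite[OF Z]])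
    have hI: "?h integrable_on {0..2*pi}"
      by (intro integrable_on_mult_right integrable_add kern_shift_integrable) auto
    have "continuous_on {0..2*pi} (\<lambda>\<theta>. dbar f (z + t *\<^sub>R rot \<theta> x))"
      by (rule continuous_on_compose2[OF C1_on_dbar_continuous[OF f]])
        (use avoid[of t] t s in \<open>auto intro!: continuous_intros\<close>)
    then have gI: "(\<lambda>\<theta>. norm (dbar f (z + t *\<^sub>R rot \<theta> x))) integrable_on {0..2*pi}"
      by (intro integrable_continuous_real continuous_intros)
    have "integral ?S (\<lambda>\<theta>. norm (dbar f (z + t *\<^sub>R rot \<theta> x))) \<le> integral ?S ?h"
    proof (rule integral_le[OF spi[OF gI] spi[OF hI]])
      fix \<theta> assume \<theta>: "\<theta> \<in> ?S"
      have "norm (z + t *\<^sub>R rot \<theta> x) powr (-3/4) \<le> t powr (-3/4) * kern (\<theta> + \<alpha>)"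
        using \<theta> t \<alpha> by (intro powr_circle_bound) (auto simp: Z_def)
      then have "C * norm (z + t *\<^sub>R rot \<theta> x) powr (-3/4) \<le> C * (t powr (-3/4) * kern (\<theta> + \<alpha>))"
        using C by (rule mult_left_mono)
      moreover have "norm (dbar f (z + t *\<^sub>R rot \<theta> x)) \<le> B + C * norm (z + t *\<^sub>R rot \<theta> x) powr (-3/4)"
        using avoid[of t \<theta>] t by (intro gb) auto
      ultimately show "norm (dbar f (z + t *\<^sub>R rot \<theta> x)) \<le> ?h \<theta>" by linarith
    qed
    also have "integral ?S ?h = integral {0..2*pi} ?h" by (rule sp)
    also have "\<dots> = 2*pi*B + C * (t powr (-3/4) * integral {0..2*pi} (\<lambda>\<theta>. kern (\<theta> + \<alpha>)))"
      by (subst integral_add) (auto intro!: integrable_on_mult_right kern_shift_integrable)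
    also have "\<dots> \<le> 2*pi*B + C * (t powr (-3/4) * kint)"
      using C \<alpha> by (intro add_left_mono mult_left_mono kern_shift_integral_le) auto
    finally have "integral {0..2*pi} (\<lambda>\<theta>. norm (dbar f (z + t *\<^sub>R rot \<theta> x))) \<le> 2*pi*B + C * (t powr (-3/4) * kint)"
      unfolding sp .
    then have "(1/(2*pi)) * integral {0..2*pi} (\<lambda>\<theta>. norm (dbar f (z + t *\<^sub>R rot \<theta> x)))
        \<le> (1/(2*pi)) * (2*pi*B + C * (t powr (-3/4) * kint))"
      by (intro mult_left_mono) auto
    also have "\<dots> = b t" by (simp add: b_def field_simps)
    finally show ?thesis using D by fastforce
  qed
  define D where "D t = (if t \<in> {0<..<s} - T then SOME D. (G has_vector_derivative D) (at t) \<and> norm D \<le> b t else 0)" for t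
  have D: "(G has_vector_derivative D t) (at t)" "norm (D t) \<le> b t" if "t \<in> {0<..<s} - T" for t
    using someI_ex[OF ex[OF that]] that by (auto simp: D_def)
  have cG: "continuous_on {0..s} G"
    unfolding G_def by (rule cmean_continuous[OF C1_on_continuous[OF f] U P s(1) z x fb])
  have FTC: "(D has_integral (G s - G 0)) {0..s}"
    using T s(2) D(1) cG by (intro fundamental_theorem_of_calculus_interior_strong) auto
  let ?S = "{0<..<s} - T"
  have neg: "negligible ({0..s} - ?S)"
  proof -
    have "{0..s} - ?S \<subseteq> insert 0 (insert s T)" by auto
    moreover have "negligible (insert 0 (insert s T))" using T by (intro negligible_finite) auto
    ultimately show ?thesis using negligible_subset by blast
  qed
  have b: "(b has_integral (s * B + sing_const * C * s powr (1/4))) {0..s}"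
  proof -
    have "(b has_integral (s * B + (C * kint / (2*pi)) * (4 * s powr (1/4)))) {0..s}"
      unfolding b_def using has_integral_const_real[of B 0 s] s(2)
      by (intro has_integral_add has_integral_mult_right powr_has_integral) auto
    moreover have "s * B + (C * kint / (2*pi)) * (4 * s powr (1/4)) = s * B + sing_const * C * s powr (1/4)"
      by (simp add: sing_const_def)
    ultimately show ?thesis by metis
  qed
  have spike: "(g has_integral I) {0..s} \<longleftrightarrow> (g has_integral I) ?S" for g :: "real \<Rightarrow> 'c::banach" and I
    by (rule has_integral_spike_set_eq) (auto intro: negligible_subset[OF neg])
  have "norm (G s - G 0) \<le> s * B + sing_const * C * s powr (1/4)"
  proof -
    have "(D has_integral (G s - G 0)) ?S" using FTC spike by blast
    moreover have "(b has_integral (s * B + sing_const * C * s powr (1/4))) ?S" using b spike by blast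
    ultimately show ?thesis
      using integral_norm_bound_integral[of D ?S b] D(2) by (metis has_integral_iff)
  qed
  moreover have "G 0 = f z" by (simp add: G_def cmean_def rot_scaleR)
  ultimately show ?thesis by (simp add: G_def)
qed

section \<open>Averages over disks\<close>

text \<open>
  A rotation is a product of three shears, which preserve plane Lebesgue measure by translation
  invariance on lines.
\<close>

lemma nn_integral_shear_x:
  assumes [measurable]: "f \<in> borel_measurable (borel :: (real \<times> real) measure)"
  shows "(\<integral>\<^sup>+p. f (fst p + a * snd p, snd p) \<partial>lborel) = (\<integral>\<^sup>+p. f p \<partial>lborel)"
proof -
  have [measurable]: "(\<lambda>p. f (fst p + a * snd p, snd p)) \<in> borel_measurable borel"
    by (rule measurable_compose[OF _ assms]) (intro borel_measurable_continuous_onI continuous_intros)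
  have "(\<integral>\<^sup>+p. f (fst p + a * snd p, snd p) \<partial>lborel) = (\<integral>\<^sup>+y. \<integral>\<^sup>+x. f (x + a * y, y) \<partial>lborel \<partial>lborel)"
    unfolding lborel_prod[symmetric]
    by (subst lborel_pair.nn_integral_snd[symmetric]) (simp_all add: lborel_prod)
  also have "\<dots> = (\<integral>\<^sup>+y. \<integral>\<^sup>+x. f (x, y) \<partial>lborel \<partial>lborel)"
    using nn_integral_real_affine[of "\<lambda>x. f (x, y)" 1 "a * y" for y]
    by (simp add: add.commute)
  also have "\<dots> = (\<integral>\<^sup>+p. f p \<partial>lborel)"
    unfolding lborel_prod[symmetric]
    by (subst lborel_pair.nn_integral_snd) (simp_all add: lborel_prod)
  finally show ?thesis .
qed

lemma nn_integral_shear_y: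
  assumes [measurable]: "f \<in> borel_measurable (borel :: (real \<times> real) measure)"
  shows "(\<integral>\<^sup>+p. f (fst p, snd p + a * fst p) \<partial>lborel) = (\<integral>\<^sup>+p. f p \<partial>lborel)"
proof -
  have [measurable]: "(\<lambda>p. f (fst p, snd p + a * fst p)) \<in> borel_measurable borel"
    by (rule measurable_compose[OF _ assms]) (intro borel_measurable_continuous_onI continuous_intros)
  have "(\<integral>\<^sup>+p. f (fst p, snd p + a * fst p) \<partial>lborel) = (\<integral>\<^sup>+x. \<integral>\<^sup>+y. f (x, y + a * x) \<partial>lborel \<partial>lborel)"
    unfolding lborel_prod[symmetric]
    by (subst lborel.nn_integral_fst[symmetric]) (simp_all add: lborel_prod)
  also have "\<dots> = (\<integral>\<^sup>+x. \<integral>\<^sup>+y. f (x, y) \<partial>lborel \<partial>lborel)"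
    using nn_integral_real_affine[of "\<lambda>y. f (x, y)" 1 "a * x" for x]
    by (simp add: add.commute)
  also have "\<dots> = (\<integral>\<^sup>+p. f p \<partial>lborel)"
    unfolding lborel_prod[symmetric]
    by (subst lborel.nn_integral_fst) (simp_all add: lborel_prod)
  finally show ?thesis .
qed

lemma rot_measurable [measurable]: "rot \<theta> \<in> borel_measurable borel"
proof -
  have "continuous_on UNIV (rot \<theta>)"
    using continuous_on_rot[of UNIV "\<lambda>_. \<theta>" "\<lambda>x. x"] by (simp add: continuous_on_const)
  then show ?thesis by (rule borel_measurable_continuous_onI)
qed

lemma nn_integral_rot:
  assumes [measurable]: "f \<in> borel_measurable (borel :: (real \<times> real) measure)"
  shows "(\<integral>\<^sup>+p. f (rot \<theta> p) \<partial>lborel) = (\<integral>\<^sup>+p. f p \<partial>lborel)"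
proof -
  have 1: "(\<integral>\<^sup>+p. f (rot \<theta> p) \<partial>lborel) = (\<integral>\<^sup>+p. f p \<partial>lborel)"
    if [measurable]: "f \<in> borel_measurable borel" and c: "cos (\<theta>/2) \<noteq> 0" for f :: "real \<times> real \<Rightarrow> ennreal" and \<theta>
  proof -
    define t where "t = - tan (\<theta>/2)"
    define s where "s = sin \<theta>"
    define f1 where "f1 p = f (fst p + t * snd p, snd p)" for p
    define f2 where "f2 p = f1 (fst p, snd p + s * fst p)" for p
    have f1 [measurable]: "f1 \<in> borel_measurable borel" unfolding f1_def
      by (rule measurable_compose[OF _ that(1)]) (intro borel_measurable_continuous_onI continuous_intros)
    have [measurable]: "f2 \<in> borel_measurable borel" unfolding f2_def
      by (rule measurable_compose[OF _ f1]) (intro borel_measurable_continuous_onI continuous_intros)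
    have sc: "sin \<theta> = 2 * sin (\<theta>/2) * cos (\<theta>/2)" "cos \<theta> = 1 - 2 * (sin (\<theta>/2))\<^sup>2"
      using sin_double[of "\<theta>/2"] cos_double_sin[of "\<theta>/2"] by simp_all
    have ts: "1 + t * s = cos \<theta>"
      using c unfolding t_def s_def sc by (simp add: tan_def field_simps power2_eq_square)
    have "t + (t + t * (s * t)) = - sin \<theta>"
    proof -
      have "t * (1 + cos \<theta>) = - sin \<theta>"
        using c cos_double_cos[of "\<theta>/2"] unfolding t_def sc(1) by (simp add: tan_def power2_eq_square)
      moreover have "t + (t + t * (s * t)) = t * (1 + (1 + t * s))" by (simp add: algebra_simps)
      ultimately show ?thesis using ts by simp
    qed
    note tts = this[folded s_def]
    have r: "rot \<theta> p = (let q = (fst p + t * snd p, snd p); q' = (fst q, snd q + s * fst q) in (fst q' + t * snd q', snd q'))" for p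
    proof -
      have "fst p + t * snd p + t * (snd p + s * (fst p + t * snd p)) = (1 + t * s) * fst p + (t + (t + t * (s * t))) * snd p"
        by algebra
      moreover have "snd p + s * (fst p + t * snd p) = s * fst p + (1 + t * s) * snd p" by algebra
      ultimately show ?thesis unfolding tts ts by (simp add: rot_def Let_def s_def)
    qed
    have "(\<integral>\<^sup>+p. f (rot \<theta> p) \<partial>lborel) = (\<integral>\<^sup>+p. f2 (fst p + t * snd p, snd p) \<partial>lborel)"
      unfolding r f2_def f1_def Let_def by simp
    also have "\<dots> = (\<integral>\<^sup>+p. f2 p \<partial>lborel)" by (rule nn_integral_shear_x) measurable
    also have "\<dots> = (\<integral>\<^sup>+p. f1 p \<partial>lborel)" unfolding f2_def by (rule nn_integral_shear_y[OF f1])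
    also have "\<dots> = (\<integral>\<^sup>+p. f p \<partial>lborel)" unfolding f1_def by (rule nn_integral_shear_x[OF that(1)])
    finally show ?thesis .
  qed
  show ?thesis
  proof (cases "cos (\<theta>/2) = 0")
    case True
    \<comment> \<open>the first shear is undefined; rotate twice by half the angle\<close>
    then have c: "cos (\<theta>/2/2) \<noteq> 0" using cos_double_cos[of "\<theta>/2/2"] by auto
    have "rot \<theta> p = rot (\<theta>/2) (rot (\<theta>/2) p)" for p
    proof -
      have "cos \<theta> = cos (\<theta>/2) * cos (\<theta>/2) - sin (\<theta>/2) * sin (\<theta>/2)" "sin \<theta> = sin (\<theta>/2) * cos (\<theta>/2) + cos (\<theta>/2) * sin (\<theta>/2)"
        using cos_add[of "\<theta>/2" "\<theta>/2"] sin_add[of "\<theta>/2" "\<theta>/2"] by simp_all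
      then show ?thesis unfolding rot_def prod_eq_iff fst_conv snd_conv by algebra
    qed
    then show ?thesis using 1[of "\<lambda>p. f (rot (\<theta>/2) p)" "\<theta>/2"] 1[of f "\<theta>/2"] c by simp
  qed (use 1 assms in blast)
qed

lemma lborel_distr_rot: "distr lborel borel (rot \<theta>) = lborel"
proof (rule measure_eqI)
  fix A assume A: "A \<in> sets (distr lborel borel (rot \<theta>))"
  then have [measurable]: "A \<in> sets borel" by simp
  have "emeasure (distr lborel borel (rot \<theta>)) A = (\<integral>\<^sup>+p. indicator A p \<partial>distr lborel borel (rot \<theta>))"
    using A by simp
  also have "\<dots> = (\<integral>\<^sup>+p. indicator A (rot \<theta> p) \<partial>lborel)"
    by (subst nn_integral_distr) auto
  also have "\<dots> = emeasure lborel A" by (subst nn_integral_rot) auto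
  finally show "emeasure (distr lborel borel (rot \<theta>)) A = emeasure lborel A" .
qed simp

lemma integral_rot:
  fixes f :: "real \<times> real \<Rightarrow> complex"
  assumes [measurable]: "f \<in> borel_measurable borel"
  shows "(LINT p|lborel. f (rot \<theta> p)) = (LINT p|lborel. f p)"
proof -
  have "(LINT p|distr lborel borel (rot \<theta>). f p) = (LINT p|lborel. f (rot \<theta> p))"
    by (subst integral_distr) auto
  then show ?thesis by (simp add: lborel_distr_rot)
qed

text \<open>
  The integral of \<open>f\<close> over the disk of radius \<open>s\<close> about \<open>z\<close>.
\<close>

definition disk_int :: "(real \<times> real \<Rightarrow> complex) \<Rightarrow> real \<times> real \<Rightarrow> real \<Rightarrow> complex" where
  "disk_int f z s = (LINT w:ball z s|lborel. f w)"

text \<open>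
  The area of the unit disk; its value is not needed.
\<close>

definition unit_area :: real where "unit_area = measure lborel (ball (0::real \<times> real) 1)"

lemma unit_area_pos: "0 < unit_area"
  unfolding unit_area_def by (rule content_ball_pos) simp

lemma content_disk: "0 \<le> s \<Longrightarrow> measure lborel (ball (z::real \<times> real) s) = unit_area * s\<^sup>2"
  using content_ball_conv_unit_ball[of s z] by (simp add: unit_area_def power2_eq_square)

lemma emeasure_disk_finite: "emeasure lborel (ball (z::real \<times> real) s) < \<infinity>"
  using emeasure_bounded_finite[of "ball z s"] by simp

lemma disk_int_cong_finite:
  assumes "finite P" "\<And>w. w \<notin> P \<Longrightarrow> f w = g w"
  shows "disk_int f z s = disk_int g z s"
  unfolding disk_int_def set_lebesgue_integral_def
  by (rule integral_discrete_difference[of P]) (use assms in \<open>auto simp: countable_finite\<close>)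

lemma set_integrable_disk:
  fixes f :: "real \<times> real \<Rightarrow> complex"
  assumes f: "continuous_on (U - P) f" and U: "open U" and P: "finite P" and s: "ball z s \<subseteq> U"
    and M: "\<And>w. w \<in> ball z s - P \<Longrightarrow> norm (f w) \<le> M"
  shows "set_integrable lborel (ball z s) f"
proof -
  let ?B = "ball z s - P"
  have B: "?B \<in> sets borel" using P by (intro borel_open open_Diff finite_imp_closed) auto
  have "integrable lborel (\<lambda>w. indicator ?B w *\<^sub>R f w)"
  proof (rule integrableI_bounded_set[where A = ?B and B = M])
    show "(\<lambda>w. indicator ?B w *\<^sub>R f w) \<in> borel_measurable lborel"
      using borel_measurable_continuous_on_indicator[OF B, of f] f s
      by (simp add: continuous_on_subset Diff_mono)
    have "emeasure lborel ?B \<le> emeasure lborel (ball z s)" by (rule emeasure_mono) auto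
    then show "emeasure lborel ?B < \<infinity>" using emeasure_disk_finite order_le_less_trans by blast
  qed (use B M in auto)
  moreover have "integrable lborel (\<lambda>w. indicator ?B w *\<^sub>R f w) \<longleftrightarrow> integrable lborel (\<lambda>w. indicator (ball z s) w *\<^sub>R f w)"
    by (rule integrable_discrete_difference[of P]) (use P in \<open>auto simp: countable_finite split: split_indicator\<close>)
  ultimately show ?thesis by (simp add: set_integrable_def)
qed

lemma disk_int_translate: "disk_int (\<lambda>w. f (w + h)) z s = disk_int f (z + h) s"
proof -
  have ind: "indicator (ball (z + h) s) (h + w) = (indicator (ball z s) w :: real)" for w
    by (auto simp: dist_norm algebra_simps split: split_indicator)
  have "disk_int f (z + h) s = (LINT w|distr lborel borel ((+) h). indicator (ball (z + h) s) w *\<^sub>R f w)"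
    by (simp add: disk_int_def set_lebesgue_integral_def lborel_distr_plus)
  also have "\<dots> = (LINT w|lborel. indicator (ball (z + h) s) (h + w) *\<^sub>R f (h + w))"
  proof (cases "(\<lambda>w. indicator (ball (z + h) s) w *\<^sub>R f w) \<in> borel_measurable borel")
    case True
    then show ?thesis by (subst integral_distr) auto
  next
    case False
    \<comment> \<open>both integrals have the default value zero\<close>
    have "\<not> integrable (distr lborel borel ((+) h)) (\<lambda>w. indicator (ball (z + h) s) w *\<^sub>R f w)"
      using False by (auto simp: lborel_distr_plus)
    moreover have "\<not> integrable lborel (\<lambda>w. indicator (ball (z + h) s) (h + w) *\<^sub>R f (h + w))"
    proof
      assume "integrable lborel (\<lambda>w. indicator (ball (z + h) s) (h + w) *\<^sub>R f (h + w))"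
      then have "(\<lambda>w. indicator (ball (z + h) s) (h + w) *\<^sub>R f (h + w)) \<in> borel_measurable borel" by auto
      then have "(\<lambda>w. indicator (ball (z + h) s) (h + (w - h)) *\<^sub>R f (h + (w - h))) \<in> borel_measurable borel"
        by (rule measurable_compose_rev) measurable
      then show False using False by simp
    qed
    ultimately show ?thesis by (simp add: not_integrable_integral_eq)
  qed
  also have "\<dots> = disk_int (\<lambda>w. f (w + h)) z s"
    unfolding disk_int_def set_lebesgue_integral_def ind by (simp add: add.commute)
  finally show ?thesis ..
qed

text \<open>
  By rotation invariance the integral over a disk is the integral of the circle means, so a bound for
  the latter passes to the former.
\<close>

lemma disk_int_circle_means:
  fixes f :: "real \<times> real \<Rightarrow> complex"
  assumes meas: "(\<lambda>w. indicator (ball z s) w *\<^sub>R f w) \<in> borel_measurable borel" and s: "0 \<le> s"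
    and M: "\<And>w. w \<in> ball z s \<Longrightarrow> norm (f w) \<le> M"
    and R: "\<And>v. norm v < s \<Longrightarrow> norm (cmean f z v - c) \<le> R"
  shows "norm (disk_int f z s - (unit_area * s\<^sup>2) *\<^sub>R c) \<le> unit_area * s\<^sup>2 * R"
proof -
  define F where "F p = indicator (ball 0 s) p *\<^sub>R f (z + p)" for p
  have F0: "F p = indicator (ball z s) (z + p) *\<^sub>R f (z + p)" for p
    by (auto simp: F_def dist_norm split: split_indicator)
  have [measurable]: "F \<in> borel_measurable borel"
    unfolding F0 by (rule measurable_compose[OF _ meas]) measurable
  have nF: "norm (F p) \<le> \<bar>M\<bar>" for p
    using M[of "z + p"] by (auto simp: F_def dist_norm split: split_indicator)
  have Fout: "F p = 0" if "p \<notin> ball 0 s" for p using that by (simp add: F_def)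
  have Frot: "F (rot \<theta> p) = indicator (ball 0 s) p *\<^sub>R f (z + rot \<theta> p)" for \<theta> p
    by (simp add: F_def indicator_def)
  have iF: "integrable lborel F"
    using emeasure_disk_finite[of 0 s] nF Fout
    by (intro integrableI_bounded_set[where A = "ball 0 s" and B = "\<bar>M\<bar>"]) auto
  have di: "disk_int f z s = (LINT p|lborel. F p)"
  proof -
    have "disk_int f z s = disk_int (\<lambda>p. f (p + z)) 0 s" using disk_int_translate[of f z 0 s] by simp
    then show ?thesis by (simp add: disk_int_def set_lebesgue_integral_def F_def add.commute)
  qed
  define H where "H \<theta> p = indicator {0..2*pi} \<theta> *\<^sub>R F (rot \<theta> p)" for \<theta> p
  have rm: "(\<lambda>x. rot (fst x) (snd x)) \<in> borel_measurable (borel :: (real \<times> real \<times> real) measure)"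
    by (intro borel_measurable_continuous_onI continuous_intros)
  have Hm: "case_prod H \<in> borel_measurable (lborel \<Otimes>\<^sub>M lborel)"
  proof -
    have [measurable]: "(\<lambda>x. F (rot (fst x) (snd x))) \<in> borel_measurable (borel :: (real \<times> real \<times> real) measure)"
      using rm by (rule measurable_compose) measurable
    have [measurable]: "fst \<in> borel_measurable (borel :: (real \<times> real \<times> real) measure)"
      by (intro borel_measurable_continuous_onI continuous_intros)
    have "(\<lambda>x. indicator {0..2*pi} (fst x) *\<^sub>R F (rot (fst x) (snd x))) \<in> borel_measurable (borel :: (real \<times> real \<times> real) measure)"
      by measurable
    moreover have "case_prod H = (\<lambda>x. indicator {0..2*pi} (fst x) *\<^sub>R F (rot (fst x) (snd x)))"
      by (simp add: fun_eq_iff H_def)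
    ultimately show ?thesis by (simp add: lborel_prod)
  qed
  have Hi: "integrable (lborel \<Otimes>\<^sub>M lborel) (case_prod H)"
  proof (rule integrableI_bounded_set[where A = "{0..2*pi} \<times> ball 0 s" and B = "\<bar>M\<bar>"])
    show "emeasure (lborel \<Otimes>\<^sub>M lborel) ({0..2*pi} \<times> ball (0::real \<times> real) s) < \<infinity>"
      using emeasure_disk_finite[of 0 s] by (subst lborel.emeasure_pair_measure_Times) (auto simp: ennreal_mult_less_top)
    show "AE x in lborel \<Otimes>\<^sub>M lborel. x \<in> {0..2*pi} \<times> ball 0 s \<longrightarrow> norm (case_prod H x) \<le> \<bar>M\<bar>"
      by (intro AE_I2 impI) (auto simp: H_def nF[of "rot _ _"])
    show "AE x in lborel \<Otimes>\<^sub>M lborel. x \<notin> {0..2*pi} \<times> ball 0 s \<longrightarrow> case_prod H x = 0"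
    proof (intro AE_I2 impI)
      fix x :: "real \<times> real \<times> real" assume x: "x \<notin> {0..2*pi} \<times> ball 0 s"
      obtain \<theta> p where [simp]: "x = (\<theta>, p)" by (rule prod.exhaust)
      have "\<theta> \<notin> {0..2*pi} \<or> rot \<theta> p \<notin> ball 0 s" using x by auto
      then show "case_prod H x = 0" using Fout[of "rot \<theta> p"] by (auto simp: H_def)
    qed
  qed (use Hm in auto)
  have "(LINT \<theta>|lborel. (LINT p|lborel. H \<theta> p)) = (LINT \<theta>|lborel. indicator {0..2*pi} \<theta> *\<^sub>R (LINT p|lborel. F p))"
    by (simp add: H_def integral_rot)
  also have "\<dots> = (2*pi) *\<^sub>R (LINT p|lborel. F p)"
    by simp
  finally have 1: "(LINT p|lborel. (LINT \<theta>|lborel. H \<theta> p)) = (2*pi) *\<^sub>R disk_int f z s"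
    using lborel_pair.Fubini_integral[OF Hi] di by simp
  have 2: "(LINT \<theta>|lborel. H \<theta> p) = (2*pi) *\<^sub>R (indicator (ball 0 s) p *\<^sub>R cmean f z p)" for p
  proof -
    have [measurable]: "(\<lambda>\<theta>. rot \<theta> p) \<in> borel_measurable borel"
      by (intro borel_measurable_continuous_onI continuous_intros)
    have [measurable]: "(\<lambda>\<theta>. F (rot \<theta> p)) \<in> borel_measurable borel" by measurable
    have "set_integrable lborel {0..2*pi} (\<lambda>\<theta>. F (rot \<theta> p))"
      unfolding set_integrable_def
      by (rule integrableI_bounded_set[where A = "{0..2*pi}" and B = "\<bar>M\<bar>"])
        (use nF in \<open>auto split: split_indicator\<close>)
    then have "(LINT \<theta>|lborel. H \<theta> p) = integral {0..2*pi} (\<lambda>\<theta>. F (rot \<theta> p))"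
      using set_borel_integral_eq_integral(2) by (simp add: H_def set_lebesgue_integral_def)
    then show ?thesis
      unfolding Frot by (cases "p \<in> ball 0 s") (simp_all add: cmean_def)
  qed
  have int1: "integrable lborel (\<lambda>p. indicator (ball 0 s) p *\<^sub>R cmean f z p)"
  proof -
    have "integrable lborel (\<lambda>p. (LINT \<theta>|lborel. H \<theta> p))"
      using lborel_pair.integrable_snd[OF Hi] by simp
    then have "integrable lborel (\<lambda>p. (1/(2*pi)) *\<^sub>R (LINT \<theta>|lborel. H \<theta> p))" by (rule integrable_scaleR_right)
    then show ?thesis unfolding 2 by simp
  qed
  have int2: "integrable lborel (\<lambda>p. indicator (ball (0::real \<times> real) s) p *\<^sub>R c)"
    using emeasure_disk_finite[of 0 s] by (intro integrable_scaleR_left) (auto intro!: integrable_real_indicator)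
  have "disk_int f z s = (LINT p|lborel. indicator (ball 0 s) p *\<^sub>R cmean f z p)"
  proof -
    have "(2*pi) *\<^sub>R (LINT p|lborel. indicator (ball 0 s) p *\<^sub>R cmean f z p) = (2*pi) *\<^sub>R disk_int f z s"
      using 1 unfolding 2 integral_scaleR_right .
    then show ?thesis by (simp only: scaleR_cancel_left) simp
  qed
  moreover have "(unit_area * s\<^sup>2) *\<^sub>R c = (LINT p|lborel. indicator (ball (0::real \<times> real) s) p *\<^sub>R c)"
  proof -
    have "integrable lborel (indicator (ball (0::real \<times> real) s) :: _ \<Rightarrow> real)"
      using emeasure_disk_finite[of 0 s] by (intro integrable_real_indicator) auto
    then have "(LINT p|lborel. indicator (ball (0::real \<times> real) s) p *\<^sub>R c) = (LINT p|lborel. indicator (ball (0::real \<times> real) s) p) *\<^sub>R c"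
      by (intro integral_scaleR_left)
    then show ?thesis using content_disk[OF s, of 0] by simp
  qed
  ultimately have "disk_int f z s - (unit_area * s\<^sup>2) *\<^sub>R c
      = (LINT p|lborel. indicator (ball 0 s) p *\<^sub>R (cmean f z p - c))"
    using Bochner_Integration.integral_diff[OF int1 int2] by (simp add: scaleR_diff_right)
  also have "norm \<dots> \<le> (LINT p|lborel. indicator (ball (0::real \<times> real) s) p *\<^sub>R R)"
  proof (rule Bochner_Integration.integral_norm_bound_integral)
    show "integrable lborel (\<lambda>p. indicator (ball 0 s) p *\<^sub>R (cmean f z p - c))"
      using Bochner_Integration.integrable_diff[OF int1 int2] by (simp add: scaleR_diff_right)
    show "integrable lborel (\<lambda>p. indicator (ball (0::real \<times> real) s) p *\<^sub>R R)"
      using emeasure_disk_finite[of 0 s] by (intro integrable_scaleR_left) (auto intro!: integrable_real_indicator)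
    show "norm (indicator (ball 0 s) p *\<^sub>R (cmean f z p - c)) \<le> indicator (ball (0::real \<times> real) s) p *\<^sub>R R" for p
      using R[of p] by (auto split: split_indicator)
  qed
  also have "\<dots> = unit_area * s\<^sup>2 * R"
    using content_disk[OF s, of 0] by simp
  finally show ?thesis .
qed

text \<open>
  The average of \<open>f\<close> over the disk of radius \<open>s\<close> about \<open>z\<close>.
\<close>

definition disk_avg :: "(real \<times> real \<Rightarrow> complex) \<Rightarrow> real \<times> real \<Rightarrow> real \<Rightarrow> complex" where
  "disk_avg f z s = (1 / (unit_area * s\<^sup>2)) *\<^sub>R disk_int f z s"

lemma partial_cong_open:
  assumes "open S" "z \<in> S" "\<And>w. w \<in> S \<Longrightarrow> f w = g w"
  shows "f differentiable (at z) \<longleftrightarrow> g differentiable (at z)"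
    and "partial_x f z = partial_x g z" "partial_y f z = partial_y g z"
proof -
  have h: "(f has_derivative D) (at z) \<longleftrightarrow> (g has_derivative D) (at z)" for D
    using has_derivative_transform_within_open[of f D z UNIV S g] has_derivative_transform_within_open[of g D z UNIV S f] assms
    by auto
  then show "f differentiable (at z) \<longleftrightarrow> g differentiable (at z)" by (simp add: differentiable_def)
  show "partial_x f z = partial_x g z" "partial_y f z = partial_y g z"
    unfolding partial_x_def partial_y_def frechet_derivative_def h by simp_all
qed

lemma C1_on_cong:
  assumes S: "open S" and eq: "\<And>w. w \<in> S \<Longrightarrow> f w = g w"
  shows "C1_on f S \<longleftrightarrow> C1_on g S"
proof -
  have p: "f differentiable (at z) \<longleftrightarrow> g differentiable (at z)"
    "partial_x f z = partial_x g z" "partial_y f z = partial_y g z" if "z \<in> S" for z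
    using partial_cong_open[OF S that, of f g] eq by auto
  have "continuous_on S (partial_x f) \<longleftrightarrow> continuous_on S (partial_x g)"
    "continuous_on S (partial_y f) \<longleftrightarrow> continuous_on S (partial_y g)"
    using p(2,3) by (auto intro!: continuous_on_cong)
  then show ?thesis unfolding C1_on_def using p(1) by simp
qed

lemma dbar_cong:
  assumes "open S" "z \<in> S" "\<And>w. w \<in> S \<Longrightarrow> f w = g w"
  shows "dbar f z = dbar g z"
  using partial_cong_open[OF assms] by (simp add: dbar_def)

lemma disk_avg_bound:
  assumes f: "C1_on f (U - P)" and U: "open U" and P: "finite P"
    and s: "cball z s \<subseteq> U" "0 < s" and z: "z \<notin> P"
    and fM: "\<And>w. w \<in> cball z s - P \<Longrightarrow> norm (f w) \<le> M"
    and gb: "\<And>w. w \<in> cball z s - P \<Longrightarrow> norm (dbar f w) \<le> B + C * norm w powr (-3/4)"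
    and B: "0 \<le> B" and C: "0 \<le> C"
  shows "norm (disk_avg f z s - f z) \<le> s * B + sing_const * C * s powr (1/4)"
proof -
  \<comment> \<open>the values on \<open>P\<close> are arbitrary but do not affect the average\<close>
  define f0 where "f0 w = (if w \<in> P then 0 else f w)" for w
  have opn: "open (U - P)" using U P by (simp add: finite_imp_closed open_Diff)
  have M: "0 \<le> M" using order_trans[OF norm_ge_zero fM[of z]] z s by simp
  have f0: "C1_on f0 (U - P)"
    using f C1_on_cong[OF opn, of f0 f] by (simp add: f0_def)
  have dbar0: "dbar f0 w = dbar f w" if "w \<in> U - P" for w
    using dbar_cong[OF opn that, of f0 f] by (simp add: f0_def)
  have f0z: "f0 z = f z" using z by (simp add: f0_def)
  let ?R = "s * B + sing_const * C * s powr (1/4)"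
  have R: "norm (cmean f0 z v - f z) \<le> ?R" if v: "norm v < s" for v
  proof (cases "v = 0")
    case True
    have "0 \<le> ?R" using B C s sing_const_nonneg by auto
    then show ?thesis using True f0z by (simp add: cmean_def)
  next
    case False
    have sub: "cball z (norm v) \<subseteq> cball z s" using v by auto
    have "norm (cmean f0 z (norm v *\<^sub>R ((1 / norm v) *\<^sub>R v)) - f0 z) \<le> norm v * B + sing_const * C * norm v powr (1/4)"
    proof (rule cmean_bound[OF f0 U P])
      fix w assume w: "w \<in> cball z (norm v) - P"
      then have "norm (f0 w) \<le> M" using fM[of w] sub by (auto simp: f0_def)
      also have "\<dots> \<le> M * (1 + norm w powr (-3/4))" using M by (simp add: mult_le_cancel_left1)
      finally show "norm (f0 w) \<le> M * (1 + norm w powr (-3/4))" .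
      have "w \<in> cball z s - P" "w \<in> U - P" using w sub s by blast+
      then show "norm (dbar f0 w) \<le> B + C * norm w powr (-3/4)" using gb[of w] dbar0[of w] by simp
    qed (use False z C sub s in auto)
    also have "\<dots> \<le> ?R"
      using v B C sing_const_nonneg by (intro add_mono mult_right_mono mult_left_mono powr_mono2) auto
    finally show ?thesis using False f0z by simp
  qed
  have Bm: "ball z s - P \<in> sets borel" using P by (intro borel_open open_Diff finite_imp_closed) auto
  have meas: "(\<lambda>w. indicator (ball z s) w *\<^sub>R f0 w) \<in> borel_measurable borel"
  proof -
    have "(\<lambda>w. indicator (ball z s) w *\<^sub>R f0 w) = (\<lambda>w. indicator (ball z s - P) w *\<^sub>R f w)"
      by (auto simp: f0_def split: split_indicator)
    moreover have "continuous_on (ball z s - P) f"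
      using C1_on_continuous[OF f] by (rule continuous_on_subset) (use s in auto)
    ultimately show ?thesis using borel_measurable_continuous_on_indicator[OF Bm] by metis
  qed
  have "norm (disk_int f0 z s - (unit_area * s\<^sup>2) *\<^sub>R f z) \<le> unit_area * s\<^sup>2 * ?R"
  proof (rule disk_int_circle_means[OF meas _ _ R])
    show "norm (f0 w) \<le> M" if "w \<in> ball z s" for w
      using fM[of w] that M by (auto simp: f0_def)
  qed (use s in auto)
  moreover have "disk_int f0 z s = disk_int f z s"
    by (rule disk_int_cong_finite[OF P]) (simp add: f0_def)
  moreover have "disk_avg f z s - f z = (1 / (unit_area * s\<^sup>2)) *\<^sub>R (disk_int f z s - (unit_area * s\<^sup>2) *\<^sub>R f z)"
    using unit_area_pos s by (simp add: disk_avg_def scaleR_diff_right)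
  ultimately show ?thesis
    using unit_area_pos s by (simp add: pos_divide_le_eq mult.commute)
qed

text \<open>
  Two disks of radius \<open>s\<close> whose centres are at distance \<open>d\<close> differ by a set of area at most
  \<open>4 s d\<close> times the area of the unit disk.
\<close>

lemma disk_avg_shift:
  assumes f: "continuous_on (U - P) f" and U: "open U" and P: "finite P" and s: "0 < s"
    and b: "ball z s \<subseteq> U" and b': "ball z' s \<subseteq> U"
    and M: "\<And>w. w \<in> (ball z s \<union> ball z' s) - P \<Longrightarrow> norm (f w) \<le> M" and M0: "0 \<le> M"
  shows "norm (disk_avg f z s - disk_avg f z' s) \<le> 4 * M * dist z z' / s"
proof -
  define d where "d = dist z z'"
  define f0 where "f0 w = (if w \<in> P then 0 else f w)" for w
  have f0M: "norm (f0 w) \<le> M" if "w \<in> ball z s \<union> ball z' s" for w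
    using M[of w] that M0 by (auto simp: f0_def)
  have c0: "continuous_on (U - P) f0" using f by (rule continuous_on_eq) (simp add: f0_def)
  have f0: "disk_int f x s = disk_int f0 x s" for x
    by (rule disk_int_cong_finite[OF P]) (simp add: f0_def)
  have i: "set_integrable lborel (ball z s) f0" "set_integrable lborel (ball z' s) f0"
    using set_integrable_disk[OF c0 U P b, of M] set_integrable_disk[OF c0 U P b', of M] f0M by auto
  have diff: "measure lborel (ball x s - ball y s) \<le> unit_area * (2 * s * d)" if "dist x y = d" for x y :: "real \<times> real"
  proof -
    define r where "r = max 0 (s - d)"
    have r: "0 \<le> r" "r \<le> s" using s by (auto simp: r_def d_def)
    have sub: "ball x s - ball y s \<subseteq> ball x s - ball x r"
    proof -
      have "dist y w < s" if "dist x w < r" for w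
      proof -
        have "dist y w \<le> dist x y + dist x w" using dist_triangle[of y w x] by (simp add: dist_commute)
        moreover have "dist x w < s - d" using that by (auto simp: r_def split: if_splits) (smt (verit) max_def that r_def zero_le_dist)
        ultimately show ?thesis using \<open>dist x y = d\<close> by simp
      qed
      then show ?thesis by auto
    qed
    have fin: "ball x q \<in> fmeasurable lborel" for q by (rule fmeasurableI) (use emeasure_disk_finite in auto)
    have "measure lborel (ball x s - ball y s) \<le> measure lborel (ball x s - ball x r)"
      using fin by (intro measure_mono_fmeasurable sub fmeasurable.Diff) auto
    also have "\<dots> = measure lborel (ball x s) - measure lborel (ball x r)"
      using emeasure_disk_finite[of x s] r by (intro measure_Diff) auto
    also have "\<dots> = unit_area * (s\<^sup>2 - r\<^sup>2)" using r s by (simp add: content_disk right_diff_distrib)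
    also have "\<dots> \<le> unit_area * (2 * s * d)"
    proof (rule mult_left_mono)
      have "s\<^sup>2 - r\<^sup>2 = (s + r) * (s - r)" by algebra
      also have "\<dots> \<le> (2 * s) * d"
        using r s by (intro mult_mono) (auto simp: r_def d_def)
      finally show "s\<^sup>2 - r\<^sup>2 \<le> 2 * s * d" by simp
    qed (use unit_area_pos in auto)
    finally show ?thesis .
  qed
  let ?D = "(ball z s - ball z' s) \<union> (ball z' s - ball z s)"
  have fin: "ball x s - ball y s \<in> fmeasurable lborel" for x y :: "real \<times> real"
    by (intro fmeasurable.Diff fmeasurableI) (use emeasure_disk_finite in auto)
  have finD: "?D \<in> fmeasurable lborel" using fin by blast
  have "disk_int f z s - disk_int f z' s = (LINT w|lborel. indicator (ball z s) w *\<^sub>R f0 w - indicator (ball z' s) w *\<^sub>R f0 w)"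
    unfolding f0 unfolding disk_int_def set_lebesgue_integral_def
    using i[unfolded set_integrable_def] by (rule Bochner_Integration.integral_diff[symmetric])
  also have "norm \<dots> \<le> (LINT w|lborel. indicator ?D w * M)"
  proof (rule Bochner_Integration.integral_norm_bound_integral)
    show "integrable lborel (\<lambda>w. indicator (ball z s) w *\<^sub>R f0 w - indicator (ball z' s) w *\<^sub>R f0 w)"
      using i[unfolded set_integrable_def] by (rule Bochner_Integration.integrable_diff)
    show "integrable lborel (\<lambda>w. indicator ?D w * M)"
      using finD by (intro integrable_mult_left) (auto simp: fmeasurable_def intro!: integrable_real_indicator)
    show "norm (indicator (ball z s) w *\<^sub>R f0 w - indicator (ball z' s) w *\<^sub>R f0 w) \<le> indicator ?D w * M" for w
      using f0M[of w] M0 by (auto split: split_indicator)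
  qed
  also have "\<dots> = measure lborel ?D * M" using finD by (simp add: fmeasurableD)
  also have "\<dots> \<le> (unit_area * (2 * s * d) + unit_area * (2 * s * d)) * M"
  proof (rule mult_right_mono[OF _ M0])
    have "measure lborel ?D \<le> measure lborel (ball z s - ball z' s) + measure lborel (ball z' s - ball z s)"
      by (rule measure_Un_le) auto
    then show "measure lborel ?D \<le> unit_area * (2 * s * d) + unit_area * (2 * s * d)"
      using diff[of z z'] diff[of z' z] by (simp add: d_def dist_commute)
  qed
  finally have *: "norm (disk_int f z s - disk_int f z' s) \<le> unit_area * s * (4 * M * d)" by (simp add: algebra_simps)
  have "disk_avg f z s - disk_avg f z' s = (1 / (unit_area * s\<^sup>2)) *\<^sub>R (disk_int f z s - disk_int f z' s)"
    by (simp add: disk_avg_def scaleR_diff_right)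
  then have "norm (disk_avg f z s - disk_avg f z' s) = norm (disk_int f z s - disk_int f z' s) / (unit_area * s\<^sup>2)"
    using unit_area_pos by simp
  also have "\<dots> \<le> unit_area * s * (4 * M * d) / (unit_area * s\<^sup>2)"
    using * unit_area_pos by (intro divide_right_mono) auto
  also have "\<dots> = 4 * M * d / s" using unit_area_pos s by (simp add: power2_eq_square)
  finally show ?thesis by (simp add: d_def)
qed

lemma disk_avg_difference:
  assumes f: "continuous_on (U - P) f" and U: "open U" and P: "finite P"
    and b: "ball z s \<subseteq> U" and b': "ball (z + h) s \<subseteq> U"
    and M: "\<And>w. w \<in> (ball z s \<union> ball (z + h) s) - P \<Longrightarrow> norm (f w) \<le> M"
  shows "disk_avg (\<lambda>w. f (w + h) - f w) z s = disk_avg f (z + h) s - disk_avg f z s"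
proof -
  have i: "set_integrable lborel (ball z s) f" "set_integrable lborel (ball (z + h) s) f"
    using set_integrable_disk[OF f U P b, of M] set_integrable_disk[OF f U P b', of M] M by auto
  let ?U = "(\<lambda>w. w - h) ` U" and ?P = "(\<lambda>w. w - h) ` P"
  have U': "open ?U" using open_translation[OF U, of "- h"] by simp
  have "set_integrable lborel (ball z s) (\<lambda>w. f (w + h))"
  proof (rule set_integrable_disk[where U = ?U and P = ?P and M = M])
    show "continuous_on (?U - ?P) (\<lambda>w. f (w + h))"
      by (rule continuous_on_compose2[OF f]) (auto intro!: continuous_intros)
    show "ball z s \<subseteq> ?U"
    proof
      fix w assume "w \<in> ball z s"
      then have "w + h \<in> ball (z + h) s" by (simp add: dist_norm)
      then have "w + h \<in> U" using b' by blast
      then show "w \<in> ?U" by force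
    qed
    fix w assume w: "w \<in> ball z s - ?P"
    then have "w + h \<in> ball (z + h) s - P" by (force simp: dist_norm image_iff)
    then show "norm (f (w + h)) \<le> M" using M by blast
  qed (use U' P in auto)
  then have "disk_int (\<lambda>w. f (w + h) - f w) z s = disk_int (\<lambda>w. f (w + h)) z s - disk_int f z s"
    unfolding disk_int_def using i by (intro set_integral_diff) auto
  then show ?thesis by (simp add: disk_avg_def disk_int_translate scaleR_diff_right)
qed

section \<open>Lipschitz and gradient bounds at a puncture\<close>

lemma partials_add:
  assumes "f differentiable (at z)" "g differentiable (at z)"
  shows "(\<lambda>w. f w + g w) differentiable (at z)"
    and "partial_x (\<lambda>w. f w + g w) z = partial_x f z + partial_x g z"
    and "partial_y (\<lambda>w. f w + g w) z = partial_y f z + partial_y g z"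
proof -
  have h: "((\<lambda>w. f w + g w) has_derivative (\<lambda>v. (fst v *\<^sub>R partial_x f z + snd v *\<^sub>R partial_y f z) +
      (fst v *\<^sub>R partial_x g z + snd v *\<^sub>R partial_y g z))) (at z)"
    using assms by (intro has_derivative_add has_derivative_partials)
  show "(\<lambda>w. f w + g w) differentiable (at z)" using h by (rule differentiableI)
  show "partial_x (\<lambda>w. f w + g w) z = partial_x f z + partial_x g z"
    "partial_y (\<lambda>w. f w + g w) z = partial_y f z + partial_y g z"
    using has_derivative_partials_unique[OF h] by simp_all
qed

lemma partials_linear:
  assumes L: "bounded_linear L" and f: "f differentiable (at z)"
  shows "(\<lambda>w. L (f w)) differentiable (at z)"
    and "partial_x (\<lambda>w. L (f w)) z = L (partial_x f z)"
    and "partial_y (\<lambda>w. L (f w)) z = L (partial_y f z)"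
proof -
  have h: "((\<lambda>w. L (f w)) has_derivative (\<lambda>v. L (fst v *\<^sub>R partial_x f z + snd v *\<^sub>R partial_y f z))) (at z)"
    using bounded_linear.has_derivative[OF L has_derivative_partials[OF f]] .
  show "(\<lambda>w. L (f w)) differentiable (at z)" using h by (rule differentiableI)
  show "partial_x (\<lambda>w. L (f w)) z = L (partial_x f z)" "partial_y (\<lambda>w. L (f w)) z = L (partial_y f z)"
    using has_derivative_partials_unique[OF h] by simp_all
qed

lemma partials_mult:
  fixes f g :: "real \<times> real \<Rightarrow> complex"
  assumes "f differentiable (at z)" "g differentiable (at z)"
  shows "(\<lambda>w. f w * g w) differentiable (at z)"
    and "partial_x (\<lambda>w. f w * g w) z = f z * partial_x g z + partial_x f z * g z"
    and "partial_y (\<lambda>w. f w * g w) z = f z * partial_y g z + partial_y f z * g z"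
proof -
  have h: "((\<lambda>w. f w * g w) has_derivative (\<lambda>v. f z * (fst v *\<^sub>R partial_x g z + snd v *\<^sub>R partial_y g z) +
      (fst v *\<^sub>R partial_x f z + snd v *\<^sub>R partial_y f z) * g z)) (at z)"
    using assms by (intro has_derivative_mult has_derivative_partials)
  show "(\<lambda>w. f w * g w) differentiable (at z)" using h by (rule differentiableI)
  show "partial_x (\<lambda>w. f w * g w) z = f z * partial_x g z + partial_x f z * g z"
    "partial_y (\<lambda>w. f w * g w) z = f z * partial_y g z + partial_y f z * g z"
    using has_derivative_partials_unique[OF h] by simp_all
qed

lemma partials_diff:
  assumes "f differentiable (at z)" "g differentiable (at z)"
  shows "(\<lambda>w. f w - g w) differentiable (at z)"
    and "partial_x (\<lambda>w. f w - g w) z = partial_x f z - partial_x g z"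
    and "partial_y (\<lambda>w. f w - g w) z = partial_y f z - partial_y g z"
proof -
  have h: "((\<lambda>w. f w - g w) has_derivative (\<lambda>v. (fst v *\<^sub>R partial_x f z + snd v *\<^sub>R partial_y f z) -
      (fst v *\<^sub>R partial_x g z + snd v *\<^sub>R partial_y g z))) (at z)"
    using assms by (intro has_derivative_diff has_derivative_partials)
  show "(\<lambda>w. f w - g w) differentiable (at z)" using h by (rule differentiableI)
  show "partial_x (\<lambda>w. f w - g w) z = partial_x f z - partial_x g z"
    "partial_y (\<lambda>w. f w - g w) z = partial_y f z - partial_y g z"
    using has_derivative_partials_unique[OF h] by simp_all
qed

lemma partials_translate:
  fixes f :: "real \<times> real \<Rightarrow> 'b::real_normed_vector"
  assumes "f differentiable (at (z + h))"
  shows "(\<lambda>w. f (w + h)) differentiable (at z)"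
    and "partial_x (\<lambda>w. f (w + h)) z = partial_x f (z + h)"
    and "partial_y (\<lambda>w. f (w + h)) z = partial_y f (z + h)"
proof -
  have "((\<lambda>w. w + h) has_derivative (\<lambda>v. v)) (at z)" by (auto intro!: derivative_eq_intros)
  from has_derivative_compose[OF this has_derivative_partials[OF assms]]
  have h: "((\<lambda>w. f (w + h)) has_derivative (\<lambda>v. fst v *\<^sub>R partial_x f (z + h) + snd v *\<^sub>R partial_y f (z + h))) (at z)" .
  show "(\<lambda>w. f (w + h)) differentiable (at z)" using h by (rule differentiableI)
  show "partial_x (\<lambda>w. f (w + h)) z = partial_x f (z + h)"
    "partial_y (\<lambda>w. f (w + h)) z = partial_y f (z + h)"
    using has_derivative_partials_unique[OF h] by simp_all
qed

lemma C1_on_difference: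
  assumes f: "C1_on f S" and T: "T \<subseteq> S" "\<And>w. w \<in> T \<Longrightarrow> w + h \<in> S"
  shows "C1_on (\<lambda>w. f (w + h) - f w) T"
    and "\<And>w. w \<in> T \<Longrightarrow> dbar (\<lambda>w. f (w + h) - f w) w = dbar f (w + h) - dbar f w"
proof -
  have d: "f differentiable (at w)" "f differentiable (at (w + h))" if "w \<in> T" for w
    using f T that by (auto simp: C1_on_def)
  note tr = partials_translate[OF d(2)]
  note di = partials_diff[OF tr(1) d(1)]
  have px: "partial_x (\<lambda>w. f (w + h) - f w) w = partial_x f (w + h) - partial_x f w"
    and py: "partial_y (\<lambda>w. f (w + h) - f w) w = partial_y f (w + h) - partial_y f w" if "w \<in> T" for w
    using di(2,3)[OF that that] tr(2,3)[OF that] by simp_all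
  have c: "continuous_on T (\<lambda>w. g (w + h) - g w)" if "continuous_on S g" for g :: "real \<times> real \<Rightarrow> complex"
    by (intro continuous_intros continuous_on_compose2[OF that] continuous_on_subset[OF that T(1)])
      (use T(2) in auto)
  have "continuous_on T (partial_x (\<lambda>w. f (w + h) - f w))"
    using c[of "partial_x f"] f px by (subst continuous_on_cong[OF refl px]) (auto simp: C1_on_def)
  moreover have "continuous_on T (partial_y (\<lambda>w. f (w + h) - f w))"
    using c[of "partial_y f"] f py by (subst continuous_on_cong[OF refl py]) (auto simp: C1_on_def)
  ultimately show "C1_on (\<lambda>w. f (w + h) - f w) T"
    using di(1) unfolding C1_on_def by blast
  show "dbar (\<lambda>w. f (w + h) - f w) w = dbar f (w + h) - dbar f w" if "w \<in> T" for w
    unfolding dbar_def px[OF that] py[OF that] by (simp add: algebra_simps)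
qed

text \<open>
  For fixed \<open>h\<close> let \<open>W(w)\<close> be the sum over the family of \<open>\<bar>g(w + h) - g(w)\<bar>\<close>, and \<open>N\<close> the
  supremum of \<open>d(w) W(w)\<close>, where \<open>d(w) = 2\<rho> - \<bar>w\<bar>\<close> is the distance to the boundary. Comparison with
  the averages at scale \<open>d(w)/2\<close> bounds \<open>N\<close> by a multiple of \<open>\<bar>h\<bar>\<close> plus \<open>N/2\<close> if \<open>\<rho>\<close> is small. The
  weight \<open>d\<close> makes \<open>N\<close> finite a priori and lets one absorb the last term.
\<close>

lemma punctured_lipschitz:
  fixes S :: "(real \<times> real \<Rightarrow> complex) set"
  assumes fin: "finite S" and R: "0 < R" and M0: "0 \<le> M" and L0: "0 \<le> L"
    and C1: "\<And>f. f \<in> S \<Longrightarrow> C1_on f (ball 0 R - {0})"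
    and M: "\<And>f w. f \<in> S \<Longrightarrow> w \<in> ball 0 R - {0} \<Longrightarrow> norm (f w) \<le> M"
    and L: "\<And>f w w'. f \<in> S \<Longrightarrow> w \<in> ball 0 R - {0} \<Longrightarrow> w' \<in> ball 0 R - {0} \<Longrightarrow>
      norm (dbar f w - dbar f w') \<le> L * (dist w w' + (\<Sum>g\<in>S. norm (g w - g w')))"
  shows "\<exists>\<rho> C. 0 < \<rho> \<and> \<rho> \<le> R \<and> 0 \<le> C \<and> (\<forall>f\<in>S. \<forall>w\<in>ball 0 \<rho> - {0}. \<forall>w'\<in>ball 0 \<rho> - {0}.
      norm (f w - f w') \<le> C * dist w w')"
proof -
  define N where "N = real (card S)"
  have N0: "0 \<le> N" by (simp add: N_def)
  \<comment> \<open>the second bound makes the contribution of \<open>dbar\<close> at most half of the supremum\<close>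
  define \<rho> where "\<rho> = min (R/4) (1 / (4 * (N * L + 1)))"
  have NL: "0 < N * L + 1" using N0 L0 by (simp add: add_nonneg_pos)
  have \<rho>: "0 < \<rho>" "4 * \<rho> \<le> R" using R NL by (auto simp: \<rho>_def)
  have "\<rho> * (4 * (N * L + 1)) \<le> 1 / (4 * (N * L + 1)) * (4 * (N * L + 1))"
    using NL by (intro mult_right_mono) (auto simp: \<rho>_def)
  also have "\<dots> = 1" using NL by simp
  finally have "\<rho> * (4 * (N * L + 1)) \<le> 1" .
  then have \<rho>NL: "2 * \<rho> * N * L \<le> 1/2" using \<rho> by (simp add: algebra_simps)
  define K where "K = 2 * N * (8 * M + 2 * \<rho>\<^sup>2 * L)"
  have K0: "0 \<le> K" using N0 M0 L0 by (simp add: K_def)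
  have main: "norm (f (z + h) - f z) \<le> K / \<rho> * norm h"
    if f: "f \<in> S" and z: "z \<in> ball 0 \<rho> - {0}" and zh: "z + h \<noteq> 0" and h: "norm h < 2 * \<rho>" for f z h
  proof -
    define \<Omega> where "\<Omega> = ball 0 (2*\<rho>) - {0, -h}"
    define d where "d w = 2 * \<rho> - norm w" for w :: "real \<times> real"
    define W where "W w = (\<Sum>g\<in>S. norm (g (w + h) - g w))" for w
    have inR: "w \<in> ball 0 R - {0}" "w + h \<in> ball 0 R - {0}" if "w \<in> \<Omega>" for w
    proof -
      show "w \<in> ball 0 R - {0}" using that \<rho> by (auto simp: \<Omega>_def)
      have "norm (w + h) < 2*\<rho> + 2*\<rho>" using that h norm_triangle_ineq[of w h] by (auto simp: \<Omega>_def)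
      moreover have "w + h \<noteq> 0" using that by (auto simp: \<Omega>_def add_eq_0_iff2)
      ultimately show "w + h \<in> ball 0 R - {0}" using \<rho> by simp
    qed
    have gM: "norm (g (w + h) - g w) \<le> 2 * M" if "g \<in> S" "w \<in> \<Omega>" for g w
      using M[OF that(1) inR(1)[OF that(2)]] M[OF that(1) inR(2)[OF that(2)]] norm_triangle_ineq4[of "g (w + h)" "g w"] by linarith
    have W0: "0 \<le> W w" for w unfolding W_def by (intro sum_nonneg) auto
    have WM: "W w \<le> N * (2 * M)" if "w \<in> \<Omega>" for w
      unfolding W_def N_def using gM that by (intro sum_bounded_above) auto
    have d: "0 < d w" "d w \<le> 2 * \<rho>" if "w \<in> \<Omega>" for w using that by (auto simp: d_def \<Omega>_def)
    define Nn where "Nn = (SUP w\<in>\<Omega>. d w * W w)"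
    have bdd: "bdd_above ((\<lambda>w. d w * W w) ` \<Omega>)"
    proof (rule bdd_aboveI2)
      fix w assume "w \<in> \<Omega>"
      then show "d w * W w \<le> 2 * \<rho> * (N * (2 * M))"
        using d W0 WM \<rho> by (intro mult_mono) auto
    qed
    have up: "d w * W w \<le> Nn" if "w \<in> \<Omega>" for w
      unfolding Nn_def using that bdd by (rule cSUP_upper)
    have z\<Omega>: "z \<in> \<Omega>" using z zh \<rho> by (auto simp: \<Omega>_def)
    have Nn0: "0 \<le> Nn" using up[OF z\<Omega>] d(1)[OF z\<Omega>] W0[of z] by (meson mult_nonneg_nonneg less_imp_le order_trans)
    have step: "d w * norm (g (w + h) - g w) \<le> (8 * M + 2 * \<rho>\<^sup>2 * L) * norm h + 2 * \<rho> * L * Nn"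
      if g: "g \<in> S" and w: "w \<in> \<Omega>" for g w
    proof -
      define s where "s = d w / 2"
      have s: "0 < s" using d(1)[OF w] by (simp add: s_def)
      define F where "F x = g (x + h) - g x" for x
      have cb: "cball w s \<subseteq> ball 0 (2*\<rho>)"
        by (rule cball_subset_ball_0) (use d(1)[OF w] in \<open>simp add: s_def d_def field_simps\<close>)
      define B where "B = L * (norm h + 2 * Nn / d w)"
      have B0: "0 \<le> B" using L0 Nn0 d(1)[OF w] by (simp add: B_def)
      have F: "C1_on F (ball 0 (2*\<rho>) - {0, -h})"
        unfolding F_def by (rule C1_on_difference(1)[OF C1[OF g]]) (use inR in \<open>auto simp: \<Omega>_def\<close>)
      have dF: "dbar F x = dbar g (x + h) - dbar g x" if "x \<in> \<Omega>" for x
        unfolding F_def by (rule C1_on_difference(2)[OF C1[OF g], where T = \<Omega>]) (use that inR in auto)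
      have "norm (disk_avg F w s - F w) \<le> s * B + sing_const * 0 * s powr (1/4)"
      proof (rule disk_avg_bound[OF F _ _ cb s])
        fix x assume x: "x \<in> cball w s - {0, -h}"
        then have x\<Omega>: "x \<in> \<Omega>" using cb by (auto simp: \<Omega>_def)
        show "norm (F x) \<le> 2 * M" unfolding F_def by (rule gM[OF g x\<Omega>])
        have dx: "d w / 2 \<le> d x"
        proof -
          have "norm x \<le> norm w + s" using x norm_triangle_sub[of x w] by (simp add: dist_norm norm_minus_commute)
          then show ?thesis unfolding d_def s_def by (simp add: field_simps)
        qed
        have "d w / 2 * W x \<le> Nn" using up[OF x\<Omega>] mult_right_mono[OF dx W0[of x]] by linarith
        then have Wx: "W x \<le> 2 * Nn / d w" using d(1)[OF w] by (simp add: field_simps)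
        have "norm (dbar F x) \<le> L * (dist (x + h) x + (\<Sum>g\<in>S. norm (g (x + h) - g x)))"
          unfolding dF[OF x\<Omega>] by (rule L[OF g inR(2)[OF x\<Omega>] inR(1)[OF x\<Omega>]])
        also have "\<dots> = L * (norm h + W x)" by (simp add: dist_norm W_def)
        also have "\<dots> \<le> B" unfolding B_def using Wx L0 by (intro mult_left_mono) auto
        finally show "norm (dbar F x) \<le> B + 0 * norm x powr (-3/4)" by simp
      qed (use w B0 in \<open>auto simp: \<Omega>_def\<close>)
      then have 1: "norm (disk_avg F w s - F w) \<le> s * B" by simp
      have bR: "ball w s \<subseteq> ball 0 R" "ball (w + h) s \<subseteq> ball 0 R"
      proof -
        show "ball w s \<subseteq> ball 0 R"
      proof -
        have "ball 0 (2*\<rho>) \<subseteq> ball (0::real \<times> real) R" using \<rho> by (intro subset_ball) auto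
        then show ?thesis using ball_subset_cball[of w s] cb by blast
      qed
        show "ball (w + h) s \<subseteq> ball 0 R"
        proof
          fix x assume "x \<in> ball (w + h) s"
          then have "x - h \<in> cball w s" by (simp add: dist_norm algebra_simps)
          then have "norm (x - h) < 2*\<rho>" using cb by auto
          then have "norm x < 2*\<rho> + 2*\<rho>" using h norm_triangle_ineq[of "x - h" h] by simp
          then show "x \<in> ball 0 R" using \<rho> by simp
        qed
      qed
      have 2: "norm (disk_avg F w s) \<le> 4 * M * norm h / s"
      proof -
        note cg = C1_on_continuous[OF C1[OF g]]
        have "disk_avg F w s = disk_avg g (w + h) s - disk_avg g w s"
          unfolding F_def by (rule disk_avg_difference[OF cg _ _ bR, of M]) (use M[OF g] bR in blast)+
        also have "norm \<dots> \<le> 4 * M * dist (w + h) w / s"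
          by (rule disk_avg_shift[OF cg _ _ s bR(2,1)]) (use M[OF g] bR M0 in blast)+
        finally show ?thesis by (simp add: dist_norm)
      qed
      have "norm (F w) \<le> 4 * M * norm h / s + s * B"
        using 1 2 norm_triangle_ineq4[of "disk_avg F w s" "disk_avg F w s - F w"] by simp
      then have "d w * norm (F w) \<le> d w * (4 * M * norm h / s + s * B)"
        using d(1)[OF w] by (intro mult_left_mono) auto
      also have "\<dots> = 8 * M * norm h + (d w)\<^sup>2 / 2 * L * norm h + d w * L * Nn"
        using d(1)[OF w] by (simp add: s_def B_def field_simps power2_eq_square)
      also have "\<dots> \<le> 8 * M * norm h + (2*\<rho>)\<^sup>2 / 2 * L * norm h + 2 * \<rho> * L * Nn"
        using d[OF w] L0 M0 Nn0 \<rho> by (intro add_mono mult_right_mono divide_right_mono power_mono) auto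
      also have "\<dots> = (8 * M + 2 * \<rho>\<^sup>2 * L) * norm h + 2 * \<rho> * L * Nn"
        by (simp add: power2_eq_square algebra_simps)
      finally show ?thesis by (simp add: F_def)
    qed
    have "Nn \<le> N * ((8 * M + 2 * \<rho>\<^sup>2 * L) * norm h + 2 * \<rho> * L * Nn)"
      unfolding Nn_def
    proof (rule cSUP_least)
      show "\<Omega> \<noteq> {}" using z\<Omega> by auto
      fix w assume w: "w \<in> \<Omega>"
      have "d w * W w = (\<Sum>g\<in>S. d w * norm (g (w + h) - g w))" by (simp add: W_def sum_distrib_left)
      also have "\<dots> \<le> N * ((8 * M + 2 * \<rho>\<^sup>2 * L) * norm h + 2 * \<rho> * L * Nn)"
        unfolding N_def by (intro sum_bounded_above step w) auto
      finally show "d w * W w \<le> N * ((8 * M + 2 * \<rho>\<^sup>2 * L) * norm h + 2 * \<rho> * L * (SUP w\<in>\<Omega>. d w * W w))"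
        unfolding Nn_def .
    qed
    also have "\<dots> = K/2 * norm h + (2 * \<rho> * N * L) * Nn" by (simp add: K_def algebra_simps)
    also have "\<dots> \<le> K/2 * norm h + 1/2 * Nn" using \<rho>NL Nn0 by (intro add_left_mono mult_right_mono)
    finally have NnK: "Nn \<le> K * norm h" by simp
    have "\<rho> * norm (f (z + h) - f z) \<le> d z * W z"
    proof (rule mult_mono)
      show "\<rho> \<le> d z" using z by (auto simp: d_def)
      show "norm (f (z + h) - f z) \<le> W z" unfolding W_def
        using f fin member_le_sum[of f S "\<lambda>g. norm (g (z + h) - g z)"] by simp
    qed (use d(1)[OF z\<Omega>] in auto)
    then have "\<rho> * norm (f (z + h) - f z) \<le> K * norm h" using up[OF z\<Omega>] NnK by linarith
    then show ?thesis using \<rho> by (simp add: field_simps)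
  qed
  have "norm (f w - f w') \<le> K / \<rho> * dist w w'" if "f \<in> S" "w \<in> ball 0 \<rho> - {0}" "w' \<in> ball 0 \<rho> - {0}" for f w w'
  proof -
    have "norm (w' - w) < 2 * \<rho>" using that norm_triangle_ineq4[of w' w] by auto
    then show ?thesis using main[of f w "w' - w"] that by (auto simp: dist_norm norm_minus_commute)
  qed
  then show ?thesis using \<rho> K0 by (intro exI[of _ \<rho>] exI[of _ "K / \<rho>"]) auto
qed

lemma difference_quotient_partials:
  fixes f :: "real \<times> real \<Rightarrow> complex"
  assumes "f differentiable (at z)"
  shows "((\<lambda>t. (1/t) *\<^sub>R (f (z + (t, 0)) - f z)) \<longlongrightarrow> partial_x f z) (at_right 0)"
    and "((\<lambda>t. (1/t) *\<^sub>R (f (z + (0, t)) - f z)) \<longlongrightarrow> partial_y f z) (at_right 0)"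
proof -
  have *: "((\<lambda>t. (1/t) *\<^sub>R (f (z + t *\<^sub>R v) - f z)) \<longlongrightarrow> fst v *\<^sub>R partial_x f z + snd v *\<^sub>R partial_y f z) (at_right 0)" for v
  proof -
    have "((\<lambda>t::real. z + t *\<^sub>R v) has_derivative (\<lambda>h. h *\<^sub>R v)) (at 0)" by (auto intro!: derivative_eq_intros)
    from has_derivative_compose[OF this, of f "\<lambda>v. fst v *\<^sub>R partial_x f z + snd v *\<^sub>R partial_y f z"]
    have "((\<lambda>t. f (z + t *\<^sub>R v)) has_derivative (\<lambda>h. fst (h *\<^sub>R v) *\<^sub>R partial_x f z + snd (h *\<^sub>R v) *\<^sub>R partial_y f z)) (at 0)"
      using has_derivative_partials[OF assms] by simp
    then have "((\<lambda>t. f (z + t *\<^sub>R v)) has_vector_derivative (fst v *\<^sub>R partial_x f z + snd v *\<^sub>R partial_y f z)) (at 0)"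
      unfolding has_vector_derivative_def by (rule has_derivative_eq_rhs) (simp add: fun_eq_iff algebra_simps)
    then have "((\<lambda>t. norm (f (z + t *\<^sub>R v) - f z - t *\<^sub>R (fst v *\<^sub>R partial_x f z + snd v *\<^sub>R partial_y f z)) / norm t) \<longlongrightarrow> 0) (at 0)"
      unfolding has_vector_derivative_def has_derivative_at by simp
    moreover have "norm (f (z + t *\<^sub>R v) - f z - t *\<^sub>R q) / norm t = norm ((1/t) *\<^sub>R (f (z + t *\<^sub>R v) - f z) - q)" if "t \<noteq> 0" for t q
    proof -
      have "(1/t) *\<^sub>R (f (z + t *\<^sub>R v) - f z) - q = (1/t) *\<^sub>R (f (z + t *\<^sub>R v) - f z - t *\<^sub>R q)"
        using that by (simp add: scaleR_diff_right)
      then show ?thesis by simp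
    qed
    ultimately have "((\<lambda>t. norm ((1/t) *\<^sub>R (f (z + t *\<^sub>R v) - f z) - (fst v *\<^sub>R partial_x f z + snd v *\<^sub>R partial_y f z))) \<longlongrightarrow> 0) (at 0)"
      by (auto elim!: Lim_transform_eventually simp: eventually_at_filter)
    then have "((\<lambda>t. (1/t) *\<^sub>R (f (z + t *\<^sub>R v) - f z)) \<longlongrightarrow> fst v *\<^sub>R partial_x f z + snd v *\<^sub>R partial_y f z) (at 0)"
      using Lim_null tendsto_norm_zero_iff by blast
    then show ?thesis by (simp add: filterlim_at_split)
  qed
  show "((\<lambda>t. (1/t) *\<^sub>R (f (z + (t, 0)) - f z)) \<longlongrightarrow> partial_x f z) (at_right 0)"
    using *[of "(1,0)"] by simp
  show "((\<lambda>t. (1/t) *\<^sub>R (f (z + (0, t)) - f z)) \<longlongrightarrow> partial_y f z) (at_right 0)"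
    using *[of "(0,1)"] by simp
qed

text \<open>
  The difference \<open>F = f(\<cdot> + h) - f\<close> and its \<open>dbar\<close> are of size \<open>\<bar>h\<bar>\<close>. Comparing \<open>F(z)\<close> and \<open>F(z')\<close>
  through averages at the scale \<open>\<bar>z - z'\<bar>\<^bsup>1/2\<^esup>\<close>, dividing by \<open>\<bar>h\<bar>\<close> and letting \<open>h\<close> tend to
  \<open>0\<close> yields the estimate for the partial derivatives; second derivatives are not used.
\<close>

lemma punctured_gradient_holder:
  assumes R: "0 < R" and C0: "0 \<le> C" and f: "C1_on f (ball 0 R - {0})"
    and L: "\<And>w w'. w \<in> ball 0 R - {0} \<Longrightarrow> w' \<in> ball 0 R - {0} \<Longrightarrow> norm (f w - f w') \<le> C * dist w w'"
    and D: "\<And>w w'. w \<in> ball 0 R - {0} \<Longrightarrow> w' \<in> ball 0 R - {0} \<Longrightarrow> norm (dbar f w - dbar f w') \<le> C * dist w w'"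
  shows "\<exists>\<rho>>0. \<rho> \<le> R \<and> (\<forall>w\<in>ball 0 \<rho> - {0}. \<forall>w'\<in>ball 0 \<rho> - {0}.
      norm (partial_x f w - partial_x f w') \<le> 6 * C * sqrt (dist w w') \<and>
      norm (partial_y f w - partial_y f w') \<le> 6 * C * sqrt (dist w w'))"
proof -
  define \<rho> where "\<rho> = min (R/4) ((R/4)\<^sup>2/2)"
  have \<rho>: "0 < \<rho>" "\<rho> \<le> R/4" "2 * \<rho> \<le> (R/4)\<^sup>2" using R by (auto simp: \<rho>_def)
  have main: "norm ((f (z + h) - f z) - (f (z' + h) - f z')) \<le> 6 * C * sqrt (dist z z') * norm h"
    if z: "z \<in> ball 0 \<rho> - {0, -h}" "z' \<in> ball 0 \<rho> - {0, -h}" and h: "norm h < R/4" for z z' h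
  proof (cases "z = z'")
    case False
    define s where "s = sqrt (dist z z')"
    have s: "0 < s" using False by (simp add: s_def)
    have "dist z z' < 2 * \<rho>" using z norm_triangle_ineq4[of z z'] by (auto simp: dist_norm)
    then have "s \<le> sqrt ((R/4)\<^sup>2)" unfolding s_def using \<rho> by (intro real_sqrt_le_mono) auto
    then have sR: "s \<le> R/4" using R by simp
    define F where "F x = f (x + h) - f x" for x
    let ?U = "ball (0::real \<times> real) (3*R/4)"
    have inR: "w \<in> ball 0 R - {0}" "w + h \<in> ball 0 R - {0}" if "w \<in> ?U - {0, -h}" for w
    proof -
      show "w \<in> ball 0 R - {0}" using that R by auto
      have "norm (w + h) < R" using that h norm_triangle_ineq[of w h] by auto
      moreover have "w + h \<noteq> 0" using that by (auto simp: add_eq_0_iff2)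
      ultimately show "w + h \<in> ball 0 R - {0}" by simp
    qed
    have F: "C1_on F (?U - {0, -h})"
      unfolding F_def by (rule C1_on_difference(1)[OF f]) (use inR in auto)
    have dF: "dbar F x = dbar f (x + h) - dbar f x" if "x \<in> ?U - {0, -h}" for x
      unfolding F_def by (rule C1_on_difference(2)[OF f, where T = "?U - {0, -h}"]) (use that inR in auto)
    have FM: "norm (F x) \<le> C * norm h" if "x \<in> ?U - {0, -h}" for x
      using L[OF inR(2)[OF that] inR(1)[OF that]] by (simp add: F_def dist_norm)
    have FD: "norm (dbar F x) \<le> C * norm h" if "x \<in> ?U - {0, -h}" for x
      using D[OF inR(2)[OF that] inR(1)[OF that]] by (simp add: dF[OF that] dist_norm)
    have cb: "cball w s \<subseteq> ?U" if "w \<in> ball 0 \<rho>" for w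
      by (rule cball_subset_ball_0) (use that sR \<rho> R in simp)
    have avg: "norm (disk_avg F w s - F w) \<le> s * (C * norm h)" if w: "w \<in> ball 0 \<rho> - {0, -h}" for w
    proof -
      have "norm (disk_avg F w s - F w) \<le> s * (C * norm h) + sing_const * 0 * s powr (1/4)"
      proof (rule disk_avg_bound[OF F _ _ cb s])
        fix x assume "x \<in> cball w s - {0, -h}"
        then have x: "x \<in> ?U - {0, -h}" using cb[of w] w by blast
        show "norm (F x) \<le> C * norm h" by (rule FM[OF x])
        show "norm (dbar F x) \<le> C * norm h + 0 * norm x powr (-3/4)" using FD[OF x] by simp
      qed (use w C0 in auto)
      then show ?thesis by simp
    qed
    have shift: "norm (disk_avg F z s - disk_avg F z' s) \<le> 4 * (C * norm h) * dist z z' / s"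
    proof (rule disk_avg_shift[OF C1_on_continuous[OF F] _ _ s])
      show "ball z s \<subseteq> ?U" "ball z' s \<subseteq> ?U" using cb[of z] cb[of z'] z ball_subset_cball by blast+
      then show "norm (F w) \<le> C * norm h" if "w \<in> (ball z s \<union> ball z' s) - {0, -h}" for w
        using FM[of w] that by blast
    qed (use C0 in auto)
    have "dist z z' = s * s" by (simp add: s_def)
    then have "4 * (C * norm h) * dist z z' / s = 4 * (C * norm h) * s" using s by simp
    then have "norm (F z - F z') \<le> 6 * C * s * norm h"
      using avg[OF z(1)] avg[OF z(2)] shift
        norm_triangle_ineq4[of "disk_avg F z s - disk_avg F z' s" "(disk_avg F z s - F z) - (disk_avg F z' s - F z')"]
        norm_triangle_ineq4[of "disk_avg F z s - F z" "disk_avg F z' s - F z'"]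
      by (simp add: algebra_simps)
    then show ?thesis by (simp add: F_def s_def)
  qed (simp add: C0)
  have pd: "norm (p - p') \<le> 6 * C * sqrt (dist w w')"
    if w: "w \<in> ball 0 \<rho> - {0}" "w' \<in> ball 0 \<rho> - {0}" and v: "norm v = 1"
      and p: "((\<lambda>t. (1/t) *\<^sub>R (f (w + t *\<^sub>R v) - f w)) \<longlongrightarrow> p) (at_right 0)"
      and p': "((\<lambda>t. (1/t) *\<^sub>R (f (w' + t *\<^sub>R v) - f w')) \<longlongrightarrow> p') (at_right 0)" for w w' v p p'
  proof (rule tendsto_upperbound)
    show "((\<lambda>t. norm ((1/t) *\<^sub>R (f (w + t *\<^sub>R v) - f w) - (1/t) *\<^sub>R (f (w' + t *\<^sub>R v) - f w'))) \<longlongrightarrow> norm (p - p')) (at_right 0)"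
      by (intro tendsto_intros p p')
    have "0 < min (R/4) (min (norm w) (norm w'))" using R w by auto
    then show "\<forall>\<^sub>F t in at_right 0. norm ((1/t) *\<^sub>R (f (w + t *\<^sub>R v) - f w) - (1/t) *\<^sub>R (f (w' + t *\<^sub>R v) - f w')) \<le> 6 * C * sqrt (dist w w')"
      unfolding eventually_at_right_field
    proof (intro exI[of _ "min (R/4) (min (norm w) (norm w'))"] conjI allI impI)
      fix t :: real assume t: "0 < t" "t < min (R/4) (min (norm w) (norm w'))"
      have n: "norm (t *\<^sub>R v) = t" using t v by simp
      then have "w \<noteq> - (t *\<^sub>R v)" "w' \<noteq> - (t *\<^sub>R v)" using t by (metis norm_minus_cancel min_less_iff_conj less_irrefl)+
      then have "norm ((f (w + t *\<^sub>R v) - f w) - (f (w' + t *\<^sub>R v) - f w')) \<le> 6 * C * sqrt (dist w w') * norm (t *\<^sub>R v)"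
        using w t n by (intro main) auto
      then have "norm ((1/t) *\<^sub>R ((f (w + t *\<^sub>R v) - f w) - (f (w' + t *\<^sub>R v) - f w'))) \<le> 6 * C * sqrt (dist w w')"
        using t v unfolding norm_scaleR by (simp add: pos_divide_le_eq)
      then show "norm ((1/t) *\<^sub>R (f (w + t *\<^sub>R v) - f w) - (1/t) *\<^sub>R (f (w' + t *\<^sub>R v) - f w')) \<le> 6 * C * sqrt (dist w w')"
        by (simp only: scaleR_diff_right)
    qed
  qed simp
  have df: "f differentiable (at w)" if "w \<in> ball 0 \<rho> - {0}" for w
    using f that \<rho> R by (auto simp: C1_on_def)
  have "norm (partial_x f w - partial_x f w') \<le> 6 * C * sqrt (dist w w') \<and>
      norm (partial_y f w - partial_y f w') \<le> 6 * C * sqrt (dist w w')"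
    if w: "w \<in> ball 0 \<rho> - {0}" "w' \<in> ball 0 \<rho> - {0}" for w w'
    using pd[OF w, of "(1,0)"] pd[OF w, of "(0,1)"]
      difference_quotient_partials[OF df[OF w(1)]] difference_quotient_partials[OF df[OF w(2)]]
    by simp
  then show ?thesis using \<rho> R by (intro exI[of _ \<rho>]) auto
qed

lemma punctured_holder_limit:
  fixes g :: "real \<times> real \<Rightarrow> complex"
  assumes R: "0 < R" and K: "0 \<le> K"
    and g: "\<And>w w'. w \<in> ball 0 R - {0} \<Longrightarrow> w' \<in> ball 0 R - {0} \<Longrightarrow> norm (g w - g w') \<le> K * sqrt (dist w w')"
  shows "\<exists>l. (g \<longlongrightarrow> l) (at 0)"
proof -
  have "uniformly_continuous_on (ball 0 R - {0}) g"
    unfolding uniformly_continuous_on_def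
  proof (intro allI impI)
    fix e :: real assume e: "0 < e"
    show "\<exists>d>0. \<forall>x\<in>ball 0 R - {0}. \<forall>x'\<in>ball 0 R - {0}. dist x' x < d \<longrightarrow> dist (g x') (g x) < e"
    proof (intro exI[of _ "(e / (K + 1))\<^sup>2"] conjI ballI impI)
      show "0 < (e / (K + 1))\<^sup>2" using e K by simp
      fix x x' :: "real \<times> real" assume x: "x \<in> ball 0 R - {0}" "x' \<in> ball 0 R - {0}" "dist x' x < (e / (K + 1))\<^sup>2"
      have "sqrt (dist x' x) < sqrt ((e / (K + 1))\<^sup>2)" using x(3) by (rule real_sqrt_less_mono)
      then have s: "sqrt (dist x' x) < e / (K + 1)" using e K by simp
      have "norm (g x' - g x) \<le> K * sqrt (dist x' x)" using g x by blast
      also have "\<dots> \<le> K * (e / (K + 1))" using s K by (intro mult_left_mono) auto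
      also have "\<dots> < e" using e K by (simp add: field_simps)
      finally show "dist (g x') (g x) < e" by (simp add: dist_norm)
    qed
  qed
  moreover have "(0::real \<times> real) \<in> closure (ball 0 R - {0})"
  proof -
    have "(0::real \<times> real) islimpt ball 0 R" using R by (simp add: islimpt_ball)
    then have "(0::real \<times> real) islimpt ball 0 R - {0}" by (simp add: islimpt_punctured[symmetric])
    then show ?thesis by (simp add: closure_def)
  qed
  ultimately obtain l where "(g \<longlongrightarrow> l) (at 0 within ball 0 R - {0})"
    by (rule uniformly_continuous_on_extension_at_closure)
  moreover have "at (0::real \<times> real) within ball 0 R - {0} = at 0"
    using R by (metis Diff_Diff_Int at_within_open at_within_def centre_in_ball open_ball Diff_idemp at_within_nhd Int_Diff Int_absorb)
  ultimately show ?thesis by metis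
qed

section \<open>Solutions with finite energy are bounded\<close>

lemma integral_small_disk:
  fixes h :: "real \<times> real \<Rightarrow> real"
  assumes h: "set_integrable lborel (ball 0 R) h" and R: "0 < R" and e: "0 < e"
  shows "\<exists>r>0. r \<le> R \<and> \<bar>LINT w:ball 0 r|lborel. h w\<bar> < e"
proof -
  define H where "H w = indicator (ball 0 R) w *\<^sub>R h w" for w
  have H: "integrable lborel H" using h unfolding set_integrable_def H_def .
  have [measurable]: "H \<in> borel_measurable borel" using borel_measurable_integrable[OF H] by simp
  define r where "r n = R / real (Suc n)" for n
  have r: "0 < r n" "r n \<le> R" for n using R by (auto simp: r_def field_simps)
  have rlim: "r \<longlonglongrightarrow> 0"
    unfolding r_def using LIMSEQ_Suc[OF lim_const_over_n[of R]] by simp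
  have "(\<lambda>n. LINT w|lborel. indicator (ball 0 (r n)) w *\<^sub>R H w) \<longlonglongrightarrow> (LINT w|(lborel :: (real \<times> real) measure). (0::real))"
  proof (rule integral_dominated_convergence[where w = "\<lambda>w. norm (H w)" and f = "\<lambda>w. 0"
        and s = "\<lambda>n w. indicator (ball 0 (r n)) w *\<^sub>R H w"])
    show "AE w in lborel. (\<lambda>n. indicator (ball 0 (r n)) w *\<^sub>R H w) \<longlonglongrightarrow> 0"
    proof -
      have "(\<lambda>n. indicator (ball 0 (r n)) w *\<^sub>R H w) \<longlonglongrightarrow> 0" if "w \<noteq> 0" for w :: "real \<times> real"
      proof -
        have "\<forall>\<^sub>F n in sequentially. r n < norm w" using order_tendstoD(2)[OF rlim, of "norm w"] that by simp
        then have "\<forall>\<^sub>F n in sequentially. indicator (ball 0 (r n)) w *\<^sub>R H w = 0"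
          by eventually_elim simp
        then show ?thesis by (rule tendsto_eventually)
      qed
      moreover have "AE w in lborel. w \<noteq> (0::real \<times> real)" by (rule AE_lborel_singleton)
      ultimately show ?thesis by auto
    qed
    show "(\<lambda>w. indicator (ball 0 (r n)) w *\<^sub>R H w) \<in> borel_measurable lborel" for n
      using borel_measurable_integrable[OF H] by (intro borel_measurable_scaleR borel_measurable_indicator) auto
  qed (use H in \<open>auto split: split_indicator\<close>)
  then have "(\<lambda>n. LINT w|lborel. indicator (ball 0 (r n)) w *\<^sub>R H w) \<longlonglongrightarrow> 0" by simp
  then obtain n where n: "\<bar>LINT w|lborel. indicator (ball 0 (r n)) w *\<^sub>R H w\<bar> < e"
    using LIMSEQ_D[OF _ e] by fastforce
  have "(\<lambda>w. indicator (ball 0 (r n)) w *\<^sub>R H w) = (\<lambda>w. indicator (ball 0 (r n)) w *\<^sub>R h w)"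
    using r(2)[of n] by (auto simp: H_def fun_eq_iff split: split_indicator)
  then show ?thesis using n r[of n] by (auto simp: set_lebesgue_integral_def intro!: exI[of _ "r n"])
qed

lemma norm_disk_avg_le:
  assumes i: "set_integrable lborel (ball z s) f" and s: "0 < s"
  shows "norm (disk_avg f z s) \<le> (LINT w:ball z s|lborel. norm (f w)) / (unit_area * s\<^sup>2)"
proof -
  have "norm (disk_int f z s) \<le> (LINT w:ball z s|lborel. norm (f w))"
    unfolding disk_int_def using i by (rule set_integral_norm_bound)
  then show ?thesis
    using unit_area_pos s by (simp add: disk_avg_def divide_right_mono)
qed

text \<open>
  Let \<open>T\<close> be the sum of the absolute values over the family. Then
  \<open>\<bar>z\<bar> T(z)\<^sup>2\<close> tends to zero. If it were large at \<open>z0\<close>, let \<open>z1\<close> maximize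
  \<open>(r0 - \<bar>w - z0\<bar>) T(w)\<^sup>2\<close> over the disk of radius \<open>r0 = \<bar>z0\<bar>/2\<close> about \<open>z0\<close>, and let \<open>m = T(z1)\<close>.
  On the disk about \<open>z1\<close> of radius \<open>\<kappa>/m\<^sup>2\<close> one has \<open>T \<le> 2 m\<close>, so that the averages there
  differ from the values at \<open>z1\<close> by at most \<open>m/2\<close> in total; hence this disk carries energy at least a constant
  depending on \<open>\<kappa>\<close> only, which is impossible close to the origin.
\<close>

lemma critical_decay:
  fixes S :: "(real \<times> real \<Rightarrow> complex) set"
  assumes fin: "finite S" and R: "0 < R" and K: "0 \<le> K"
    and C1: "\<And>f. f \<in> S \<Longrightarrow> C1_on f (ball 0 R - {0})"
    and D: "\<And>f w. f \<in> S \<Longrightarrow> w \<in> ball 0 R - {0} \<Longrightarrow> norm (dbar f w) \<le> K * (\<Sum>g\<in>S. norm (g w)) ^ 3"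
    and L4: "set_integrable lborel (ball 0 R) (\<lambda>w. (\<Sum>g\<in>S. norm (g w)) ^ 4)"
    and \<eta>: "0 < \<eta>"
  shows "\<exists>r>0. r \<le> R \<and> (\<forall>z\<in>ball 0 r - {0}. norm z * (\<Sum>g\<in>S. norm (g z))\<^sup>2 \<le> \<eta>)"
proof -
  define T where "T w = (\<Sum>g\<in>S. norm (g w))" for w
  have T0: "0 \<le> T w" for w unfolding T_def by (intro sum_nonneg) auto
  define N where "N = real (card S)"
  have N0: "0 \<le> N" by (simp add: N_def)
  \<comment> \<open>the first bound keeps the disk of radius \<open>\<kappa> / m\<^sup>2\<close> inside the region of the maximum, the second
      limits the deviation from the averages to \<open>m / 2\<close>\<close>
  define \<kappa> where "\<kappa> = min (\<eta>/4) (1 / (16 * (N * K + 1)))"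
  have NK: "0 < N * K + 1" using N0 K by (simp add: add_nonneg_pos)
  have \<kappa>: "0 < \<kappa>" "\<kappa> \<le> \<eta>/4" using \<eta> NK by (auto simp: \<kappa>_def)
  have "\<kappa> * (16 * (N * K + 1)) \<le> 1 / (16 * (N * K + 1)) * (16 * (N * K + 1))"
    using NK by (intro mult_right_mono) (auto simp: \<kappa>_def)
  also have "\<dots> = 1" using NK by simp
  finally have \<kappa>NK: "N * (8 * K * \<kappa>) \<le> 1/2" using \<kappa> by (simp add: algebra_simps)
  have cT: "continuous_on (ball 0 R - {0}) T"
    unfolding T_def by (intro continuous_intros C1_on_continuous C1)
  have "0 < unit_area * \<kappa>\<^sup>2 / 256" using unit_area_pos \<kappa> by simp
  from integral_small_disk[OF L4[folded T_def] R this]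
  obtain r where r: "0 < r" "r \<le> R" "\<bar>LINT w:ball 0 r|lborel. T w ^ 4\<bar> < unit_area * \<kappa>\<^sup>2 / 256" by blast
  have "norm z0 * (T z0)\<^sup>2 \<le> \<eta>" if z0: "z0 \<in> ball 0 (r/2) - {0}" for z0
  proof (rule ccontr)
    assume "\<not> norm z0 * (T z0)\<^sup>2 \<le> \<eta>"
    then have big: "\<eta> < norm z0 * (T z0)\<^sup>2" by simp
    define r0 where "r0 = norm z0 / 2"
    have r0: "0 < r0" using z0 by (simp add: r0_def)
    have sub: "cball z0 r0 \<subseteq> ball 0 r - {0}"
    proof
      fix x assume x: "x \<in> cball z0 r0"
      have "norm x \<le> norm z0 + r0" "norm z0 \<le> norm x + r0"
        using x norm_triangle_sub[of x z0] norm_triangle_sub[of z0 x] by (auto simp: dist_norm norm_minus_commute)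
      then show "x \<in> ball 0 r - {0}" using z0 r0 by (auto simp: r0_def)
    qed
    have subR: "ball 0 r - {0} \<subseteq> ball 0 R - {0::real \<times> real}" using r by auto
    define q where "q w = (r0 - dist w z0) * (T w)\<^sup>2" for w
    have "continuous_on (cball z0 r0) q"
      unfolding q_def using sub subR by (intro continuous_intros continuous_on_subset[OF cT]) auto
    then obtain z1 where z1: "z1 \<in> cball z0 r0" "\<And>w. w \<in> cball z0 r0 \<Longrightarrow> q w \<le> q z1"
      using continuous_attains_sup[of "cball z0 r0" q] r0 by auto
    define d where "d = r0 - dist z1 z0"
    define m where "m = T z1"
    have "\<eta>/2 < q z0" using big by (simp add: q_def r0_def)
    also have "q z0 \<le> q z1" using z1(2) r0 by simp
    finally have qz1: "\<eta>/2 < d * m\<^sup>2" by (simp add: q_def d_def m_def)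
    have d0: "0 \<le> d" using z1(1) by (simp add: d_def dist_commute)
    have d: "0 < d" and m: "0 < m"
      using qz1 \<eta> d0 T0[of z1] by (auto simp: m_def less_le)
    define \<rho> where "\<rho> = \<kappa> / m\<^sup>2"
    have \<rho>: "0 < \<rho>" using \<kappa> m by (simp add: \<rho>_def)
    have "\<rho> * m\<^sup>2 \<le> d / 2 * m\<^sup>2" using \<kappa> qz1 m by (simp add: \<rho>_def)
    then have \<rho>d: "\<rho> \<le> d/2" using m by simp
    have cb: "cball z1 \<rho> \<subseteq> cball z0 r0"
    proof
      fix x assume "x \<in> cball z1 \<rho>"
      then have "dist x z1 \<le> d" using \<rho>d d by (simp add: dist_commute)
      then show "x \<in> cball z0 r0" using dist_triangle[of z0 x z1] by (simp add: d_def dist_commute)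
    qed
    have T2: "T x \<le> 2 * m" if x: "x \<in> cball z1 \<rho>" for x
    proof -
      have "dist x z1 \<le> d/2" using x \<rho>d by (simp add: dist_commute)
      then have "d/2 \<le> r0 - dist x z0" using dist_triangle[of x z0 z1] by (simp add: d_def)
      then have "d/2 * (T x)\<^sup>2 \<le> q x" unfolding q_def by (intro mult_right_mono) auto
      also have "\<dots> \<le> d * m\<^sup>2" using z1(2)[of x] cb x by (auto simp: q_def d_def m_def)
      finally have "(T x)\<^sup>2 \<le> 2 * m\<^sup>2" using d by simp
      also have "\<dots> \<le> (2 * m)\<^sup>2" by (simp add: power2_eq_square)
      finally show ?thesis by (rule power2_le_imp_le) (use m in auto)
    qed
    have inR: "x \<in> ball 0 R - {0}" if "x \<in> cball z1 \<rho>" for x using that cb sub subR by blast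
    have gi: "set_integrable lborel (ball z1 \<rho>) g" if g: "g \<in> S" for g
    proof (rule set_integrable_disk[where P = "{}" and U = "ball 0 R - {0}" and M = "2 * m"])
      show "continuous_on (ball 0 R - {0} - {}) g" using C1_on_continuous[OF C1[OF g]] by simp
      show "ball z1 \<rho> \<subseteq> ball 0 R - {0}" using inR ball_subset_cball[of z1 \<rho>] by blast
      fix w assume "w \<in> ball z1 \<rho> - {}"
      then have "T w \<le> 2 * m" by (intro T2) auto
      moreover have "norm (g w) \<le> T w" unfolding T_def by (rule norm_le_sum_norm[OF fin g])
      ultimately show "norm (g w) \<le> 2 * m" by linarith
    qed auto
    have avg: "norm (g z1) \<le> norm (disk_avg g z1 \<rho>) + 8 * K * \<kappa> * m" if g: "g \<in> S" for g
    proof -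
      have "norm (disk_avg g z1 \<rho> - g z1) \<le> \<rho> * (8 * K * m ^ 3) + sing_const * 0 * \<rho> powr (1/4)"
      proof (rule disk_avg_bound[where P = "{}" and U = "ball 0 R - {0}" and M = "2 * m"])
        show "C1_on g (ball 0 R - {0} - {})" using C1[OF g] by simp
        show "cball z1 \<rho> \<subseteq> ball 0 R - {0}" using inR by blast
        fix w assume "w \<in> cball z1 \<rho> - {}"
        then have w: "w \<in> cball z1 \<rho>" by simp
        have "norm (g w) \<le> T w" unfolding T_def by (rule norm_le_sum_norm[OF fin g])
        then show "norm (g w) \<le> 2 * m" using T2[OF w] by linarith
        have "norm (dbar g w) \<le> K * T w ^ 3" unfolding T_def by (rule D[OF g inR[OF w]])
        also have "\<dots> \<le> K * (2 * m) ^ 3" using K T0 T2[OF w] by (intro mult_left_mono power_mono) auto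
        finally show "norm (dbar g w) \<le> 8 * K * m ^ 3 + 0 * norm w powr (-3/4)" by (simp add: power_mult_distrib)
      qed (use \<rho> K m in auto)
      also have "\<dots> = 8 * K * \<kappa> * m" using m by (simp add: \<rho>_def power3_eq_cube power2_eq_square)
      finally show ?thesis using norm_triangle_ineq4[of "disk_avg g z1 \<rho>" "disk_avg g z1 \<rho> - g z1"] by simp
    qed
    let ?A = "unit_area * \<rho>\<^sup>2"
    have A: "0 < ?A" using unit_area_pos \<rho> by simp
    have "m = (\<Sum>g\<in>S. norm (g z1))" by (simp add: m_def T_def)
    also have "\<dots> \<le> (\<Sum>g\<in>S. norm (disk_avg g z1 \<rho>) + 8 * K * \<kappa> * m)" by (intro sum_mono avg)
    also have "\<dots> = (\<Sum>g\<in>S. norm (disk_avg g z1 \<rho>)) + N * (8 * K * \<kappa>) * m" by (simp add: sum.distrib N_def)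
    also have "\<dots> \<le> (\<Sum>g\<in>S. norm (disk_avg g z1 \<rho>)) + 1/2 * m"
      using \<kappa>NK m by (intro add_left_mono mult_right_mono) auto
    finally have "m/2 \<le> (\<Sum>g\<in>S. norm (disk_avg g z1 \<rho>))" by simp
    also have "\<dots> \<le> (\<Sum>g\<in>S. (LINT w:ball z1 \<rho>|lborel. norm (g w)) / ?A)"
      by (intro sum_mono norm_disk_avg_le gi \<rho>)
    also have "\<dots> = (LINT w:ball z1 \<rho>|lborel. T w) / ?A"
    proof -
      have "(LINT w:ball z1 \<rho>|lborel. T w) = (LINT w|lborel. (\<Sum>g\<in>S. indicator (ball z1 \<rho>) w *\<^sub>R norm (g w)))"
        by (simp add: set_lebesgue_integral_def T_def sum_distrib_left)
      also have "\<dots> = (\<Sum>g\<in>S. LINT w:ball z1 \<rho>|lborel. norm (g w))"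
        unfolding set_lebesgue_integral_def
        by (rule Bochner_Integration.integral_sum) (use set_integrable_norm[OF gi] in \<open>auto simp: set_integrable_def\<close>)
      finally show ?thesis by (simp add: sum_divide_distrib)
    qed
    finally have mA: "m/2 * ?A \<le> (LINT w:ball z1 \<rho>|lborel. T w)" using A by (simp add: field_simps)
    have Ti: "set_integrable lborel (ball z1 \<rho>) T"
    proof -
      have "integrable lborel (\<lambda>w. \<Sum>g\<in>S. indicator (ball z1 \<rho>) w *\<^sub>R norm (g w))"
        by (rule Bochner_Integration.integrable_sum) (use set_integrable_norm[OF gi] in \<open>auto simp: set_integrable_def\<close>)
      then show ?thesis by (simp add: set_integrable_def T_def sum_distrib_left)
    qed
    have T4i: "set_integrable lborel (ball 0 r) (\<lambda>w. T w ^ 4)" "set_integrable lborel (ball z1 \<rho>) (\<lambda>w. T w ^ 4)"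
    proof -
      have "ball z1 \<rho> \<subseteq> ball 0 R" using inR ball_subset_cball[of z1 \<rho>] by blast
      then show "set_integrable lborel (ball 0 r) (\<lambda>w. T w ^ 4)" "set_integrable lborel (ball z1 \<rho>) (\<lambda>w. T w ^ 4)"
        using r by (auto intro!: set_integrable_subset[OF L4[folded T_def]])
    qed
    have ci: "set_integrable lborel (ball z1 \<rho>) (\<lambda>_. m/4)"
      unfolding set_integrable_def using emeasure_disk_finite[of z1 \<rho>]
      by (intro integrable_scaleR_left) (auto intro!: integrable_real_indicator)
    \<comment> \<open>a pointwise inequality in place of the Hoelder inequality\<close>
    have "(LINT w:ball z1 \<rho>|lborel. T w) \<le> (LINT w:ball z1 \<rho>|lborel. m/4 + 64/m^3 * T w ^ 4)"
    proof (rule set_integral_mono[OF Ti])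
      show "set_integrable lborel (ball z1 \<rho>) (\<lambda>w. m/4 + 64/m^3 * T w ^ 4)"
        using ci T4i(2) by (intro set_integral_add(1) set_integrable_mult_right) auto
      show "T w \<le> m/4 + 64/m^3 * T w ^ 4" for w
      proof (cases "T w \<le> m/4")
        case True
        then show ?thesis using T0[of w] m by (simp add: add_increasing2)
      next
        case False
        then have "(m/4)^3 \<le> T w ^ 3" using m by (intro power_mono) auto
        then have "T w * (m/4)^3 \<le> T w * T w ^ 3" using T0 by (intro mult_left_mono) auto
        then have "T w \<le> 64/m^3 * T w ^ 4" using m by (simp add: field_simps power4_eq_xxxx power3_eq_cube)
        then show ?thesis using m by simp
      qed
    qed
    also have "\<dots> = m/4 * ?A + 64/m^3 * (LINT w:ball z1 \<rho>|lborel. T w ^ 4)"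
    proof -
      have "(LINT w:ball z1 \<rho>|lborel. m/4) = m/4 * ?A"
        using content_disk[of \<rho> z1] \<rho> by (simp add: set_lebesgue_integral_def)
      moreover have "(LINT w:ball z1 \<rho>|lborel. m/4 + 64/m^3 * T w ^ 4)
          = (LINT w:ball z1 \<rho>|lborel. m/4) + (LINT w:ball z1 \<rho>|lborel. 64/m^3 * T w ^ 4)"
        using ci T4i(2) by (intro set_integral_add(2) set_integrable_mult_right) auto
      ultimately show ?thesis by simp
    qed
    also have "\<dots> \<le> m/4 * ?A + 64/m^3 * (LINT w:ball 0 r|lborel. T w ^ 4)"
    proof -
      have "ball z1 \<rho> \<subseteq> ball 0 r" using cb sub ball_subset_cball[of z1 \<rho>] by blast
      then have "(LINT w:ball z1 \<rho>|lborel. T w ^ 4) \<le> (LINT w:ball 0 r|lborel. T w ^ 4)"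
        unfolding set_lebesgue_integral_def using T4i[unfolded set_integrable_def] T0
        by (intro integral_mono) (auto split: split_indicator)
      then show ?thesis using m by (intro add_left_mono mult_left_mono) auto
    qed
    finally have "m/2 * ?A \<le> m/4 * ?A + 64/m^3 * (LINT w:ball 0 r|lborel. T w ^ 4)"
      using mA by linarith
    then have "m/4 * ?A \<le> 64/m^3 * (LINT w:ball 0 r|lborel. T w ^ 4)" by linarith
    also have "\<dots> < 64/m^3 * (unit_area * \<kappa>\<^sup>2 / 256)" using r(3) m by (intro mult_strict_left_mono) auto
    also have "\<dots> = m/4 * ?A"
      using m by (simp add: \<rho>_def field_simps power2_eq_square power3_eq_cube)
    finally show False by simp
  qed
  then show ?thesis using r by (intro exI[of _ "r/2"]) (auto simp: T_def)
qed

text \<open>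
  The identification of the plane with the complex numbers.
\<close>

definition zc :: "real \<times> real \<Rightarrow> complex" where "zc w = Complex (fst w) (snd w)"

lemma norm_zc [simp]: "norm (zc w) = norm w"
  by (cases w) (simp add: zc_def norm_Pair cmod_def)

lemma zc_bounded_linear: "bounded_linear zc"
proof (rule bounded_linear_intro[where K = 1])
  show "norm (zc w) \<le> norm w * 1" for w by simp
qed (auto simp: zc_def complex_eq_iff)

text \<open>
  Multiplication by a holomorphic function commutes with \<open>dbar\<close>.
\<close>

lemma C1_on_zc_mult:
  assumes f: "C1_on f S"
  shows "C1_on (\<lambda>w. zc w * f w) S" and "\<And>w. w \<in> S \<Longrightarrow> dbar (\<lambda>w. zc w * f w) w = zc w * dbar f w"
proof -
  have zd: "(zc has_derivative zc) (at w)" for w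
    using bounded_linear.has_derivative[OF zc_bounded_linear has_derivative_ident] .
  have z: "zc differentiable (at w)" "partial_x zc w = 1" "partial_y zc w = \<i>" for w
    using has_derivative_partials_unique[OF zd] differentiableI[OF zd]
    by (auto simp: zc_def complex_eq_iff)
  have fd: "f differentiable (at w)" if "w \<in> S" for w using f that by (auto simp: C1_on_def)
  have p: "(\<lambda>w. zc w * f w) differentiable (at w)"
    "partial_x (\<lambda>w. zc w * f w) w = zc w * partial_x f w + f w"
    "partial_y (\<lambda>w. zc w * f w) w = zc w * partial_y f w + \<i> * f w" if "w \<in> S" for w
    using partials_mult[OF z(1) fd[OF that]] z by simp_all
  have zc: "continuous_on S zc" using zc_bounded_linear by (rule linear_continuous_on)
  have "continuous_on S (partial_x (\<lambda>w. zc w * f w))" "continuous_on S (partial_y (\<lambda>w. zc w * f w))"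
    using f C1_on_continuous[OF f] zc
    by (subst continuous_on_cong[OF refl p(2)] continuous_on_cong[OF refl p(3)];
        auto simp: C1_on_def intro!: continuous_intros)+
  then show "C1_on (\<lambda>w. zc w * f w) S" using p(1) by (simp add: C1_on_def)
  show "dbar (\<lambda>w. zc w * f w) w = zc w * dbar f w" if "w \<in> S" for w
    unfolding dbar_def p(2,3)[OF that] by (simp add: algebra_simps)
qed

lemma punctured_two_point_bound:
  assumes f: "C1_on f (ball 0 r - {0})" and s: "0 < s" and M0: "0 \<le> M" and C0: "0 \<le> C"
    and z: "z \<noteq> 0" "norm z + s < r" "z' \<noteq> 0" "norm z' + s < r"
    and M: "\<And>w. w \<in> ball 0 r - {0} \<Longrightarrow> norm (f w) \<le> M"
    and C: "\<And>w. w \<in> ball 0 r - {0} \<Longrightarrow> norm (dbar f w) \<le> C * norm w powr (-3/4)"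
  shows "norm (f z - f z') \<le> 4 * M * dist z z' / s + 2 * (sing_const * C * s powr (1/4))"
proof -
  note cb = cball_subset_ball_0[of _ s r]
  have avg: "norm (disk_avg f x s - f x) \<le> sing_const * C * s powr (1/4)" if x: "x \<noteq> 0" "norm x + s < r" for x
  proof -
    have "norm (disk_avg f x s - f x) \<le> s * 0 + sing_const * C * s powr (1/4)"
    proof (rule disk_avg_bound[OF f _ _ cb[OF x(2)] s])
      fix w assume "w \<in> cball x s - {0}"
      then have w: "w \<in> ball 0 r - {0}" using cb[OF x(2)] by blast
      show "norm (f w) \<le> M" by (rule M[OF w])
      show "norm (dbar f w) \<le> 0 + C * norm w powr (-3/4)" using C[OF w] by simp
    qed (use x C0 in auto)
    then show ?thesis by simp
  qed
  have "norm (disk_avg f z s - disk_avg f z' s) \<le> 4 * M * dist z z' / s"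
  proof (rule disk_avg_shift[OF C1_on_continuous[OF f] _ _ s])
    show b: "ball z s \<subseteq> ball 0 r" "ball z' s \<subseteq> ball 0 r"
      using cb[OF z(2)] cb[OF z(4)] ball_subset_cball by blast+
    show "norm (f w) \<le> M" if "w \<in> (ball z s \<union> ball z' s) - {0}" for w
      using M[of w] that b by blast
  qed (use M0 in auto)
  then show ?thesis
    using avg[OF z(1,2)] avg[OF z(3,4)]
      norm_triangle_ineq4[of "disk_avg f z s - disk_avg f z' s" "(disk_avg f z s - f z) - (disk_avg f z' s - f z')"]
      norm_triangle_ineq4[of "disk_avg f z s - f z" "disk_avg f z' s - f z'"]
    by (simp add: algebra_simps)
qed

text \<open>
  One step of the iteration, at the scale \<open>s = k \<bar>z\<bar>\<close>. The function \<open>F(w) = w g(w)\<close> tends to \<open>0\<close> at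
  the origin, is at most \<open>\<bar>w\<bar>\<^bsup>1/2\<^esup> \<mu>\<close>, and has \<open>\<bar>dbar F\<bar> \<le> K \<mu>\<^sup>3 \<bar>w\<bar>\<^bsup>-1/2\<^esup>\<close>; the
  two-point estimate between \<open>z\<close> and points tending to the origin bounds \<open>F(z)\<close>.
\<close>

lemma decay_step:
  fixes S :: "(real \<times> real \<Rightarrow> complex) set"
  assumes fin: "finite S" and K: "0 \<le> K" and r: "0 < r" and r1: "r \<le> R"
    and C1: "\<And>f. f \<in> S \<Longrightarrow> C1_on f (ball 0 R - {0})"
    and D: "\<And>f w. f \<in> S \<Longrightarrow> w \<in> ball 0 R - {0} \<Longrightarrow> norm (dbar f w) \<le> K * (\<Sum>g\<in>S. norm (g w)) ^ 3"
    and \<mu>: "0 \<le> \<mu>" "\<And>w. w \<in> ball 0 r - {0} \<Longrightarrow> sqrt (norm w) * (\<Sum>g\<in>S. norm (g w)) \<le> \<mu>"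
    and k: "1 \<le> k" and z: "z \<noteq> 0" "(k + 2) * norm z = r" and g: "g \<in> S"
  shows "sqrt (norm z) * norm (g z) \<le> sqrt (k + 2) * (8 / k + 2 * sing_const * K * \<mu>\<^sup>2) * \<mu>"
proof -
  define T where "T w = (\<Sum>g\<in>S. norm (g w))" for w
  have T0: "0 \<le> T w" for w unfolding T_def by (intro sum_nonneg) auto
  have gT: "norm (g w) \<le> T w" for w
    unfolding T_def by (rule norm_le_sum_norm[OF fin g])
  have \<mu>T: "sqrt (norm w) * T w \<le> \<mu>" if "w \<in> ball 0 r - {0}" for w using \<mu>(2)[OF that] by (simp add: T_def)
  define F where "F w = zc w * g w" for w
  have inR: "w \<in> ball 0 R - {0}" if "w \<in> ball 0 r - {0}" for w :: "real \<times> real" using that r1 by auto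
  have F: "C1_on F (ball 0 r - {0})"
    unfolding F_def by (rule C1_on_zc_mult(1)[OF C1_on_subset[OF C1[OF g]]]) (use r1 in auto)
  have dF: "dbar F w = zc w * dbar g w" if "w \<in> ball 0 r - {0}" for w
    unfolding F_def by (rule C1_on_zc_mult(2)[OF C1[OF g] inR[OF that]])
  define M where "M = sqrt r * \<mu>"
  have M0: "0 \<le> M" using r \<mu> by (simp add: M_def)
  have Fw: "norm (F w) \<le> sqrt (norm w) * \<mu>" if w: "w \<in> ball 0 r - {0}" for w
  proof -
    have "norm (F w) \<le> norm w * T w" unfolding F_def norm_mult norm_zc using gT by (intro mult_left_mono) auto
    also have "\<dots> = sqrt (norm w) * (sqrt (norm w) * T w)" by simp
    also have "\<dots> \<le> sqrt (norm w) * \<mu>" using \<mu>T[OF w] by (intro mult_left_mono) auto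
    finally show ?thesis .
  qed
  have FM: "norm (F w) \<le> M" if w: "w \<in> ball 0 r - {0}" for w
  proof -
    have "sqrt (norm w) * \<mu> \<le> sqrt r * \<mu>" using w \<mu>(1) by (intro mult_right_mono) auto
    then show ?thesis using Fw[OF w] by (simp add: M_def)
  qed
  define C where "C = K * \<mu> ^ 3 * r powr (1/4)"
  have C0: "0 \<le> C" using K \<mu> by (simp add: C_def)
  have FC: "norm (dbar F w) \<le> C * norm w powr (-3/4)" if w: "w \<in> ball 0 r - {0}" for w
  proof -
    define n where "n = norm w"
    have n: "0 < n" "n \<le> r" using w by (auto simp: n_def)
    have pw: "n = n powr (3/2) * n powr (1/4) * n powr (-3/4)" using n by (simp flip: powr_add)
    have s3: "n powr (3/2) = sqrt n ^ 3" using n by (simp add: powr_half_sqrt[symmetric] powr_power)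
    have "norm (dbar F w) = n * norm (dbar g w)" by (simp add: dF[OF w] norm_mult n_def)
    also have "\<dots> \<le> n * (K * T w ^ 3)"
      using D[OF g inR[OF w]] n by (intro mult_left_mono) (auto simp: T_def)
    also have "\<dots> = K * (sqrt n * T w) ^ 3 * n powr (1/4) * n powr (-3/4)"
      by (subst pw) (simp add: s3 power_mult_distrib)
    also have "\<dots> \<le> K * \<mu> ^ 3 * r powr (1/4) * n powr (-3/4)"
      using K T0[of w] \<mu>T[OF w] \<mu>(1) n
      by (intro mult_right_mono mult_mono mult_left_mono power_mono powr_mono2) (auto simp: n_def)
    finally show ?thesis by (simp add: C_def n_def)
  qed
  define s where "s = k * norm z"
  have s: "0 < s" using k z by (simp add: s_def)
  have sr: "s \<le> r" "norm z + s < r" using z k by (auto simp: s_def algebra_simps)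
  have rem: "2 * (sing_const * C * s powr (1/4)) \<le> 2 * sing_const * K * \<mu> ^ 3 * sqrt r"
  proof -
    have "sing_const * C * s powr (1/4) \<le> sing_const * C * r powr (1/4)"
      using s sr C0 sing_const_nonneg by (intro mult_left_mono powr_mono2) auto
    also have "\<dots> = sing_const * (K * \<mu> ^ 3) * (r powr (1/4) * r powr (1/4))" by (simp add: C_def)
    also have "r powr (1/4) * r powr (1/4) = sqrt r" using r by (simp add: powr_half_sqrt flip: powr_add)
    finally show ?thesis by simp
  qed
  define B where "B = 8 * M / k + 2 * sing_const * K * \<mu> ^ 3 * sqrt r"
  have two: "norm (F z - F z') \<le> B" if z': "z' \<noteq> 0" "norm z' \<le> norm z" for z'
  proof -
    have "norm (F z - F z') \<le> 4 * M * dist z z' / s + 2 * (sing_const * C * s powr (1/4))"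
      by (rule punctured_two_point_bound[OF F s M0 C0 _ _ _ _ FM FC]) (use z z' sr in auto)
    also have "4 * M * dist z z' / s \<le> 8 * M / k"
    proof -
      have "dist z z' \<le> 2 * norm z" using z' norm_triangle_ineq4[of z z'] by (simp add: dist_norm)
      then have "4 * M * dist z z' / s \<le> 4 * M * (2 * norm z) / s"
        using M0 s by (intro divide_right_mono mult_left_mono) auto
      also have "\<dots> = 8 * M / k" using z k by (simp add: s_def)
      finally show ?thesis .
    qed
    finally show ?thesis using rem by (simp add: B_def)
  qed
  have "norm (F z) \<le> B"
  proof (rule field_le_epsilon)
    fix e :: real assume e: "0 < e"
    define t where "t = min (norm z) ((e / (\<mu> + 1))\<^sup>2)"
    have t: "0 < t" "t \<le> norm z" using z e \<mu> by (auto simp: t_def)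
    define z' where "z' = (t / norm z) *\<^sub>R z"
    have nz': "norm z' = t" using t z by (simp add: z'_def)
    then have z': "z' \<noteq> 0" using t by auto
    have "sqrt t \<le> sqrt ((e / (\<mu> + 1))\<^sup>2)" unfolding t_def by (intro real_sqrt_le_mono) auto
    then have st: "sqrt t \<le> e / (\<mu> + 1)" using e \<mu> by simp
    have "z' \<in> ball 0 r - {0}" using z' nz' t sr s by auto
    from Fw[OF this] have "norm (F z') \<le> sqrt t * \<mu>" by (simp add: nz')
    also have "\<dots> \<le> e / (\<mu> + 1) * \<mu>" using st \<mu> by (intro mult_right_mono) auto
    also have "\<dots> \<le> e" using e \<mu> by (simp add: field_simps)
    finally show "norm (F z) \<le> B + e"
      using two[OF z'] nz' t norm_triangle_sub[of "F z" "F z'"] by simp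
  qed
  then have "sqrt (norm z) * (sqrt (norm z) * norm (g z)) \<le> B"
    by (simp add: F_def norm_mult mult.assoc[symmetric])
  also have "B = sqrt (norm z) * (sqrt (k + 2) * (8 / k + 2 * sing_const * K * \<mu>\<^sup>2) * \<mu>)"
    unfolding B_def M_def z(2)[symmetric] real_sqrt_mult
    by (simp add: algebra_simps power2_eq_square power3_eq_cube add_divide_distrib)
  finally show ?thesis using z by simp
qed

text \<open>
  Let \<open>T\<close> be the sum of the absolute values over the family.
  With \<open>k + 2 = \<Lambda>\<^sup>4\<close>, the step turns a bound \<open>\<mu>\<close> for \<open>\<bar>z\<bar>\<^bsup>1/2\<^esup> T(z)\<close> on a disk into the bound
  \<open>\<mu>/\<Lambda>\<close> on the disk that is smaller by the factor \<open>\<Lambda>\<^sup>4\<close>. This is the rate \<open>\<bar>z\<bar>\<^bsup>1/4\<^esup>\<close>. The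
  main term of the step has the factor \<open>(k + 2)\<^bsup>1/2\<^esup>/k\<close>, which beats \<open>1/\<Lambda>\<close> for large \<open>\<Lambda>\<close>.
\<close>

lemma removable_decay:
  fixes S :: "(real \<times> real \<Rightarrow> complex) set"
  assumes fin: "finite S" and R: "0 < R" and K: "0 \<le> K"
    and C1: "\<And>f. f \<in> S \<Longrightarrow> C1_on f (ball 0 R - {0})"
    and D: "\<And>f w. f \<in> S \<Longrightarrow> w \<in> ball 0 R - {0} \<Longrightarrow> norm (dbar f w) \<le> K * (\<Sum>g\<in>S. norm (g w)) ^ 3"
    and L4: "set_integrable lborel (ball 0 R) (\<lambda>w. (\<Sum>g\<in>S. norm (g w)) ^ 4)"
  shows "\<exists>r C. 0 < r \<and> r \<le> R \<and> 0 \<le> C \<and> (\<forall>z\<in>ball 0 r - {0}. (\<Sum>g\<in>S. norm (g z)) \<le> C * norm z powr (-1/4))"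
proof -
  define T where "T w = (\<Sum>g\<in>S. norm (g w))" for w
  have T0: "0 \<le> T w" for w unfolding T_def by (intro sum_nonneg) auto
  define N where "N = real (card S)"
  have N0: "0 \<le> N" by (simp add: N_def)
  \<comment> \<open>the disks shrink by \<open>\<Lambda>\<^sup>4\<close>; the constant makes \<open>Nk\<close> below hold for the number \<open>N\<close> of functions\<close>
  define \<Lambda> where "\<Lambda> = 16 * N + 2"
  define k where "k = \<Lambda> ^ 4 - 2"
  have \<Lambda>2: "2 \<le> \<Lambda>" using N0 by (simp add: \<Lambda>_def)
  then have l4: "2 ^ 4 \<le> \<Lambda> ^ 4" by (intro power_mono) auto
  then have k1: "1 \<le> k" by (simp add: k_def)
  have Nk: "N * (\<Lambda>\<^sup>2 * (8 / k)) \<le> 1 / (2 * \<Lambda>)"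
  proof -
    have "16 * N * \<Lambda> ^ 3 \<le> k"
    proof -
      have "\<Lambda> ^ 4 - 16 * N * \<Lambda> ^ 3 = 2 * \<Lambda> ^ 3"
        by (simp add: \<Lambda>_def power3_eq_cube power4_eq_xxxx algebra_simps)
      moreover have "1 \<le> \<Lambda> ^ 3" using \<Lambda>2 by (intro one_le_power) auto
      ultimately show ?thesis by (simp add: k_def)
    qed
    then have "16 * N * \<Lambda> ^ 3 / (2 * \<Lambda> * k) \<le> k / (2 * \<Lambda> * k)" using \<Lambda>2 k1 by (intro divide_right_mono) auto
    then show ?thesis using \<Lambda>2 k1 by (simp add: field_simps power2_eq_square power3_eq_cube)
  qed
  define c where "c = 2 * sing_const * K"
  have c0: "0 \<le> c" using K sing_const_nonneg by (simp add: c_def)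
  \<comment> \<open>smallness that makes the cubic term at most \<open>\<mu> / (2 \<Lambda>)\<close>\<close>
  define \<eta> where "\<eta> = 1 / (2 * \<Lambda> * (N * \<Lambda>\<^sup>2 * c + 1))"
  have pos: "0 < N * \<Lambda>\<^sup>2 * c + 1" using N0 c0 by (simp add: add_nonneg_pos)
  have \<eta>: "0 < \<eta>" using \<Lambda>2 pos by (simp add: \<eta>_def)
  have N\<eta>: "N * (\<Lambda>\<^sup>2 * (c * \<eta>)) \<le> 1 / (2 * \<Lambda>)"
  proof -
    have "N * (\<Lambda>\<^sup>2 * (c * \<eta>)) = (N * \<Lambda>\<^sup>2 * c) / (N * \<Lambda>\<^sup>2 * c + 1) * (1 / (2 * \<Lambda>))"
      by (simp add: \<eta>_def mult_ac)
    also have "\<dots> \<le> 1 * (1 / (2 * \<Lambda>))" using pos \<Lambda>2 N0 c0 by (intro mult_right_mono) auto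
    finally show ?thesis by simp
  qed
  obtain r where r: "0 < r" "r \<le> R" "\<And>z. z \<in> ball 0 r - {0} \<Longrightarrow> norm z * (T z)\<^sup>2 \<le> \<eta>"
    using critical_decay[OF fin R K C1 D L4 \<eta>] unfolding T_def by blast
  have base: "sqrt (norm z) * T z \<le> sqrt \<eta>" if "z \<in> ball 0 r - {0}" for z
  proof -
    have "sqrt (norm z * (T z)\<^sup>2) \<le> sqrt \<eta>" using r(3)[OF that] by (rule real_sqrt_le_mono)
    then show ?thesis using T0 by (simp add: real_sqrt_mult)
  qed
  have iter: "\<forall>z\<in>ball 0 (r / (\<Lambda>^4)^j) - {0}. sqrt (norm z) * T z \<le> sqrt \<eta> / \<Lambda> ^ j" for j
  proof (induction j)
    case 0
    then show ?case using base by simp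
  next
    case (Suc j)
    show ?case
    proof
      fix z :: "real \<times> real" assume z: "z \<in> ball 0 (r / (\<Lambda>^4)^Suc j) - {0}"
      define \<mu> where "\<mu> = sqrt \<eta> / \<Lambda> ^ j"
      have \<mu>0: "0 \<le> \<mu>" using \<eta> \<Lambda>2 by (simp add: \<mu>_def)
      have "\<mu> \<le> sqrt \<eta> / 1" unfolding \<mu>_def using \<Lambda>2 \<eta> by (intro divide_left_mono one_le_power) auto
      then have \<mu>\<eta>: "\<mu>\<^sup>2 \<le> \<eta>" using power_mono[OF _ \<mu>0, of "sqrt \<eta>" 2] \<eta> by simp
      define r' where "r' = (k + 2) * norm z"
      have r'0: "0 < r'" using z k1 by (simp add: r'_def)
      have lp: "0 < \<Lambda> ^ 4" using \<Lambda>2 by simp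
      have "\<Lambda>^4 * norm z \<le> \<Lambda>^4 * (r / (\<Lambda>^4)^Suc j)" using z lp by (intro mult_left_mono) auto
      also have "\<dots> = r / (\<Lambda>^4)^j" using lp by simp
      finally have r'1: "r' \<le> r / (\<Lambda>^4)^j" by (simp add: r'_def k_def)
      also have "\<dots> \<le> r / 1" using r \<Lambda>2 by (intro divide_left_mono one_le_power) auto
      finally have r'R: "r' \<le> R" using r by simp
      have g: "sqrt (norm z) * norm (g z) \<le> \<Lambda>\<^sup>2 * (8 / k + c * \<eta>) * \<mu>" if "g \<in> S" for g
      proof -
        have "sqrt (norm z) * norm (g z) \<le> sqrt (k + 2) * (8 / k + 2 * sing_const * K * \<mu>\<^sup>2) * \<mu>"
        proof (rule decay_step[OF fin K r'0 r'R C1 D \<mu>0 _ k1 _ _ that])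
          fix w :: "real \<times> real" assume "w \<in> ball 0 r' - {0}"
          then have "w \<in> ball 0 (r / (\<Lambda>^4)^j) - {0}" using r'1 by auto
          then show "sqrt (norm w) * (\<Sum>g\<in>S. norm (g w)) \<le> \<mu>" using Suc.IH by (simp add: T_def \<mu>_def)
        qed (use z in \<open>auto simp: r'_def\<close>)
        also have "sqrt (k + 2) = \<Lambda>\<^sup>2"
        proof -
          have "k + 2 = (\<Lambda>\<^sup>2)\<^sup>2" by (simp add: k_def flip: power_mult)
          then show ?thesis by (simp only: real_sqrt_abs abs_power2)
        qed
        also have "\<Lambda>\<^sup>2 * (8 / k + 2 * sing_const * K * \<mu>\<^sup>2) * \<mu> \<le> \<Lambda>\<^sup>2 * (8 / k + c * \<eta>) * \<mu>"
          unfolding c_def[symmetric] using \<mu>\<eta> \<mu>0 c0 by (intro mult_right_mono mult_left_mono add_left_mono) auto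
        finally show ?thesis .
      qed
      have "sqrt (norm z) * T z = (\<Sum>g\<in>S. sqrt (norm z) * norm (g z))" by (simp add: T_def sum_distrib_left)
      also have "\<dots> \<le> N * (\<Lambda>\<^sup>2 * (8 / k + c * \<eta>) * \<mu>)" unfolding N_def by (intro sum_bounded_above g)
      also have "\<dots> = (N * (\<Lambda>\<^sup>2 * (8 / k)) + N * (\<Lambda>\<^sup>2 * (c * \<eta>))) * \<mu>" by (simp add: algebra_simps)
      also have "\<dots> \<le> (1 / (2 * \<Lambda>) + 1 / (2 * \<Lambda>)) * \<mu>" using Nk N\<eta> \<mu>0 by (intro mult_right_mono add_mono)
      also have "\<dots> = sqrt \<eta> / \<Lambda> ^ Suc j" using \<Lambda>2 by (simp add: \<mu>_def)
      finally show "sqrt (norm z) * T z \<le> sqrt \<eta> / \<Lambda> ^ Suc j" .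
    qed
  qed
  define C where "C = sqrt \<eta> * \<Lambda> * r powr (-1/4)"
  have "T z \<le> C * norm z powr (-1/4)" if z: "z \<in> ball 0 r - {0}" for z
  proof -
    have nz: "0 < norm z" "norm z < r" using z by auto
    have x1: "1 < r / norm z" using nz by simp
    have lam1: "1 < \<Lambda> ^ 4" using l4 by simp
    define P where "P n \<longleftrightarrow> r / norm z \<le> (\<Lambda>^4)^n" for n
    obtain n where "P n" unfolding P_def using real_arch_pow[OF lam1] less_imp_le by blast
    then have Pn: "P (LEAST n. P n)" by (rule LeastI)
    have "\<not> P 0" using x1 by (simp add: P_def)
    then have "(LEAST n. P n) \<noteq> 0" using Pn by metis
    then obtain j where j: "(LEAST n. P n) = Suc j" using not0_implies_Suc by blast
    have Pj: "r / norm z \<le> (\<Lambda>^4)^Suc j" using Pn j by (simp add: P_def)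
    have "\<not> P j" using not_less_Least[of j P] j by simp
    then have nPj: "(\<Lambda>^4)^j < r / norm z" by (simp add: P_def)
    have lj: "0 < \<Lambda> ^ j" using \<Lambda>2 by simp
    have "norm z < r / (\<Lambda>^4)^j"
    proof -
      have lp: "0 < (\<Lambda>^4)^j" using \<Lambda>2 by simp
      have "(\<Lambda>^4)^j * norm z < r" using nPj nz by (simp add: pos_less_divide_eq)
      then show ?thesis unfolding pos_less_divide_eq[OF lp] by (simp only: mult.commute)
    qed
    then have small: "sqrt (norm z) * T z \<le> sqrt \<eta> / \<Lambda> ^ j" using iter[of j] z by auto
    have lam: "1 / \<Lambda> ^ j \<le> \<Lambda> * (norm z powr (1/4) * r powr (-1/4))"
    proof -
      have "(r / norm z) powr (1/4) \<le> ((\<Lambda>^4)^Suc j) powr (1/4)" using Pj nz r by (intro powr_mono2) auto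
      also have "(\<Lambda>^4)^Suc j = (\<Lambda> ^ Suc j) ^ 4" by (simp only: power_mult[symmetric] mult.commute)
      also have "((\<Lambda> ^ Suc j) ^ 4) powr (1/4) = \<Lambda> ^ Suc j"
        using \<Lambda>2 by (simp add: powr_powr flip: powr_numeral)
      finally have "(r / norm z) powr (1/4) \<le> \<Lambda> * \<Lambda> ^ j" by simp
      then have "r powr (1/4) / norm z powr (1/4) \<le> \<Lambda> * \<Lambda> ^ j" using nz r by (simp add: powr_divide)
      then have "1 / \<Lambda> ^ j \<le> \<Lambda> * (norm z powr (1/4) / r powr (1/4))"
        using nz r lj by (simp add: field_simps)
      then show ?thesis by (simp add: powr_minus_divide)
    qed
    have "sqrt (norm z) * T z \<le> sqrt \<eta> * (1 / \<Lambda> ^ j)" using small by simp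
    also have "\<dots> \<le> sqrt \<eta> * (\<Lambda> * (norm z powr (1/4) * r powr (-1/4)))" using lam \<eta> by (intro mult_left_mono) auto
    also have "\<dots> = C * norm z powr (1/4)" by (simp add: C_def)
    also have "norm z powr (1/4) = sqrt (norm z) * norm z powr (-1/4)"
      using nz by (simp add: powr_half_sqrt[symmetric] flip: powr_add)
    finally have "sqrt (norm z) * T z \<le> sqrt (norm z) * (C * norm z powr (-1/4))" by (simp add: mult.left_commute)
    then show ?thesis using nz by simp
  qed
  moreover have "0 \<le> C" using \<eta> \<Lambda>2 by (simp add: C_def)
  ultimately show ?thesis using r(1,2) unfolding T_def by blast
qed

lemma removable_bounded:
  fixes S :: "(real \<times> real \<Rightarrow> complex) set"
  assumes fin: "finite S" and R: "0 < R" and K: "0 \<le> K"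
    and C1: "\<And>f. f \<in> S \<Longrightarrow> C1_on f (ball 0 R - {0})"
    and D: "\<And>f w. f \<in> S \<Longrightarrow> w \<in> ball 0 R - {0} \<Longrightarrow> norm (dbar f w) \<le> K * (\<Sum>g\<in>S. norm (g w)) ^ 3"
    and L4: "set_integrable lborel (ball 0 R) (\<lambda>w. (\<Sum>g\<in>S. norm (g w)) ^ 4)"
  shows "\<exists>r M. 0 < r \<and> r \<le> R \<and> (\<forall>f\<in>S. \<forall>z\<in>ball 0 r - {0}. norm (f z) \<le> M)"
proof -
  define T where "T w = (\<Sum>g\<in>S. norm (g w))" for w
  have T0: "0 \<le> T w" for w unfolding T_def by (intro sum_nonneg) auto
  obtain r C where r: "0 < r" "r \<le> R" and C: "0 \<le> C" "\<And>z. z \<in> ball 0 r - {0} \<Longrightarrow> T z \<le> C * norm z powr (-1/4)"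
    using removable_decay[OF assms] unfolding T_def by blast
  define s where "s = r / 2"
  have s: "0 < s" using r by (simp add: s_def)
  define M where "M = C * (s/2) powr (-1/4) + sing_const * (K * C ^ 3) * s powr (1/4)"
  have "norm (f z) \<le> M" if f: "f \<in> S" and z: "z \<in> ball 0 (s/2) - {0}" for f z
  proof -
    let ?x = "(1, 0) :: real \<times> real"
    have fT: "norm (f w) \<le> T w" for w
      unfolding T_def by (rule norm_le_sum_norm[OF fin f])
    have fr: "C1_on f (ball 0 r - {0})" by (rule C1_on_subset[OF C1[OF f]]) (use r in auto)
    have cb: "cball z s \<subseteq> ball 0 r"
      by (rule cball_subset_ball_0) (use z s in \<open>simp add: s_def\<close>)
    have "norm (cmean f z (s *\<^sub>R ?x) - f z) \<le> s * 0 + sing_const * (K * C ^ 3) * s powr (1/4)"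
    proof (rule cmean_bound[OF fr _ _ cb, where A = C])
      fix w assume "w \<in> cball z s - {0}"
      then have w: "w \<in> ball 0 r - {0}" using cb by blast
      then have wR: "w \<in> ball 0 R - {0}" using r by auto
      have n: "0 < norm w" using w by auto
      have le: "norm w powr (-1/4) \<le> 1 + norm w powr (-3/4)"
      proof (cases "norm w \<le> 1")
        case True
        then have "norm w powr (-1/4) \<le> norm w powr (-3/4)" using n by (intro powr_mono') auto
        then show ?thesis by simp
      next
        case False
        then have "norm w powr (-1/4) \<le> 1 powr (-1/4)" by (intro powr_mono2') auto
        then show ?thesis by (simp add: add_increasing2)
      qed
      have "norm (f w) \<le> C * norm w powr (-1/4)" using fT[of w] C(2)[OF w] by linarith
      also have "\<dots> \<le> C * (1 + norm w powr (-3/4))" using le C(1) by (intro mult_left_mono)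
      finally show "norm (f w) \<le> C * (1 + norm w powr (-3/4))" .
      have "norm (dbar f w) \<le> K * T w ^ 3" using D[OF f wR] by (simp add: T_def)
      also have "\<dots> \<le> K * (C * norm w powr (-1/4)) ^ 3"
        using K T0 C(2)[OF w] by (intro mult_left_mono power_mono)
      also have "\<dots> = K * C ^ 3 * norm w powr (-3/4)"
        using n by (simp add: power_mult_distrib powr_power)
      finally show "norm (dbar f w) \<le> 0 + K * C ^ 3 * norm w powr (-3/4)" by simp
    qed (use s z K C in \<open>auto simp: norm_Pair\<close>)
    moreover have "norm (cmean f z (s *\<^sub>R ?x) - 0) \<le> C * (s/2) powr (-1/4)"
    proof (rule cmean_close)
      have far: "z + rot \<theta> (s *\<^sub>R ?x) \<in> ball 0 r - {0}" "s/2 \<le> norm (z + rot \<theta> (s *\<^sub>R ?x))" for \<theta>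
      proof -
        have n: "norm (rot \<theta> (s *\<^sub>R ?x)) = s" using s by (simp add: norm_Pair)
        have "z + rot \<theta> (s *\<^sub>R ?x) \<in> cball z s" using n by (simp add: dist_norm)
        moreover show lo: "s/2 \<le> norm (z + rot \<theta> (s *\<^sub>R ?x))"
          using norm_diff_ineq[of "rot \<theta> (s *\<^sub>R ?x)" z] z n by (simp add: add.commute)
        moreover have "z + rot \<theta> (s *\<^sub>R ?x) \<noteq> 0" using lo s by auto
        ultimately show "z + rot \<theta> (s *\<^sub>R ?x) \<in> ball 0 r - {0}" using cb by blast
      qed
      show "continuous_on {0..2*pi} (\<lambda>\<theta>. f (z + rot \<theta> (s *\<^sub>R ?x)))"
      proof (rule continuous_on_compose2[OF C1_on_continuous[OF fr]])
        show "(\<lambda>\<theta>. z + rot \<theta> (s *\<^sub>R ?x)) ` {0..2*pi} \<subseteq> ball 0 r - {0}"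
          by (rule image_subsetI) (rule far(1))
      qed (intro continuous_intros)
      fix \<theta>
      have "norm (f (z + rot \<theta> (s *\<^sub>R ?x))) \<le> C * norm (z + rot \<theta> (s *\<^sub>R ?x)) powr (-1/4)"
        using fT C(2)[OF far(1)] order_trans by blast
      also have "\<dots> \<le> C * (s/2) powr (-1/4)"
        using C(1) s far(2) by (intro mult_left_mono powr_mono2') auto
      finally show "norm (f (z + rot \<theta> (s *\<^sub>R ?x)) - 0) \<le> C * (s/2) powr (-1/4)" by simp
    qed
    ultimately show ?thesis
      using norm_triangle_ineq4[of "cmean f z (s *\<^sub>R ?x)" "cmean f z (s *\<^sub>R ?x) - f z"] by (simp add: M_def)
  qed
  then show ?thesis using s r by (intro exI[of _ "s/2"] exI[of _ M]) (auto simp: s_def)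
qed

section \<open>Functions of class C^k\<close>

lemma schwarz_real:
  fixes \<phi> \<phi>x \<phi>y \<phi>xy \<phi>yx :: "real \<times> real \<Rightarrow> real"
  assumes S: "open S" and p: "(a, b) \<in> S"
    and dx: "\<And>x y. (x, y) \<in> S \<Longrightarrow> ((\<lambda>x. \<phi> (x, y)) has_real_derivative \<phi>x (x, y)) (at x)"
    and dy: "\<And>x y. (x, y) \<in> S \<Longrightarrow> ((\<lambda>y. \<phi> (x, y)) has_real_derivative \<phi>y (x, y)) (at y)"
    and dxy: "\<And>x y. (x, y) \<in> S \<Longrightarrow> ((\<lambda>y. \<phi>x (x, y)) has_real_derivative \<phi>xy (x, y)) (at y)"
    and dyx: "\<And>x y. (x, y) \<in> S \<Longrightarrow> ((\<lambda>x. \<phi>y (x, y)) has_real_derivative \<phi>yx (x, y)) (at x)"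
    and c: "isCont \<phi>xy (a, b)" "isCont \<phi>yx (a, b)"
  shows "\<phi>xy (a, b) = \<phi>yx (a, b)"
proof (rule ccontr)
  assume ne: "\<phi>xy (a, b) \<noteq> \<phi>yx (a, b)"
  define e where "e = \<bar>\<phi>xy (a, b) - \<phi>yx (a, b)\<bar> / 2"
  have e: "0 < e" using ne by (simp add: e_def)
  obtain d1 where d1: "0 < d1" "\<And>q. dist q (a, b) < d1 \<Longrightarrow> dist (\<phi>xy q) (\<phi>xy (a, b)) < e"
    using c(1) e unfolding continuous_at_eps_delta by blast
  obtain d2 where d2: "0 < d2" "\<And>q. dist q (a, b) < d2 \<Longrightarrow> dist (\<phi>yx q) (\<phi>yx (a, b)) < e"
    using c(2) e unfolding continuous_at_eps_delta by blast
  obtain d3 where d3: "0 < d3" "ball (a, b) d3 \<subseteq> S" using S p open_contains_ball by blast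
  define h where "h = min d1 (min d2 d3) / 3"
  have h: "0 < h" using d1 d2 d3 by (simp add: h_def)
  have near: "dist (x, y) (a, b) < min d1 (min d2 d3)" if "a \<le> x" "x \<le> a + h" "b \<le> y" "y \<le> b + h" for x y
  proof -
    have "dist (x, y) (a, b) \<le> \<bar>x - a\<bar> + \<bar>y - b\<bar>"
      unfolding dist_Pair_Pair dist_real_def using sqrt_sum_squares_le_sum_abs by simp
    also have "\<dots> \<le> 2 * h" using that by simp
    also have "\<dots> < min d1 (min d2 d3)" using h unfolding h_def by linarith
    finally show ?thesis .
  qed
  have inS: "(x, y) \<in> S" if "a \<le> x" "x \<le> a + h" "b \<le> y" "y \<le> b + h" for x y
  proof -
    have "(x, y) \<in> ball (a, b) d3" using near[OF that] by (simp add: dist_commute)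
    then show ?thesis using d3(2) by blast
  qed
  let ?\<Delta> = "\<phi> (a + h, b + h) - \<phi> (a + h, b) - \<phi> (a, b + h) + \<phi> (a, b)"
  obtain x1 y1 where 1: "a < x1" "x1 < a + h" "b < y1" "y1 < b + h" "?\<Delta> = h * (h * \<phi>xy (x1, y1))"
  proof -
    have "\<exists>x>a. x < a + h \<and> (\<lambda>x. \<phi> (x, b + h) - \<phi> (x, b)) (a + h) - (\<lambda>x. \<phi> (x, b + h) - \<phi> (x, b)) a
        = (a + h - a) * (\<phi>x (x, b + h) - \<phi>x (x, b))"
    proof (rule MVT2)
      fix x assume "a \<le> x" "x \<le> a + h"
      then show "((\<lambda>x. \<phi> (x, b + h) - \<phi> (x, b)) has_real_derivative \<phi>x (x, b + h) - \<phi>x (x, b)) (at x)"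
        using h by (intro DERIV_diff dx inS) auto
    qed (use h in simp)
    then obtain x where x: "a < x" "x < a + h" "?\<Delta> = h * (\<phi>x (x, b + h) - \<phi>x (x, b))" by auto
    have "\<exists>y>b. y < b + h \<and> (\<lambda>y. \<phi>x (x, y)) (b + h) - (\<lambda>y. \<phi>x (x, y)) b = (b + h - b) * \<phi>xy (x, y)"
    proof (rule MVT2)
      fix y assume "b \<le> y" "y \<le> b + h"
      then show "((\<lambda>y. \<phi>x (x, y)) has_real_derivative \<phi>xy (x, y)) (at y)" using x by (intro dxy inS) auto
    qed (use h in simp)
    then show thesis using x that by auto
  qed
  obtain x2 y2 where 2: "a < x2" "x2 < a + h" "b < y2" "y2 < b + h" "?\<Delta> = h * (h * \<phi>yx (x2, y2))"
  proof -
    have "\<exists>y>b. y < b + h \<and> (\<lambda>y. \<phi> (a + h, y) - \<phi> (a, y)) (b + h) - (\<lambda>y. \<phi> (a + h, y) - \<phi> (a, y)) b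
        = (b + h - b) * (\<phi>y (a + h, y) - \<phi>y (a, y))"
    proof (rule MVT2)
      fix y assume "b \<le> y" "y \<le> b + h"
      then show "((\<lambda>y. \<phi> (a + h, y) - \<phi> (a, y)) has_real_derivative \<phi>y (a + h, y) - \<phi>y (a, y)) (at y)"
        using h by (intro DERIV_diff dy inS) auto
    qed (use h in simp)
    then obtain y where y: "b < y" "y < b + h" "?\<Delta> = h * (\<phi>y (a + h, y) - \<phi>y (a, y))" by auto
    have "\<exists>x>a. x < a + h \<and> (\<lambda>x. \<phi>y (x, y)) (a + h) - (\<lambda>x. \<phi>y (x, y)) a = (a + h - a) * \<phi>yx (x, y)"
    proof (rule MVT2)
      fix x assume "a \<le> x" "x \<le> a + h"
      then show "((\<lambda>x. \<phi>y (x, y)) has_real_derivative \<phi>yx (x, y)) (at x)" using y by (intro dyx inS) auto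
    qed (use h in simp)
    then show thesis using y that by auto
  qed
  have "\<phi>xy (x1, y1) = \<phi>yx (x2, y2)" using 1(5) 2(5) h by simp
  moreover have "dist (\<phi>xy (x1, y1)) (\<phi>xy (a, b)) < e" using d1(2) near[of x1 y1] 1 by auto
  moreover have "dist (\<phi>yx (x2, y2)) (\<phi>yx (a, b)) < e" using d2(2) near[of x2 y2] 2 by auto
  ultimately show False by (auto simp: e_def dist_real_def abs_if split: if_splits)
qed

lemma schwarz:
  assumes S: "open S" and z: "z \<in> S" and f: "\<And>w. w \<in> S \<Longrightarrow> f differentiable (at w)"
    and fx: "C1_on (partial_x f) S" and fy: "C1_on (partial_y f) S"
  shows "partial_y (partial_x f) z = partial_x (partial_y f) z"
proof -
  have axis: "((\<lambda>x. L (g (x, y))) has_real_derivative L (partial_x g (x, y))) (at x)"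
    "((\<lambda>y. L (g (x, y))) has_real_derivative L (partial_y g (x, y))) (at y)"
    if L: "bounded_linear L" and g: "g differentiable (at (x, y))" for L :: "complex \<Rightarrow> real" and g x y
  proof -
    note h = bounded_linear.has_derivative[OF L has_derivative_partials[OF g]]
    have "((\<lambda>x. (x, y)) has_derivative (\<lambda>h. (h, 0))) (at x)" by (auto intro!: derivative_eq_intros)
    from has_derivative_compose[OF this h]
    show "((\<lambda>x. L (g (x, y))) has_real_derivative L (partial_x g (x, y))) (at x)"
      unfolding has_field_derivative_def
      by (rule has_derivative_eq_rhs) (auto simp: fun_eq_iff linear_scale[OF bounded_linear.linear[OF L]])
    have "((\<lambda>y. (x, y)) has_derivative (\<lambda>h. (0, h))) (at y)" by (auto intro!: derivative_eq_intros)
    from has_derivative_compose[OF this h]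
    show "((\<lambda>y. L (g (x, y))) has_real_derivative L (partial_y g (x, y))) (at y)"
      unfolding has_field_derivative_def
      by (rule has_derivative_eq_rhs) (auto simp: fun_eq_iff linear_scale[OF bounded_linear.linear[OF L]])
  qed
  have main: "L (partial_y (partial_x f) z) = L (partial_x (partial_y f) z)" if L: "bounded_linear L" for L :: "complex \<Rightarrow> real"
  proof -
    obtain a b where ab: "z = (a, b)" by (rule prod.exhaust)
    have Lc: "isCont L w" for w using L by (rule linear_continuous_at)
    have "isCont (partial_y (partial_x f)) (a, b)" "isCont (partial_x (partial_y f)) (a, b)"
      using fx fy z S by (auto simp: ab C1_on_def continuous_on_eq_continuous_at)
    then have c: "isCont (\<lambda>w. L (partial_y (partial_x f) w)) (a, b)" "isCont (\<lambda>w. L (partial_x (partial_y f) w)) (a, b)"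
      using Lc isCont_o2 by blast+
    show ?thesis unfolding ab
    proof (rule schwarz_real[where \<phi> = "\<lambda>w. L (f w)" and \<phi>x = "\<lambda>w. L (partial_x f w)" and \<phi>y = "\<lambda>w. L (partial_y f w)"
        and \<phi>xy = "\<lambda>w. L (partial_y (partial_x f) w)" and \<phi>yx = "\<lambda>w. L (partial_x (partial_y f) w)", OF S _ _ _ _ _ c])
    qed (use z f fx fy in \<open>auto simp: ab C1_on_def intro!: axis L\<close>)
  qed
  show ?thesis
    using main[OF bounded_linear_Re] main[OF bounded_linear_Im] by (rule complex_eqI)
qed

lemma C_k_on_cong:
  assumes "open S" "\<And>x. x \<in> S \<Longrightarrow> f x = g x"
  shows "C_k_on k f S \<longleftrightarrow> C_k_on k g S"
  using assms(2)
proof (induction k arbitrary: f g)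
  case 0
  then show ?case by (auto cong: continuous_on_cong)
next
  case (Suc k)
  have h: "(f has_derivative D) (at x) \<longleftrightarrow> (g has_derivative D) (at x)" if "x \<in> S" for D x
    using has_derivative_transform_within_open[of f D x UNIV S g] has_derivative_transform_within_open[of g D x UNIV S f]
      assms(1) Suc.prems that by auto
  have "C_k_on k (\<lambda>x. frechet_derivative f (at x) v) S \<longleftrightarrow> C_k_on k (\<lambda>x. frechet_derivative g (at x) v) S" for v
    by (rule Suc.IH) (simp add: frechet_derivative_def h)
  then show ?case using h by (auto simp: differentiable_def)
qed

lemma C_k_on_subset: "C_k_on k f S \<Longrightarrow> T \<subseteq> S \<Longrightarrow> C_k_on k f T"
proof (induction k arbitrary: f)
  case 0
  then show ?case using continuous_on_subset by auto
next
  case (Suc k)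
  then show ?case unfolding C_k_on.simps by blast
qed

lemma C_k_on_SucD: "C_k_on (Suc k) f S \<Longrightarrow> C_k_on k f S"
proof (induction k arbitrary: f)
  case 0
  then show ?case
    by (auto intro!: continuous_at_imp_continuous_on differentiable_imp_continuous_within)
next
  case (Suc k)
  then show ?case by (metis C_k_on.simps(2))
qed

lemma C_k_on_le:
  assumes "C_k_on k f S" "j \<le> k" shows "C_k_on j f S"
  using assms(2)
proof (induction rule: inc_induct)
  case base
  show ?case by (rule assms(1))
next
  case (step n)
  show ?case by (rule C_k_on_SucD[OF step.IH])
qed

lemma C_k_on_linear:
  assumes L: "bounded_linear L" and S: "open S"
  shows "C_k_on k f S \<Longrightarrow> C_k_on k (\<lambda>x. L (f x)) S"
proof (induction k arbitrary: f)
  case 0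
  then show ?case using bounded_linear.continuous_on[OF L] by simp
next
  case (Suc k)
  have h: "((\<lambda>x. L (f x)) has_derivative (\<lambda>v. L (frechet_derivative f (at x) v))) (at x)" if "x \<in> S" for x
    using bounded_linear.has_derivative[OF L] Suc.prems that frechet_derivative_works by fastforce
  have "C_k_on k (\<lambda>x. frechet_derivative (\<lambda>x. L (f x)) (at x) v) S" for v
  proof -
    have "C_k_on k (\<lambda>x. L (frechet_derivative f (at x) v)) S"
      by (rule Suc.IH) (use Suc.prems in simp)
    moreover have "frechet_derivative (\<lambda>x. L (f x)) (at x) v = L (frechet_derivative f (at x) v)" if "x \<in> S" for x
      using frechet_derivative_at[OF h[OF that]] by metis
    ultimately show ?thesis by (subst C_k_on_cong[OF S])
  qed
  then show ?case using h by (auto simp: differentiable_def)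
qed

lemma C_k_on_add:
  assumes S: "open S"
  shows "C_k_on k f S \<Longrightarrow> C_k_on k g S \<Longrightarrow> C_k_on k (\<lambda>x. f x + g x) S"
proof (induction k arbitrary: f g)
  case 0
  then show ?case by (simp add: continuous_on_add)
next
  case (Suc k)
  have h: "((\<lambda>x. f x + g x) has_derivative (\<lambda>v. frechet_derivative f (at x) v + frechet_derivative g (at x) v)) (at x)" if "x \<in> S" for x
    using Suc.prems that frechet_derivative_works by (intro has_derivative_add) auto
  have "C_k_on k (\<lambda>x. frechet_derivative (\<lambda>x. f x + g x) (at x) v) S" for v
  proof -
    have "C_k_on k (\<lambda>x. frechet_derivative f (at x) v + frechet_derivative g (at x) v) S"
      by (rule Suc.IH) (use Suc.prems in simp_all)
    moreover have "frechet_derivative (\<lambda>x. f x + g x) (at x) v = frechet_derivative f (at x) v + frechet_derivative g (at x) v" if "x \<in> S" for x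
      using frechet_derivative_at[OF h[OF that]] by metis
    ultimately show ?thesis by (subst C_k_on_cong[OF S])
  qed
  then show ?case using h by (auto simp: differentiable_def)
qed

lemma C_k_on_zero: "C_k_on k (\<lambda>x. 0) S"
proof (induction k)
  case 0
  show ?case by simp
next
  case (Suc k)
  show ?case unfolding C_k_on.simps frechet_derivative_const
    using Suc by (intro conjI ballI allI differentiable_const)
qed

lemma C_k_on_sum:
  assumes "open S" "finite I" "\<And>i. i \<in> I \<Longrightarrow> C_k_on k (f i) S"
  shows "C_k_on k (\<lambda>x. \<Sum>i\<in>I. f i x) S"
  using assms(2,3)
proof (induction I rule: finite_induct)
  case empty
  show ?case by (simp only: sum.empty C_k_on_zero)
next
  case (insert i I)
  have "C_k_on k (\<lambda>x. f i x + (\<Sum>i\<in>I. f i x)) S"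
    by (rule C_k_on_add[OF assms(1)]) (use insert in blast)+
  moreover have "(\<lambda>x. \<Sum>i\<in>insert i I. f i x) = (\<lambda>x. f i x + (\<Sum>i\<in>I. f i x))"
    using insert.hyps by simp
  ultimately show ?case by simp
qed

lemma C_k_on_partials:
  assumes "C_k_on (Suc k) f S"
  shows "C_k_on k (partial_x f) S" "C_k_on k (partial_y f) S" "\<And>z. z \<in> S \<Longrightarrow> f differentiable (at z)"
proof -
  show "C_k_on k (partial_x f) S" "C_k_on k (partial_y f) S"
    using assms unfolding partial_x_def[abs_def] partial_y_def[abs_def] C_k_on.simps by blast+
  show "\<And>z. z \<in> S \<Longrightarrow> f differentiable (at z)" using assms unfolding C_k_on.simps by blast
qed

lemma C_k_on_imp_C1_on:
  assumes "C_k_on (Suc k) f S" shows "C1_on f S"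
proof -
  have "C_k_on (Suc 0) f S" by (rule C_k_on_le[OF assms]) simp
  note p = C_k_on_partials[OF this]
  show ?thesis unfolding C1_on_def using p(1,2) p(3) by (simp only: C_k_on.simps) simp
qed

lemma C_k_on_SucI:
  fixes f :: "real \<times> real \<Rightarrow> 'b::real_normed_vector"
  assumes S: "open S" and d: "\<And>z. z \<in> S \<Longrightarrow> f differentiable (at z)"
    and x: "C_k_on k (partial_x f) S" and y: "C_k_on k (partial_y f) S"
  shows "C_k_on (Suc k) f S"
proof -
  have "C_k_on k (\<lambda>z. frechet_derivative f (at z) v) S" for v
  proof -
    have "C_k_on k (\<lambda>z. fst v *\<^sub>R partial_x f z + snd v *\<^sub>R partial_y f z) S"
      by (intro C_k_on_add[OF S] C_k_on_linear[OF bounded_linear_scaleR_right S] x y)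
    then show ?thesis
      by (subst C_k_on_cong[OF S frechet_derivative_partials[OF d]])
  qed
  then show ?thesis using d by simp
qed

section \<open>Control of higher derivatives\<close>

text \<open>
  The iterated partial derivatives of order at most \<open>k\<close> of the functions in \<open>S\<close>, as a set of functions.
\<close>

primrec derivs :: "nat \<Rightarrow> (real \<times> real \<Rightarrow> complex) set \<Rightarrow> (real \<times> real \<Rightarrow> complex) set" where
  "derivs 0 S = S"
| "derivs (Suc k) S = derivs k S \<union> partial_x ` derivs k S \<union> partial_y ` derivs k S"

lemma finite_derivs: "finite S \<Longrightarrow> finite (derivs k S)"
  by (induction k) simp_all

lemma derivs_mono: "j \<le> k \<Longrightarrow> derivs j S \<subseteq> derivs k S"
  by (rule lift_Suc_mono_le[of "\<lambda>k. derivs k S"]) auto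

lemma derivs_partial:
  "derivs k (partial_x ` S) \<subseteq> derivs (Suc k) S" "derivs k (partial_y ` S) \<subseteq> derivs (Suc k) S"
  by (induction k) auto

lemma derivs_C_k_on:
  assumes "\<And>f. f \<in> S \<Longrightarrow> C_k_on r f \<Omega>"
  shows "f \<in> derivs j S \<Longrightarrow> j \<le> r \<Longrightarrow> C_k_on (r - j) f \<Omega>"
proof (induction j arbitrary: f)
  case 0
  then show ?case using assms by simp
next
  case (Suc j)
  have *: "C_k_on (Suc (r - Suc j)) g \<Omega>" if "g \<in> derivs j S" for g
    using Suc.IH[OF that] Suc.prems(2) by (simp add: Suc_diff_Suc)
  from Suc.prems(1) consider "f \<in> derivs j S" | g where "g \<in> derivs j S" "f = partial_x g" | g where "g \<in> derivs j S" "f = partial_y g"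
    by auto
  then show ?case using * C_k_on_SucD C_k_on_partials by cases blast+
qed

text \<open>
  Bounded and Lipschitz on \<open>\<Omega>\<close> with respect to \<open>d\<close>. In the application \<open>d\<close> is the pseudometric
  \<open>dist z z' + (\<Sum>g. norm (g z - g z'))\<close>, summed over the derivatives of the solution up to a given order.
\<close>

definition ctrl0 :: "(real \<times> real \<Rightarrow> real \<times> real \<Rightarrow> real) \<Rightarrow> (real \<times> real) set \<Rightarrow> (real \<times> real \<Rightarrow> complex) \<Rightarrow> bool" where
  "ctrl0 d \<Omega> g \<longleftrightarrow> (\<exists>B\<ge>0. \<forall>z\<in>\<Omega>. \<forall>z'\<in>\<Omega>. norm (g z) \<le> B \<and> norm (g z - g z') \<le> B * d z z')"

text \<open>
  All partial derivatives up to order \<open>k\<close> are bounded and \<open>d\<close>-Lipschitz on \<open>\<Omega>\<close>.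
\<close>

primrec ctrl :: "nat \<Rightarrow> (real \<times> real \<Rightarrow> real \<times> real \<Rightarrow> real) \<Rightarrow> (real \<times> real) set \<Rightarrow> (real \<times> real \<Rightarrow> complex) \<Rightarrow> bool" where
  "ctrl 0 d \<Omega> g \<longleftrightarrow> ctrl0 d \<Omega> g"
| "ctrl (Suc k) d \<Omega> g \<longleftrightarrow> ctrl0 d \<Omega> g \<and> (\<forall>z\<in>\<Omega>. g differentiable (at z)) \<and>
     ctrl k d \<Omega> (partial_x g) \<and> ctrl k d \<Omega> (partial_y g)"

lemma ctrl0_cong: "(\<And>z. z \<in> \<Omega> \<Longrightarrow> f z = g z) \<Longrightarrow> ctrl0 d \<Omega> f \<longleftrightarrow> ctrl0 d \<Omega> g"
  unfolding ctrl0_def by simp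

lemma ctrl_cong:
  assumes "open \<Omega>" shows "(\<And>z. z \<in> \<Omega> \<Longrightarrow> f z = g z) \<Longrightarrow> ctrl k d \<Omega> f \<longleftrightarrow> ctrl k d \<Omega> g"
proof (induction k arbitrary: f g)
  case 0
  show ?case unfolding ctrl.simps by (rule ctrl0_cong) (rule 0)
next
  case (Suc k)
  have p: "f differentiable (at z) \<longleftrightarrow> g differentiable (at z)"
    "partial_x f z = partial_x g z" "partial_y f z = partial_y g z" if "z \<in> \<Omega>" for z
    using partial_cong_open[OF assms that, of f g] Suc.prems by auto
  then show ?case
    using ctrl0_cong[of \<Omega> f g] Suc.prems Suc.IH[of "partial_x f" "partial_x g"] Suc.IH[of "partial_y f" "partial_y g"]
    by simp
qed

lemma ctrl_imp_ctrl0: "ctrl k d \<Omega> g \<Longrightarrow> ctrl0 d \<Omega> g"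
  by (cases k) auto

lemma ctrl_SucD: "ctrl (Suc k) d \<Omega> g \<Longrightarrow> ctrl k d \<Omega> g"
proof (induction k arbitrary: g)
  case (Suc k)
  then show ?case by (metis ctrl.simps(2))
qed simp

lemma ctrl0_const: "(\<And>z z'. 0 \<le> d z z') \<Longrightarrow> ctrl0 d \<Omega> (\<lambda>_. c)"
  unfolding ctrl0_def by (intro exI[of _ "norm c"]) simp

lemma ctrl_const:
  assumes "\<And>z z'. 0 \<le> d z z'"
  shows "ctrl k d \<Omega> (\<lambda>_. c)"
proof (induction k arbitrary: c)
  case 0
  show ?case unfolding ctrl.simps by (rule ctrl0_const[OF assms])
next
  case (Suc k)
  have "partial_x (\<lambda>_. c) = (\<lambda>_. 0)" "partial_y (\<lambda>_. c) = (\<lambda>_. 0)"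
    by (simp_all add: partial_x_def fun_eq_iff partial_y_def)
  then show ?case unfolding ctrl.simps using Suc ctrl0_const[OF assms] by simp
qed

lemma ctrl0_add:
  assumes d: "\<And>z z'. 0 \<le> d z z'" and "ctrl0 d \<Omega> f" "ctrl0 d \<Omega> g"
  shows "ctrl0 d \<Omega> (\<lambda>z. f z + g z)"
proof -
  obtain B C where B: "0 \<le> B" "\<And>z z'. z \<in> \<Omega> \<Longrightarrow> z' \<in> \<Omega> \<Longrightarrow> norm (f z) \<le> B \<and> norm (f z - f z') \<le> B * d z z'"
    and C: "0 \<le> C" "\<And>z z'. z \<in> \<Omega> \<Longrightarrow> z' \<in> \<Omega> \<Longrightarrow> norm (g z) \<le> C \<and> norm (g z - g z') \<le> C * d z z'"
    using assms(2,3) unfolding ctrl0_def by blast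
  have "norm (f z + g z) \<le> B + C \<and> norm ((f z + g z) - (f z' + g z')) \<le> (B + C) * d z z'"
    if "z \<in> \<Omega>" "z' \<in> \<Omega>" for z z'
    using B(2)[OF that] C(2)[OF that] norm_triangle_ineq[of "f z" "g z"] norm_triangle_ineq[of "f z - f z'" "g z - g z'"]
    by (auto simp: algebra_simps)
  then show ?thesis unfolding ctrl0_def using B(1) C(1) by (intro exI[of _ "B + C"]) auto
qed

lemma ctrl_add:
  assumes d: "\<And>z z'. 0 \<le> d z z'" and \<Omega>: "open \<Omega>"
  shows "ctrl k d \<Omega> f \<Longrightarrow> ctrl k d \<Omega> g \<Longrightarrow> ctrl k d \<Omega> (\<lambda>z. f z + g z)"
proof (induction k arbitrary: f g)
  case 0
  then show ?case using ctrl0_add[OF d] by simp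
next
  case (Suc k)
  then have df: "f differentiable (at z)" and dg: "g differentiable (at z)" if "z \<in> \<Omega>" for z using that by auto
  note p = partials_add[OF df dg]
  have "ctrl k d \<Omega> (partial_x (\<lambda>z. f z + g z))"
    using ctrl_cong[OF \<Omega> p(2)] Suc.IH[of "partial_x f" "partial_x g"] Suc.prems by simp
  moreover have "ctrl k d \<Omega> (partial_y (\<lambda>z. f z + g z))"
    using ctrl_cong[OF \<Omega> p(3)] Suc.IH[of "partial_y f" "partial_y g"] Suc.prems by simp
  ultimately show ?case using Suc.prems p(1) ctrl0_add[OF d] by simp
qed

lemma ctrl_sum:
  assumes d: "\<And>z z'. 0 \<le> d z z'" and \<Omega>: "open \<Omega>" and I: "finite I" "\<And>i. i \<in> I \<Longrightarrow> ctrl k d \<Omega> (f i)"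
  shows "ctrl k d \<Omega> (\<lambda>z. \<Sum>i\<in>I. f i z)"
  using I
proof (induction I rule: finite_induct)
  case empty
  show ?case using ctrl_const[OF d] by simp
next
  case (insert i I)
  have "ctrl k d \<Omega> (\<lambda>z. f i z + (\<Sum>i\<in>I. f i z))"
    by (rule ctrl_add[OF d \<Omega>]) (use insert in blast)+
  moreover have "(\<lambda>z. \<Sum>i\<in>insert i I. f i z) = (\<lambda>z. f i z + (\<Sum>i\<in>I. f i z))"
    using insert.hyps by simp
  ultimately show ?case by simp
qed

lemma ctrl0_mult:
  assumes d: "\<And>z z'. 0 \<le> d z z'" and "ctrl0 d \<Omega> f" "ctrl0 d \<Omega> g"
  shows "ctrl0 d \<Omega> (\<lambda>z. f z * g z)"
proof -
  obtain B C where B: "0 \<le> B" "\<And>z z'. z \<in> \<Omega> \<Longrightarrow> z' \<in> \<Omega> \<Longrightarrow> norm (f z) \<le> B \<and> norm (f z - f z') \<le> B * d z z'"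
    and C: "0 \<le> C" "\<And>z z'. z \<in> \<Omega> \<Longrightarrow> z' \<in> \<Omega> \<Longrightarrow> norm (g z) \<le> C \<and> norm (g z - g z') \<le> C * d z z'"
    using assms(2,3) unfolding ctrl0_def by blast
  have "norm (f z * g z) \<le> 2 * B * C \<and> norm (f z * g z - f z' * g z') \<le> 2 * B * C * d z z'"
    if z: "z \<in> \<Omega>" "z' \<in> \<Omega>" for z z'
  proof
    have "norm (f z * g z) \<le> B * C" unfolding norm_mult using B C z by (intro mult_mono) auto
    also have "\<dots> \<le> 2 * B * C" using B C by simp
    finally show "norm (f z * g z) \<le> 2 * B * C" .
    have "f z * g z - f z' * g z' = f z * (g z - g z') + (f z - f z') * g z'" by (simp add: algebra_simps)
    then have "norm (f z * g z - f z' * g z') \<le> norm (f z) * norm (g z - g z') + norm (f z - f z') * norm (g z')"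
      using norm_triangle_ineq[of "f z * (g z - g z')" "(f z - f z') * g z'"] by (simp add: norm_mult)
    also have "\<dots> \<le> B * (C * d z z') + (B * d z z') * C"
      using B(1) C(1) B(2)[OF z] C(2)[OF z] C(2)[OF z(2) z(2)] d by (intro add_mono mult_mono) auto
    also have "\<dots> = 2 * B * C * d z z'" by simp
    finally show "norm (f z * g z - f z' * g z') \<le> 2 * B * C * d z z'" .
  qed
  then show ?thesis unfolding ctrl0_def using B(1) C(1) by (intro exI[of _ "2 * B * C"]) auto
qed

lemma ctrl_mult:
  assumes d: "\<And>z z'. 0 \<le> d z z'" and \<Omega>: "open \<Omega>"
  shows "ctrl k d \<Omega> f \<Longrightarrow> ctrl k d \<Omega> g \<Longrightarrow> ctrl k d \<Omega> (\<lambda>z. f z * g z)"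
proof (induction k arbitrary: f g)
  case 0
  then show ?case using ctrl0_mult[OF d] by simp
next
  case (Suc k)
  then have df: "f differentiable (at z)" and dg: "g differentiable (at z)" if "z \<in> \<Omega>" for z using that by auto
  note p = partials_mult[OF df dg]
  note fk = ctrl_SucD[OF Suc.prems(1)] and gk = ctrl_SucD[OF Suc.prems(2)]
  have fx: "ctrl k d \<Omega> (partial_x f)" "ctrl k d \<Omega> (partial_y f)" "ctrl k d \<Omega> (partial_x g)" "ctrl k d \<Omega> (partial_y g)"
    using Suc.prems by auto
  have "ctrl k d \<Omega> (partial_x (\<lambda>z. f z * g z))"
    using ctrl_cong[OF \<Omega> p(2)] ctrl_add[OF d \<Omega> Suc.IH[OF fk fx(3)] Suc.IH[OF fx(1) gk]] by simp
  moreover have "ctrl k d \<Omega> (partial_y (\<lambda>z. f z * g z))"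
    using ctrl_cong[OF \<Omega> p(3)] ctrl_add[OF d \<Omega> Suc.IH[OF fk fx(4)] Suc.IH[OF fx(2) gk]] by simp
  ultimately show ?case using Suc.prems p(1) ctrl0_mult[OF d] by simp
qed

lemma ctrl_cnj:
  assumes \<Omega>: "open \<Omega>"
  shows "ctrl k d \<Omega> f \<Longrightarrow> ctrl k d \<Omega> (\<lambda>z. cnj (f z))"
proof (induction k arbitrary: f)
  case 0
  then show ?case by (simp add: ctrl0_def flip: complex_cnj_diff)
next
  case (Suc k)
  then have df: "f differentiable (at z)" if "z \<in> \<Omega>" for z using that by auto
  note p = partials_linear[OF bounded_linear_cnj df]
  have c0: "ctrl0 d \<Omega> (\<lambda>z. cnj (f z))" using Suc.prems by (simp add: ctrl0_def flip: complex_cnj_diff)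
  show ?case
    using ctrl_cong[OF \<Omega> p(2)] ctrl_cong[OF \<Omega> p(3)] Suc.IH[of "partial_x f"] Suc.IH[of "partial_y f"] Suc.prems c0 p(1) by simp
qed

lemma C_k_on_imp_ctrl:
  assumes d: "\<And>z z'. dist z z' \<le> d z z'" and \<rho>: "\<rho> < R"
  shows "C_k_on (Suc k) h (ball 0 R) \<Longrightarrow> ctrl k d (ball 0 \<rho> - {0}) h"
proof (induction k arbitrary: h)
  case 0
  then have h: "C1_on h (ball 0 R)" using C_k_on_imp_C1_on by blast
  have sub: "cball 0 \<rho> \<subseteq> ball (0::real \<times> real) R" using \<rho> by auto
  have bdd: "\<exists>B. \<forall>z\<in>cball 0 \<rho>. norm (g z) \<le> B" if "continuous_on (ball 0 R) g" for g :: "real \<times> real \<Rightarrow> complex"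
  proof -
    have "compact (g ` cball 0 \<rho>)"
      using continuous_on_subset[OF that sub] compact_continuous_image compact_cball by blast
    then show ?thesis using compact_imp_bounded bounded_iff by (metis imageI)
  qed
  obtain B where B: "\<And>z. z \<in> cball 0 \<rho> \<Longrightarrow> norm (h z) \<le> B" using bdd[OF C1_on_continuous[OF h]] by blast
  obtain Bx where Bx: "\<And>z. z \<in> cball 0 \<rho> \<Longrightarrow> norm (partial_x h z) \<le> Bx" using bdd h unfolding C1_on_def by blast
  obtain By where By: "\<And>z. z \<in> cball 0 \<rho> \<Longrightarrow> norm (partial_y h z) \<le> By" using bdd h unfolding C1_on_def by blast
  define C where "C = \<bar>B\<bar> + \<bar>Bx\<bar> + \<bar>By\<bar>"
  have lip: "norm (h z - h z') \<le> C * norm (z - z')" if "z \<in> ball 0 \<rho>" "z' \<in> ball 0 \<rho>" for z z'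
  proof (rule differentiable_bound[OF convex_ball _ _ that])
    fix x assume x: "x \<in> ball (0::real \<times> real) \<rho>"
    then have "x \<in> ball 0 R" using \<rho> by simp
    then have "h differentiable (at x)" using h by (auto simp: C1_on_def)
    from has_derivative_partials[OF this]
    show "(h has_derivative (\<lambda>v. fst v *\<^sub>R partial_x h x + snd v *\<^sub>R partial_y h x)) (at x within ball 0 \<rho>)"
      by (rule has_derivative_at_withinI)
    show "onorm (\<lambda>v. fst v *\<^sub>R partial_x h x + snd v *\<^sub>R partial_y h x) \<le> C"
    proof (rule onorm_le)
      fix v :: "real \<times> real"
      have "norm (fst v *\<^sub>R partial_x h x + snd v *\<^sub>R partial_y h x) \<le> \<bar>fst v\<bar> * norm (partial_x h x) + \<bar>snd v\<bar> * norm (partial_y h x)"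
        by (metis norm_scaleR norm_triangle_ineq)
      also have "\<dots> \<le> norm v * \<bar>Bx\<bar> + norm v * \<bar>By\<bar>"
        using Bx[of x] By[of x] x norm_fst_le[of "fst v" "snd v"] norm_snd_le[of "snd v" "fst v"]
        by (intro add_mono mult_mono) auto
      also have "\<dots> \<le> C * norm v" by (simp add: C_def algebra_simps)
      finally show "norm (fst v *\<^sub>R partial_x h x + snd v *\<^sub>R partial_y h x) \<le> C * norm v" .
    qed
  qed
  have C0: "0 \<le> C" by (simp add: C_def)
  have "norm (h z) \<le> C \<and> norm (h z - h z') \<le> C * d z z'" if "z \<in> ball 0 \<rho> - {0}" "z' \<in> ball 0 \<rho> - {0}" for z z'
  proof
    show "norm (h z) \<le> C" using B[of z] that by (simp add: C_def)
    have "C * norm (z - z') \<le> C * d z z'" using d[of z z'] C0 by (intro mult_left_mono) (auto simp: dist_norm)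
    then show "norm (h z - h z') \<le> C * d z z'" using lip[of z z'] that by auto
  qed
  then show ?case unfolding ctrl.simps ctrl0_def using C0 by blast
next
  case (Suc k)
  have "ctrl k d (ball 0 \<rho> - {0}) (partial_x h)" "ctrl k d (ball 0 \<rho> - {0}) (partial_y h)"
    using Suc.IH C_k_on_partials[OF Suc.prems] by auto
  moreover have "ctrl k d (ball 0 \<rho> - {0}) h" using Suc.IH C_k_on_SucD[OF Suc.prems] by blast
  moreover have "h differentiable (at z)" if "z \<in> ball 0 \<rho> - {0}" for z
    using C_k_on_partials(3)[OF Suc.prems] that \<rho> by auto
  ultimately show ?case using ctrl_imp_ctrl0 by simp
qed

section \<open>Limits of the derivatives at the origin\<close>

lemma dbar_partial:
  assumes \<Omega>: "open \<Omega>" and f: "C_k_on (Suc (Suc 0)) f \<Omega>" and z: "z \<in> \<Omega>"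
  shows "dbar (partial_x f) z = partial_x (dbar f) z" "dbar (partial_y f) z = partial_y (dbar f) z"
proof -
  note p = C_k_on_partials[OF f]
  have x: "C1_on (partial_x f) \<Omega>" and y: "C1_on (partial_y f) \<Omega>" using p(1,2) C_k_on_imp_C1_on by blast+
  have dx: "partial_x f differentiable (at z)" and dy: "partial_y f differentiable (at z)"
    using x y z by (auto simp: C1_on_def)
  note i = partials_linear[OF bounded_linear_mult_right[of \<i>] dy]
  note s = partials_add[OF dx i(1)]
  have "partial_y (partial_x f) z = partial_x (partial_y f) z"
    by (rule schwarz[OF \<Omega> z p(3) x y])
  then show "dbar (partial_x f) z = partial_x (dbar f) z" "dbar (partial_y f) z = partial_y (dbar f) z"
    unfolding dbar_def[abs_def] s(2,3) i(2,3) by simp_all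
qed

lemma dbar_derivs_ctrl:
  assumes \<Omega>: "open \<Omega>" and S: "\<And>u. u \<in> S \<Longrightarrow> C_k_on r u \<Omega>" and k: "k < r"
    and D: "\<And>u. u \<in> S \<Longrightarrow> ctrl k d \<Omega> (dbar u)"
  shows "f \<in> derivs j S \<Longrightarrow> j \<le> k \<Longrightarrow> ctrl (k - j) d \<Omega> (dbar f)"
proof (induction j arbitrary: f)
  case 0
  then show ?case using D by simp
next
  case (Suc j)
  have IH: "ctrl (Suc (k - Suc j)) d \<Omega> (dbar g)" if "g \<in> derivs j S" for g
    using Suc.IH[OF that] Suc.prems(2) by (simp add: Suc_diff_Suc del: ctrl.simps)
  have C2: "C_k_on (Suc (Suc 0)) g \<Omega>" if "g \<in> derivs j S" for g
  proof (rule C_k_on_le)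
    show "C_k_on (r - j) g \<Omega>" by (rule derivs_C_k_on[OF S that]) (use Suc.prems(2) k in auto)
    show "Suc (Suc 0) \<le> r - j" using Suc.prems(2) k by linarith
  qed
  from Suc.prems(1) consider "f \<in> derivs j S" | g where "g \<in> derivs j S" "f = partial_x g" | g where "g \<in> derivs j S" "f = partial_y g"
    by auto
  then show ?case
  proof cases
    case 1
    then show ?thesis using ctrl_SucD[OF IH] by blast
  next
    case 2
    have "ctrl (k - Suc j) d \<Omega> (partial_x (dbar g))" using IH[OF 2(1)] by simp
    then show ?thesis
      unfolding 2(2) by (subst ctrl_cong[OF \<Omega> dbar_partial(1)[OF \<Omega> C2[OF 2(1)]]])
  next
    case 3
    have "ctrl (k - Suc j) d \<Omega> (partial_y (dbar g))" using IH[OF 3(1)] by simp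
    then show ?thesis
      unfolding 3(2) by (subst ctrl_cong[OF \<Omega> dbar_partial(2)[OF \<Omega> C2[OF 3(1)]]])
  qed
qed

lemma derivs_ctrl:
  assumes S: "\<And>u. u \<in> S \<Longrightarrow> C_k_on r u \<Omega>" and k: "k \<le> r" and M0: "0 \<le> M"
    and M: "\<And>f z. f \<in> derivs k S \<Longrightarrow> z \<in> \<Omega> \<Longrightarrow> norm (f z) \<le> M"
    and d: "\<And>f z z'. f \<in> derivs k S \<Longrightarrow> norm (f z - f z') \<le> d z z'" "\<And>z z'. 0 \<le> d z z'"
  shows "f \<in> derivs j S \<Longrightarrow> j + m = k \<Longrightarrow> ctrl m d \<Omega> f"
proof (induction m arbitrary: j f)
  have c0: "ctrl0 d \<Omega> f" if "f \<in> derivs k S" for f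
    unfolding ctrl0_def
  proof (intro exI[of _ "M + 1"] conjI ballI)
    fix z z' assume "z \<in> \<Omega>"
    then show "norm (f z) \<le> M + 1" using M[OF that, of z] by simp
    have "1 * d z z' \<le> (M + 1) * d z z'" using M0 d(2) by (intro mult_right_mono) auto
    then show "norm (f z - f z') \<le> (M + 1) * d z z'" using d(1)[OF that, of z z'] by simp
  qed (use M0 in auto)
  have sub: "derivs j S \<subseteq> derivs k S" if "j \<le> k" for j using derivs_mono[OF that] .
  {
    case 0
    then show ?case using c0 by simp
  next
    case (Suc m)
    have "C_k_on (r - j) f \<Omega>" by (rule derivs_C_k_on[OF S Suc.prems(1)]) (use Suc.prems(2) k in auto)
    then have "C_k_on (Suc 0) f \<Omega>" by (rule C_k_on_le) (use Suc.prems(2) k in linarith)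
    then have df: "\<forall>z\<in>\<Omega>. f differentiable (at z)" using C_k_on_partials(3) by blast
    have "ctrl m d \<Omega> (partial_x f)" "ctrl m d \<Omega> (partial_y f)"
      using Suc.IH[of "partial_x f" "Suc j"] Suc.IH[of "partial_y f" "Suc j"] Suc.prems by auto
    moreover have "f \<in> derivs k S" using sub[of j] Suc.prems by auto
    ultimately show ?case using df c0 by simp
  }
qed

lemma limits_imp_bounded:
  fixes D :: "(real \<times> real \<Rightarrow> complex) set"
  assumes fin: "finite D" and lim: "\<And>f. f \<in> D \<Longrightarrow> \<exists>l. (f \<longlongrightarrow> l) (at 0)" and R: "0 < R"
  shows "\<exists>\<rho> M. 0 < \<rho> \<and> \<rho> \<le> R \<and> 0 \<le> M \<and> (\<forall>f\<in>D. \<forall>z\<in>ball 0 \<rho> - {0}. norm (f z) \<le> M)"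
proof -
  obtain l where l: "\<And>f. f \<in> D \<Longrightarrow> (f \<longlongrightarrow> l f) (at 0)" using lim by metis
  define M where "M = (\<Sum>f\<in>D. norm (l f) + 1)"
  have M0: "0 \<le> M" unfolding M_def by (intro sum_nonneg) (simp add: add_nonneg_nonneg)
  have "\<forall>\<^sub>F z in at 0. norm (f z) < norm (l f) + 1" if "f \<in> D" for f
    by (rule order_tendstoD(2)[OF tendsto_norm[OF l[OF that]]]) simp
  then have "\<forall>\<^sub>F z in at 0. \<forall>f\<in>D. norm (f z) < norm (l f) + 1"
    using fin by (simp add: eventually_ball_finite)
  then obtain \<rho> where \<rho>: "0 < \<rho>" "\<And>z. z \<noteq> 0 \<Longrightarrow> dist z 0 < \<rho> \<Longrightarrow> \<forall>f\<in>D. norm (f z) < norm (l f) + 1"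
    unfolding eventually_at by blast
  have "norm (f z) \<le> M" if f: "f \<in> D" and z: "z \<in> ball 0 (min \<rho> R) - {0}" for f z
  proof -
    have "norm (f z) < norm (l f) + 1" using \<rho>(2)[of z] f z by auto
    also have "\<dots> \<le> M" unfolding M_def
      using member_le_sum[OF f, of "\<lambda>f. norm (l f) + 1"] fin by (simp add: add_nonneg_nonneg)
    finally show ?thesis by simp
  qed
  then show ?thesis using \<rho>(1) R M0 by (intro exI[of _ "min \<rho> R"] exI[of _ M]) auto
qed

text \<open>
  If the derivatives of order at most \<open>k\<close> are bounded near the origin, then these and the derivatives of
  order \<open>k + 1\<close> have limits there. The hypothesis \<open>eq\<close> expresses that \<open>dbar u\<close> is a sufficiently smooth
  function of the point and of the members of \<open>S\<close>.
\<close>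

lemma regularity_step:
  fixes S :: "(real \<times> real \<Rightarrow> complex) set"
  assumes fin: "finite S" and R: "0 < R" and S: "\<And>u. u \<in> S \<Longrightarrow> C_k_on r u (ball 0 R - {0})" and k: "k < r"
    and bd: "0 < \<rho>0" "\<rho>0 \<le> R" "0 \<le> M" "\<And>f z. f \<in> derivs k S \<Longrightarrow> z \<in> ball 0 \<rho>0 - {0} \<Longrightarrow> norm (f z) \<le> M"
    and eq: "\<And>d \<rho> u. (\<And>z z'. dist z z' \<le> d z z') \<Longrightarrow> 0 < \<rho> \<Longrightarrow> \<rho> < R \<Longrightarrow>
      (\<And>u. u \<in> S \<Longrightarrow> ctrl k d (ball 0 \<rho> - {0}) u) \<Longrightarrow> u \<in> S \<Longrightarrow> ctrl k d (ball 0 \<rho> - {0}) (dbar u)"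
    and f: "f \<in> derivs k S"
  shows "(\<exists>l. (f \<longlongrightarrow> l) (at 0)) \<and> (\<exists>l. (partial_x f \<longlongrightarrow> l) (at 0)) \<and> (\<exists>l. (partial_y f \<longlongrightarrow> l) (at 0))"
proof -
  define D where "D = derivs k S"
  have D: "finite D" unfolding D_def using fin by (rule finite_derivs)
  define \<rho> where "\<rho> = min \<rho>0 (R/2)"
  have \<rho>: "0 < \<rho>" "\<rho> < R" "\<rho> \<le> \<rho>0" using bd R by (auto simp: \<rho>_def)
  define \<Omega> where "\<Omega> = ball (0::real \<times> real) \<rho> - {0}"
  have \<Omega>: "open \<Omega>" by (simp add: \<Omega>_def open_delete)
  have \<Omega>R: "\<Omega> \<subseteq> ball 0 R - {0}" using \<rho> by (auto simp: \<Omega>_def)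
  \<comment> \<open>the pseudometric for which \<open>dbar\<close> of every derivative is Lipschitz\<close>
  define d where "d z z' = dist z z' + (\<Sum>g\<in>D. norm (g z - g z'))" for z z' :: "real \<times> real"
  have s0: "0 \<le> (\<Sum>g\<in>D. norm (g z - g z'))" for z z' by (intro sum_nonneg) auto
  have d0: "0 \<le> d z z'" for z z' using s0[of z z'] by (simp add: d_def add_nonneg_nonneg)
  have dd: "dist z z' \<le> d z z'" for z z' using s0[of z z'] by (simp add: d_def)
  have dg: "norm (g z - g z') \<le> d z z'" if "g \<in> D" for g z z'
  proof -
    have "norm (g z - g z') \<le> (\<Sum>g\<in>D. norm (g z - g z'))"
      using member_le_sum[OF that, of "\<lambda>g. norm (g z - g z')"] D by simp
    then show ?thesis unfolding d_def using zero_le_dist[of z z'] by linarith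
  qed
  have S\<Omega>: "C_k_on r u \<Omega>" if "u \<in> S" for u using C_k_on_subset[OF S[OF that] \<Omega>R] .
  have M\<Omega>: "norm (g z) \<le> M" if "g \<in> D" "z \<in> \<Omega>" for g z
    using bd(4)[of g z] that \<rho> by (auto simp: D_def \<Omega>_def)
  have cu: "ctrl k d \<Omega> u" if "u \<in> S" for u
    by (rule derivs_ctrl[OF S\<Omega> _ bd(3), where j = 0 and k = k])
      (use k that M\<Omega> dg d0 in \<open>auto simp: D_def\<close>)
  have "ctrl k d \<Omega> (dbar u)" if "u \<in> S" for u
    unfolding \<Omega>_def using eq[OF dd \<rho>(1,2) cu[unfolded \<Omega>_def] that] .
  then have c0: "ctrl0 d \<Omega> (dbar g)" if "g \<in> D" for g
    using dbar_derivs_ctrl[where d = d and f = g and j = k, OF \<Omega> S\<Omega> k] that by (simp add: D_def)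
  then have "\<forall>g\<in>D. \<exists>B\<ge>0. \<forall>z\<in>\<Omega>. \<forall>z'\<in>\<Omega>. norm (dbar g z) \<le> B \<and> norm (dbar g z - dbar g z') \<le> B * d z z'"
    unfolding ctrl0_def by blast
  then obtain B where B: "\<And>g. g \<in> D \<Longrightarrow> 0 \<le> B g"
    "\<And>g z z'. g \<in> D \<Longrightarrow> z \<in> \<Omega> \<Longrightarrow> z' \<in> \<Omega> \<Longrightarrow> norm (dbar g z - dbar g z') \<le> B g * d z z'"
    by metis
  define L where "L = (\<Sum>g\<in>D. B g)"
  have L0: "0 \<le> L" unfolding L_def using B(1) by (rule sum_nonneg)
  have L: "norm (dbar g z - dbar g z') \<le> L * d z z'" if "g \<in> D" "z \<in> \<Omega>" "z' \<in> \<Omega>" for g z z'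
  proof -
    have "B g \<le> L" unfolding L_def using member_le_sum[OF that(1), of B] B(1) D by simp
    then have "B g * d z z' \<le> L * d z z'" using d0 by (intro mult_right_mono)
    then show ?thesis using B(2)[OF that] by linarith
  qed
  have C1: "C1_on g \<Omega>" if "g \<in> D" for g
  proof -
    have "C_k_on (r - k) g \<Omega>" by (rule derivs_C_k_on[OF S\<Omega>]) (use that k in \<open>auto simp: D_def\<close>)
    then have "C_k_on (Suc 0) g \<Omega>" by (rule C_k_on_le) (use k in linarith)
    then show ?thesis by (rule C_k_on_imp_C1_on)
  qed
  have "\<exists>\<rho>1 C. 0 < \<rho>1 \<and> \<rho>1 \<le> \<rho> \<and> 0 \<le> C \<and> (\<forall>g\<in>D. \<forall>w\<in>ball 0 \<rho>1 - {0}. \<forall>w'\<in>ball 0 \<rho>1 - {0}.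
      norm (g w - g w') \<le> C * dist w w')"
  proof (rule punctured_lipschitz[OF D \<rho>(1) bd(3) L0])
    show "C1_on g (ball 0 \<rho> - {0})" if "g \<in> D" for g using C1[OF that] by (simp add: \<Omega>_def)
    show "norm (g z) \<le> M" if "g \<in> D" "z \<in> ball 0 \<rho> - {0}" for g z
      using M\<Omega>[OF that(1), of z] that(2) by (simp add: \<Omega>_def)
    fix g and z z' :: "real \<times> real"
    assume g: "g \<in> D" and z: "z \<in> ball 0 \<rho> - {0}" and "z' \<in> ball 0 \<rho> - {0}"
    then show "norm (dbar g z - dbar g z') \<le> L * (dist z z' + (\<Sum>g\<in>D. norm (g z - g z')))"
      using L[OF g, of z z'] z by (simp add: \<Omega>_def d_def)
  qed
  then obtain \<rho>1 C where \<rho>1: "0 < \<rho>1" "\<rho>1 \<le> \<rho>" and C: "0 \<le> C"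
    "\<And>g w w'. g \<in> D \<Longrightarrow> w \<in> ball 0 \<rho>1 - {0} \<Longrightarrow> w' \<in> ball 0 \<rho>1 - {0} \<Longrightarrow> norm (g w - g w') \<le> C * dist w w'"
    by blast
  define C' where "C' = C + L * (1 + real (card D) * C)"
  have C': "C \<le> C'" "L * (1 + real (card D) * C) \<le> C'" "0 \<le> C'" using C(1) L0 by (auto simp: C'_def)
  have sub1: "ball 0 \<rho>1 - {0} \<subseteq> \<Omega>" using \<rho>1 by (auto simp: \<Omega>_def)
  have fD: "f \<in> D" using f by (simp add: D_def)
  have lip: "norm (f w - f w') \<le> C' * dist w w'" if "w \<in> ball 0 \<rho>1 - {0}" "w' \<in> ball 0 \<rho>1 - {0}" for w w'
    using C(2)[OF fD that] mult_right_mono[OF C'(1) zero_le_dist[of w w']] by linarith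
  have lipD: "norm (dbar f w - dbar f w') \<le> C' * dist w w'" if w: "w \<in> ball 0 \<rho>1 - {0}" "w' \<in> ball 0 \<rho>1 - {0}" for w w'
  proof -
    have "(\<Sum>g\<in>D. norm (g w - g w')) \<le> real (card D) * (C * dist w w')"
      by (rule sum_bounded_above) (use C(2) w in blast)
    then have "d w w' \<le> (1 + real (card D) * C) * dist w w'" by (simp add: d_def algebra_simps)
    then have "L * d w w' \<le> L * ((1 + real (card D) * C) * dist w w')" using L0 by (rule mult_left_mono)
    also have "\<dots> \<le> C' * dist w w'"
      using mult_right_mono[OF C'(2) zero_le_dist[of w w']] by (simp only: mult.assoc)
    finally have "L * d w w' \<le> C' * dist w w'" .
    moreover have "norm (dbar f w - dbar f w') \<le> L * d w w'" using L[OF fD] w sub1 by blast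
    ultimately show ?thesis by linarith
  qed
  obtain \<rho>2 where \<rho>2: "0 < \<rho>2" "\<And>w w'. w \<in> ball 0 \<rho>2 - {0} \<Longrightarrow> w' \<in> ball 0 \<rho>2 - {0} \<Longrightarrow>
      norm (partial_x f w - partial_x f w') \<le> 6 * C' * sqrt (dist w w') \<and>
      norm (partial_y f w - partial_y f w') \<le> 6 * C' * sqrt (dist w w')"
    using punctured_gradient_holder[OF \<rho>1(1) C'(3) C1_on_subset[OF C1[OF fD] sub1] lip lipD] by blast
  have "\<exists>l. (partial_x f \<longlongrightarrow> l) (at 0)"
    by (rule punctured_holder_limit[OF \<rho>2(1), of "6 * C'"]) (use C' \<rho>2 in auto)
  moreover have "\<exists>l. (partial_y f \<longlongrightarrow> l) (at 0)"
    by (rule punctured_holder_limit[OF \<rho>2(1), of "6 * C'"]) (use C' \<rho>2 in auto)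
  moreover have "\<exists>l. (f \<longlongrightarrow> l) (at 0)"
  proof (rule punctured_holder_limit[where R = "min \<rho>1 (1/2)" and K = C'])
    fix w w' :: "real \<times> real" assume w: "w \<in> ball 0 (min \<rho>1 (1/2)) - {0}" "w' \<in> ball 0 (min \<rho>1 (1/2)) - {0}"
    have "dist w w' \<le> 1" using w norm_triangle_ineq4[of w w'] by (auto simp: dist_norm)
    then have "dist w w' * dist w w' \<le> dist w w' * 1" by (intro mult_left_mono) auto
    then have "dist w w' \<le> sqrt (dist w w')" by (intro real_le_rsqrt) (simp add: power2_eq_square)
    then have "C' * dist w w' \<le> C' * sqrt (dist w w')" using C' by (intro mult_left_mono)
    moreover have "norm (f w - f w') \<le> C' * dist w w'" by (rule lip) (use w in auto)
    ultimately show "norm (f w - f w') \<le> C' * sqrt (dist w w')" by linarith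
  qed (use \<rho>1 C' in auto)
  ultimately show ?thesis by blast
qed

lemma derivs_limits:
  fixes S :: "(real \<times> real \<Rightarrow> complex) set"
  assumes fin: "finite S" and R: "0 < R" and S: "\<And>u. u \<in> S \<Longrightarrow> C_k_on r u (ball 0 R - {0})" and r: "1 \<le> r"
    and bd: "0 < \<rho>0" "\<rho>0 \<le> R" "\<And>f z. f \<in> S \<Longrightarrow> z \<in> ball 0 \<rho>0 - {0} \<Longrightarrow> norm (f z) \<le> M"
    and eq: "\<And>k d \<rho> u. k < r \<Longrightarrow> (\<And>z z'. dist z z' \<le> d z z') \<Longrightarrow> 0 < \<rho> \<Longrightarrow> \<rho> < R \<Longrightarrow>
      (\<And>u. u \<in> S \<Longrightarrow> ctrl k d (ball 0 \<rho> - {0}) u) \<Longrightarrow> u \<in> S \<Longrightarrow> ctrl k d (ball 0 \<rho> - {0}) (dbar u)"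
  shows "f \<in> derivs r S \<Longrightarrow> \<exists>l. (f \<longlongrightarrow> l) (at 0)"
proof -
  have step: "\<exists>l. (f \<longlongrightarrow> l) (at 0)"
    if b: "\<exists>\<rho> M. 0 < \<rho> \<and> \<rho> \<le> R \<and> 0 \<le> M \<and> (\<forall>f\<in>derivs k S. \<forall>z\<in>ball 0 \<rho> - {0}. norm (f z) \<le> M)"
      and k: "k < r" and f: "f \<in> derivs (Suc k) S" for k f
  proof -
    obtain \<rho> M where b: "0 < \<rho>" "\<rho> \<le> R" "0 \<le> M" "\<And>f z. f \<in> derivs k S \<Longrightarrow> z \<in> ball 0 \<rho> - {0} \<Longrightarrow> norm (f z) \<le> M"
      using b by blast
    have st: "(\<exists>l. (h \<longlongrightarrow> l) (at 0)) \<and> (\<exists>l. (partial_x h \<longlongrightarrow> l) (at 0)) \<and> (\<exists>l. (partial_y h \<longlongrightarrow> l) (at 0))"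
      if h: "h \<in> derivs k S" for h
    proof (rule regularity_step[OF fin R S k b(1-3) _ _ h])
      fix d \<rho> u
      assume a: "\<And>z z'. dist z z' \<le> d z z'" "0 < \<rho>" "\<rho> < R" "\<And>u. u \<in> S \<Longrightarrow> ctrl k d (ball 0 \<rho> - {0}) u" "u \<in> S"
      show "ctrl k d (ball 0 \<rho> - {0}) (dbar u)" by (rule eq[OF k a])
    qed (use b(4) in auto)
    from f consider "f \<in> derivs k S" | g where "g \<in> derivs k S" "f = partial_x g" | g where "g \<in> derivs k S" "f = partial_y g"
      by auto
    then show ?thesis using st by cases simp_all
  qed
  have bnd: "\<exists>\<rho> M. 0 < \<rho> \<and> \<rho> \<le> R \<and> 0 \<le> M \<and> (\<forall>f\<in>derivs k S. \<forall>z\<in>ball 0 \<rho> - {0}. norm (f z) \<le> M)" if "k \<le> r" for k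
    using that
  proof (induction k)
    case 0
    have "\<forall>f\<in>derivs 0 S. \<forall>z\<in>ball 0 \<rho>0 - {0}. norm (f z) \<le> \<bar>M\<bar>" using bd(3) by (fastforce intro: order_trans)
    then show ?case using bd(1,2) by (intro exI[of _ \<rho>0] exI[of _ "\<bar>M\<bar>"]) auto
  next
    case (Suc k)
    then show ?case
      using step[of k] by (intro limits_imp_bounded[OF finite_derivs[OF fin] _ R]) auto
  qed
  show "\<exists>l. (f \<longlongrightarrow> l) (at 0)" if "f \<in> derivs r S"
    using step[OF bnd[of "r - 1"]] r that by simp
qed

lemma has_derivative_puncture:
  fixes f :: "real \<times> real \<Rightarrow> complex"
  assumes R: "0 < R" and c: "isCont f 0" and d: "\<And>z. z \<in> ball 0 R - {0} \<Longrightarrow> f differentiable (at z)"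
    and lx: "(partial_x f \<longlongrightarrow> lx) (at 0)" and ly: "(partial_y f \<longlongrightarrow> ly) (at 0)"
  shows "(f has_derivative (\<lambda>v. fst v *\<^sub>R lx + snd v *\<^sub>R ly)) (at 0)"
  unfolding has_derivative_at_alt
proof (intro conjI allI impI)
  show "bounded_linear (\<lambda>v. fst v *\<^sub>R lx + snd v *\<^sub>R ly)"
    by (intro bounded_linear_add bounded_linear_scaleR_const bounded_linear_fst bounded_linear_snd)
  fix e :: real assume e: "0 < e"
  have "\<forall>\<^sub>F z in at 0. dist (partial_x f z) lx < e/2 \<and> dist (partial_y f z) ly < e/2"
    using tendstoD[OF lx, of "e/2"] tendstoD[OF ly, of "e/2"] e by (auto intro: eventually_conj)
  then obtain \<delta> where \<delta>: "0 < \<delta>" "\<And>z. z \<noteq> 0 \<Longrightarrow> dist z 0 < \<delta> \<Longrightarrow> dist (partial_x f z) lx < e/2 \<and> dist (partial_y f z) ly < e/2"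
    unfolding eventually_at by blast
  show "\<exists>d>0. \<forall>y. norm (y - 0) < d \<longrightarrow> norm (f y - f 0 - (fst (y - 0) *\<^sub>R lx + snd (y - 0) *\<^sub>R ly)) \<le> e * norm (y - 0)"
  proof (intro exI[of _ "min \<delta> R"] conjI allI impI)
    fix y :: "real \<times> real" assume y: "norm (y - 0) < min \<delta> R"
    show "norm (f y - f 0 - (fst (y - 0) *\<^sub>R lx + snd (y - 0) *\<^sub>R ly)) \<le> e * norm (y - 0)"
    proof (cases "y = 0")
      case False
      define q where "q = fst y *\<^sub>R lx + snd y *\<^sub>R ly"
      define g where "g t = f (t *\<^sub>R y) - t *\<^sub>R q" for t :: real
      let ?g' = "\<lambda>t h. h *\<^sub>R (fst y *\<^sub>R (partial_x f (t *\<^sub>R y) - lx) + snd y *\<^sub>R (partial_y f (t *\<^sub>R y) - ly))"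
      have df: "f differentiable (at (t *\<^sub>R y))" if "0 < t" "t \<le> 1" for t
      proof (rule d)
        have "t * norm y \<le> 1 * norm y" using that by (intro mult_right_mono) auto
        moreover have "norm y < R" using y by simp
        ultimately have "t * norm y < R" by linarith
        then show "t *\<^sub>R y \<in> ball 0 R - {0}" using that False by simp
      qed
      have "\<exists>t\<in>{0<..<1}. norm (g 1 - g 0) \<le> norm (?g' t (1 - 0))"
      proof (rule mvt_general)
        have "isCont (\<lambda>t. f (t *\<^sub>R y)) t" if "t \<in> {0..1}" for t
        proof (rule isCont_o2[of t "\<lambda>t. t *\<^sub>R y" f])
          show "isCont f (t *\<^sub>R y)"
            using c df[of t] that by (cases "t = 0") (auto simp: differentiable_imp_continuous_within)
        qed (intro continuous_intros)
        then have "continuous_on {0..1} (\<lambda>t. f (t *\<^sub>R y))" by (simp add: continuous_at_imp_continuous_on)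
        then show "continuous_on {0..1} g"
          unfolding g_def by (intro continuous_intros)
        fix t :: real assume t: "0 < t" "t < 1"
        have "((\<lambda>t. t *\<^sub>R y) has_derivative (\<lambda>h. h *\<^sub>R y)) (at t)" by (auto intro!: derivative_eq_intros)
        from has_derivative_compose[OF this has_derivative_partials[OF df]] t
        have "((\<lambda>t. f (t *\<^sub>R y)) has_derivative (\<lambda>h. fst (h *\<^sub>R y) *\<^sub>R partial_x f (t *\<^sub>R y) + snd (h *\<^sub>R y) *\<^sub>R partial_y f (t *\<^sub>R y))) (at t)" by simp
        moreover have "((\<lambda>t. t *\<^sub>R q) has_derivative (\<lambda>h. h *\<^sub>R q)) (at t)" by (auto intro!: derivative_eq_intros)
        ultimately have "(g has_derivative (\<lambda>h. (fst (h *\<^sub>R y) *\<^sub>R partial_x f (t *\<^sub>R y) + snd (h *\<^sub>R y) *\<^sub>R partial_y f (t *\<^sub>R y)) - h *\<^sub>R q)) (at t)"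
          unfolding g_def by (rule has_derivative_diff)
        then show "(g has_derivative ?g' t) (at t)"
          by (rule has_derivative_eq_rhs) (simp add: fun_eq_iff q_def algebra_simps)
      qed simp
      then obtain t where t: "0 < t" "t < 1" "norm (g 1 - g 0) \<le> norm (?g' t (1 - 0))" by auto
      have ty: "t *\<^sub>R y \<noteq> 0" "dist (t *\<^sub>R y) 0 < \<delta>"
      proof -
        have "t * norm y \<le> 1 * norm y" using t by (intro mult_right_mono) auto
        moreover have "norm y < \<delta>" using y by simp
        ultimately have "t * norm y < \<delta>" by linarith
        then show "dist (t *\<^sub>R y) 0 < \<delta>" using t by simp
        show "t *\<^sub>R y \<noteq> 0" using t False by simp
      qed
      have "norm (?g' t (1 - 0)) \<le> \<bar>fst y\<bar> * norm (partial_x f (t *\<^sub>R y) - lx) + \<bar>snd y\<bar> * norm (partial_y f (t *\<^sub>R y) - ly)"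
        using norm_triangle_ineq[of "fst y *\<^sub>R (partial_x f (t *\<^sub>R y) - lx)" "snd y *\<^sub>R (partial_y f (t *\<^sub>R y) - ly)"] by simp
      also have "\<dots> \<le> norm y * (e/2) + norm y * (e/2)"
        using \<delta>(2)[OF ty] norm_fst_le[of "fst y" "snd y"] norm_snd_le[of "snd y" "fst y"]
        by (intro add_mono mult_mono) (auto simp: dist_norm)
      finally have "norm (g 1 - g 0) \<le> e * norm y" using t(3) by simp
      moreover have "g 1 - g 0 = f y - f 0 - q" by (simp add: g_def)
      ultimately show ?thesis by (simp add: q_def)
    qed simp
  qed (use \<delta> R in simp)
qed

text \<open>
  A function of class \<open>C\<^sup>r\<close> off the origin all of whose derivatives of order at most \<open>r\<close> have limits
  there is of class \<open>C\<^sup>r\<close>, if its value at the origin is the limit.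
\<close>

lemma C_k_on_puncture:
  fixes f :: "real \<times> real \<Rightarrow> complex"
  assumes R: "0 < R"
  shows "C_k_on r f (ball 0 R - {0}) \<Longrightarrow> isCont f 0 \<Longrightarrow> (\<And>g. g \<in> derivs r {f} \<Longrightarrow> \<exists>l. (g \<longlongrightarrow> l) (at 0)) \<Longrightarrow>
    C_k_on r f (ball 0 R)"
proof (induction r arbitrary: f)
  case 0
  have "isCont f z" if "z \<in> ball 0 R" for z
    using 0 that by (cases "z = 0") (auto simp: continuous_on_eq_continuous_at open_delete)
  then show ?case by (simp add: continuous_at_imp_continuous_on)
next
  case (Suc r)
  have fin: "f \<in> derivs r {f}" using derivs_mono[of 0 r "{f}"] by auto
  have in1: "partial_x f \<in> derivs (Suc r) {f}" "partial_y f \<in> derivs (Suc r) {f}" using fin by auto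
  obtain lx where lx: "(partial_x f \<longlongrightarrow> lx) (at 0)" using Suc.prems(3)[OF in1(1)] by blast
  obtain ly where ly: "(partial_y f \<longlongrightarrow> ly) (at 0)" using Suc.prems(3)[OF in1(2)] by blast
  note p = C_k_on_partials[OF Suc.prems(1)]
  have h: "(f has_derivative (\<lambda>v. fst v *\<^sub>R lx + snd v *\<^sub>R ly)) (at 0)"
    by (rule has_derivative_puncture[OF R Suc.prems(2) p(3) lx ly])
  have p0: "partial_x f 0 = lx" "partial_y f 0 = ly" using has_derivative_partials_unique[OF h] by simp_all
  have df: "f differentiable (at z)" if "z \<in> ball 0 R" for z
    using p(3)[of z] that differentiableI[OF h] by (cases "z = 0") auto
  have cx: "isCont (partial_x f) 0" "isCont (partial_y f) 0" using lx ly p0 by (simp_all add: isCont_def)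
  have "C_k_on r (partial_x f) (ball 0 R)"
    by (rule Suc.IH[OF p(1) cx(1)]) (use Suc.prems(3) derivs_partial(1)[of r "{f}"] in auto)
  moreover have "C_k_on r (partial_y f) (ball 0 R)"
    by (rule Suc.IH[OF p(2) cx(2)]) (use Suc.prems(3) derivs_partial(2)[of r "{f}"] in auto)
  ultimately show ?case using C_k_on_SucI[OF open_ball df] by blast
qed

text \<open>
  Used to pass between the components of \<open>\<psi>\<close> and the functions \<open>u\<close>, with \<open>L\<close> the identity or the
  conjugation.
\<close>

lemma derivs_related:
  assumes \<Omega>: "open \<Omega>" and L: "bounded_linear L" and S': "\<And>u. u \<in> S' \<Longrightarrow> C_k_on r u \<Omega>"
    and rel: "\<And>g. g \<in> S \<Longrightarrow> \<exists>g'\<in>S'. \<forall>w\<in>\<Omega>. g w = L (g' w)"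
  shows "j \<le> r \<Longrightarrow> g \<in> derivs j S \<Longrightarrow> \<exists>g'\<in>derivs j S'. \<forall>w\<in>\<Omega>. g w = L (g' w)"
proof (induction j arbitrary: g)
  case 0
  then show ?case using rel by simp
next
  case (Suc j)
  have IH: "\<exists>h'\<in>derivs j S'. (\<forall>w\<in>\<Omega>. h w = L (h' w)) \<and> (\<forall>w\<in>\<Omega>. partial_x h w = L (partial_x h' w)) \<and>
      (\<forall>w\<in>\<Omega>. partial_y h w = L (partial_y h' w))" if h: "h \<in> derivs j S" for h
  proof -
    obtain h' where h': "h' \<in> derivs j S'" "\<And>w. w \<in> \<Omega> \<Longrightarrow> h w = L (h' w)"
      using Suc.IH[OF _ h] Suc.prems(1) by auto
    have "C_k_on (r - j) h' \<Omega>" by (rule derivs_C_k_on[OF S' h'(1)]) (use Suc.prems(1) in auto)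
    then have "C_k_on (Suc 0) h' \<Omega>" by (rule C_k_on_le) (use Suc.prems(1) in linarith)
    then have d: "h' differentiable (at w)" if "w \<in> \<Omega>" for w using C_k_on_partials(3) that by blast
    have "partial_x h w = L (partial_x h' w) \<and> partial_y h w = L (partial_y h' w)" if w: "w \<in> \<Omega>" for w
      using partial_cong_open(2,3)[OF \<Omega> w, of h "\<lambda>w. L (h' w)"] h'(2) partials_linear(2,3)[OF L d[OF w]] by simp
    then show ?thesis using h' by blast
  qed
  from Suc.prems(2) consider "g \<in> derivs j S" | h where "h \<in> derivs j S" "g = partial_x h" | h where "h \<in> derivs j S" "g = partial_y h"
    by auto
  then show ?case
  proof cases
    case 1
    then show ?thesis using IH by fastforce
  next
    case 2
    then obtain h' where "h' \<in> derivs j S'" "\<forall>w\<in>\<Omega>. partial_x h w = L (partial_x h' w)" using IH by blast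
    then show ?thesis using 2 by (intro bexI[of _ "partial_x h'"]) auto
  next
    case 3
    then obtain h' where "h' \<in> derivs j S'" "\<forall>w\<in>\<Omega>. partial_y h w = L (partial_y h' w)" using IH by blast
    then show ?thesis using 3 by (intro bexI[of _ "partial_y h'"]) auto
  qed
qed

lemma C_k_on_components:
  fixes f :: "real \<times> real \<Rightarrow> complex^2^'n::finite"
  assumes S: "open S" and f: "\<And>i a. C_k_on k (\<lambda>z. f z $ i $ a) S"
  shows "C_k_on k f S"
proof -
  have lin: "bounded_linear (\<lambda>c::complex. (axis i (axis a c) :: complex^2^'n))" for i a
    by (intro linear_conv_bounded_linear[THEN iffD1] linearI) (auto simp: vec_eq_iff axis_def)
  have "C_k_on k (\<lambda>z. \<Sum>i\<in>UNIV. \<Sum>a\<in>UNIV. (axis i (axis a (f z $ i $ a)) :: complex^2^'n)) S"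
    by (intro C_k_on_sum[OF S] C_k_on_linear[OF lin S] f) auto
  moreover have "(\<Sum>i\<in>UNIV. \<Sum>a\<in>UNIV. (axis i (axis a (x $ i $ a)) :: complex^2^'n)) = x" for x
  proof (intro vec_eq_iff[THEN iffD2] allI)
    fix j :: 'n and b :: 2
    have "(\<Sum>i\<in>UNIV. \<Sum>a\<in>UNIV. (axis i (axis a (x $ i $ a)) :: complex^2^'n)) $ j $ b
        = (\<Sum>i\<in>UNIV. \<Sum>a\<in>UNIV. if i = j then if a = b then x $ i $ a else 0 else 0)"
      by (simp add: axis_def if_distrib[of "\<lambda>v. v $ _"] eq_commute cong: if_cong)
    also have "\<dots> = (\<Sum>i\<in>UNIV. if i = j then x $ i $ b else 0)"
      by (rule sum.cong) auto
    also have "\<dots> = x $ j $ b" by simp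
    finally show "(\<Sum>i\<in>UNIV. \<Sum>a\<in>UNIV. (axis i (axis a (x $ i $ a)) :: complex^2^'n)) $ j $ b = x $ j $ b" .
  qed
  ultimately show ?thesis by simp
qed

section \<open>The Dirac equation\<close>

lemma partial_component:
  fixes f :: "real \<times> real \<Rightarrow> ('b::real_normed_vector)^'m::finite"
  assumes "f differentiable (at z)"
  shows "partial_x (\<lambda>w. f w $ a) z = partial_x f z $ a" "partial_y (\<lambda>w. f w $ a) z = partial_y f z $ a"
    and "(\<lambda>w. f w $ a) differentiable (at z)"
  using partials_linear[OF bounded_linear_vec_nth assms] by auto

lemma dirac_components:
  assumes "f differentiable (at z)"
  shows "dirac f z $ 1 = partial_x (\<lambda>w. f w $ 2) z + \<i> * partial_y (\<lambda>w. f w $ 2) z"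
    and "dirac f z $ 2 = - partial_x (\<lambda>w. f w $ 1) z + \<i> * partial_y (\<lambda>w. f w $ 1) z"
  unfolding partial_component[OF assms]
  by (simp_all add: dirac_def matrix_vector_mult_def sum_2 vector_2)

lemma dirac_cong:
  assumes "open S" "z \<in> S" "\<And>w. w \<in> S \<Longrightarrow> f w = g w"
  shows "dirac f z = dirac g z"
  using partial_cong_open(2,3)[OF assms] by (simp add: dirac_def)

text \<open>
  The components of the spinors, with the first ones conjugated, so that the system takes the form
  \<open>dbar u = F\<close>.
\<close>

definition spinor_comp :: "(real \<times> real \<Rightarrow> complex^2^'n) \<Rightarrow> 'n \<Rightarrow> 2 \<Rightarrow> real \<times> real \<Rightarrow> complex" where
  "spinor_comp \<psi> i a z = (if a = 1 then cnj (\<psi> z $ i $ a) else \<psi> z $ i $ a)"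

text \<open>
  Component \<open>a\<close> of the right hand side of the \<open>i\<close>-th equation.
\<close>

definition dirac_rhs ::
  "('n::finite \<Rightarrow> 'n \<Rightarrow> 'n \<Rightarrow> real \<times> real \<Rightarrow> real^'n) \<Rightarrow> (real \<times> real \<Rightarrow> complex^2^'n) \<Rightarrow> 'n \<Rightarrow> 2 \<Rightarrow> real \<times> real \<Rightarrow> complex" where
  "dirac_rhs H \<psi> i a z = (\<Sum>j\<in>UNIV. \<Sum>k\<in>UNIV. \<Sum>l\<in>UNIV.
     (of_real (H j k l z $ i) * (\<Sum>b\<in>UNIV. \<psi> z $ j $ b * cnj (\<psi> z $ k $ b))) * \<psi> z $ l $ a)"

lemma dirac_rhs_component:
  "(\<Sum>j\<in>UNIV. \<Sum>k\<in>UNIV. \<Sum>l\<in>UNIV.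
     (of_real (H j k l z $ i) * hermitian (\<psi> z $ j) (\<psi> z $ k)) *s (\<psi> z $ l)) $ a = dirac_rhs H \<psi> i a z"
  by (simp add: dirac_rhs_def hermitian_def)

lemma dbar_spinor_comp:
  fixes \<psi> :: "real \<times> real \<Rightarrow> complex^2^'n::finite"
  assumes d: "\<psi> differentiable (at z)" and eq: "solves_dirac H S \<psi>" and z: "z \<in> S"
  shows "dbar (spinor_comp \<psi> i a) z = (if a = 1 then - cnj (dirac_rhs H \<psi> i 2 z) else dirac_rhs H \<psi> i 1 z)"
proof -
  have di: "(\<lambda>w. \<psi> w $ i) differentiable (at z)" by (rule partial_component(3)[OF d])
  have dia: "(\<lambda>w. \<psi> w $ i $ a) differentiable (at z)" for a by (rule partial_component(3)[OF di])
  have e: "dirac (\<lambda>w. \<psi> w $ i) z $ a = dirac_rhs H \<psi> i a z" for a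
    using eq z unfolding solves_dirac_def by (simp only: dirac_rhs_component)
  show ?thesis
  proof (cases "a = 1")
    case True
    have s: "spinor_comp \<psi> i a = (\<lambda>w. cnj (\<psi> w $ i $ 1))" using True by (simp add: spinor_comp_def fun_eq_iff)
    have "dbar (spinor_comp \<psi> i a) z = - cnj (dirac (\<lambda>w. \<psi> w $ i) z $ 2)"
      unfolding s dbar_def dirac_components[OF di] partials_linear[OF bounded_linear_cnj dia] by simp
    then show ?thesis using True e by simp
  next
    case False
    then have a: "a = 2" using exhaust_2 by auto
    have s: "spinor_comp \<psi> i a = (\<lambda>w. \<psi> w $ i $ 2)" using a by (simp add: spinor_comp_def fun_eq_iff)
    have "dbar (spinor_comp \<psi> i a) z = dirac (\<lambda>w. \<psi> w $ i) z $ 1"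
      unfolding s dbar_def dirac_components[OF di] by simp
    then show ?thesis using False e by simp
  qed
qed

lemma dirac_rhs_bound:
  fixes \<psi> :: "real \<times> real \<Rightarrow> complex^2^'n::finite"
  assumes M: "\<And>i j k l. \<bar>H j k l z $ i\<bar> \<le> M" and T: "\<And>i a. norm (\<psi> z $ i $ a) \<le> T"
  shows "norm (dirac_rhs H \<psi> i a z) \<le> 2 * real CARD('n) ^ 3 * M * T ^ 3"
proof -
  have T0: "0 \<le> T" using norm_ge_zero T order_trans by blast
  have M0: "0 \<le> M" using abs_ge_zero M order_trans by blast
  have one: "norm ((of_real (H j k l z $ i) * (\<Sum>b\<in>UNIV. \<psi> z $ j $ b * cnj (\<psi> z $ k $ b))) * \<psi> z $ l $ a) \<le> M * (2 * (T * T)) * T" for j k l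
  proof -
    have "norm (\<Sum>b\<in>UNIV. \<psi> z $ j $ b * cnj (\<psi> z $ k $ b)) \<le> (\<Sum>b\<in>(UNIV::2 set). norm (\<psi> z $ j $ b * cnj (\<psi> z $ k $ b)))"
      by (rule norm_sum)
    also have "\<dots> \<le> real (card (UNIV::2 set)) * (T * T)"
      by (rule sum_bounded_above) (use T T0 in \<open>auto simp: norm_mult intro!: mult_mono\<close>)
    finally have "norm (\<Sum>b\<in>UNIV. \<psi> z $ j $ b * cnj (\<psi> z $ k $ b)) \<le> 2 * (T * T)" by simp
    then show ?thesis unfolding norm_mult using M T T0 M0 by (intro mult_mono) auto
  qed
  have "norm (dirac_rhs H \<psi> i a z) \<le> (\<Sum>j\<in>(UNIV::'n set). \<Sum>k\<in>(UNIV::'n set). \<Sum>l\<in>(UNIV::'n set). M * (2 * (T * T)) * T)"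
    unfolding dirac_rhs_def by (intro order_trans[OF norm_sum] sum_mono order_trans[OF one order_refl])
  also have "\<dots> = 2 * real CARD('n) ^ 3 * M * T ^ 3" by (simp add: power3_eq_cube)
  finally show ?thesis .
qed

lemma dirac_rhs_ctrl:
  fixes \<psi> :: "real \<times> real \<Rightarrow> complex^2^'n::finite"
  assumes d: "\<And>z z'. 0 \<le> d z z'" and \<Omega>: "open \<Omega>"
    and H: "\<And>i j k l. ctrl m d \<Omega> (\<lambda>z. of_real (H j k l z $ i))"
    and u: "\<And>i a. ctrl m d \<Omega> (spinor_comp \<psi> i a)"
  shows "ctrl m d \<Omega> (dirac_rhs H \<psi> i a)"
proof -
  have \<psi>: "ctrl m d \<Omega> (\<lambda>z. \<psi> z $ i $ a)" for i a
  proof (cases "a = 1")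
    case True
    then show ?thesis using ctrl_cnj[OF \<Omega> u[of i a]] by (simp add: spinor_comp_def)
  next
    case False
    then show ?thesis using u[of i a] by (simp add: spinor_comp_def[abs_def])
  qed
  show ?thesis unfolding dirac_rhs_def[abs_def]
    by (intro ctrl_sum[OF d \<Omega>] ctrl_mult[OF d \<Omega>] ctrl_cnj[OF \<Omega>] \<psi> H finite)
qed

theorem theorem3p1:
  fixes H :: "'n::finite \<Rightarrow> 'n \<Rightarrow> 'n \<Rightarrow> real \<times> real \<Rightarrow> real^'n"
    and \<psi> :: "real \<times> real \<Rightarrow> complex^2^'n"
  assumes "\<And>j k l. C_k_on 1 (H j k l) unit_disk"
    and "\<exists>M. \<forall>z\<in>unit_disk. \<forall>i j k l. \<bar>H j k l z $ i\<bar> \<le> M"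
    and "\<exists>M. \<forall>z\<in>unit_disk. \<forall>i j k l. norm (grad (\<lambda>w. H j k l w $ i) z) \<le> M"
    and "smooth_solution H (unit_disk - {0}) \<psi>"
    and "set_integrable lborel unit_disk (\<lambda>z. norm (\<psi> z) ^ 4)"
  shows "\<exists>\<phi>. (\<forall>z\<in>unit_disk - {0}. \<phi> z = \<psi> z) \<and> smooth_solution H unit_disk \<phi>"
proof -
  define B where "B = ball (0::real \<times> real) 1"
  define \<Omega> where "\<Omega> = B - {0}"
  have UB: "unit_disk = B" by (simp add: B_def unit_disk_eq_ball)
  have B: "open B" and \<Omega>: "open \<Omega>" by (simp_all add: B_def \<Omega>_def open_delete)
  have H1: "C_k_on (Suc 0) (H j k l) B" for j k l using assms(1) by (simp only: UB One_nat_def)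
  have sol: "solves_dirac H \<Omega> \<psi>"
    and smooth: "\<And>r. (\<And>j k l. C_k_on r (H j k l) \<Omega>) \<Longrightarrow> C_k_on r \<psi> \<Omega>"
    using assms(4) unfolding smooth_solution_def UB \<Omega>_def by blast+
  have \<psi>C: "C_k_on r \<psi> \<Omega>" if "\<And>j k l. C_k_on r (H j k l) B" for r
    by (rule smooth) (rule C_k_on_subset[OF that], simp add: \<Omega>_def)
  obtain M where M: "\<And>z i j k l. z \<in> B \<Longrightarrow> \<bar>H j k l z $ i\<bar> \<le> M" using assms(2) unfolding UB by blast
  have B0: "0 \<in> B" by (simp add: B_def)
  have M0: "0 \<le> M" by (rule order_trans[OF abs_ge_zero M[OF B0]])

  define u where "u = spinor_comp \<psi>"
  define S where "S = range (\<lambda>(i, a). u i a)"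
  have fin: "finite S" by (simp add: S_def)
  have uS: "u i a \<in> S" for i a by (auto simp: S_def)
  have comp: "C_k_on r (\<lambda>z. \<psi> z $ i $ a) \<Omega>" if "C_k_on r \<psi> \<Omega>" for r i a
    using C_k_on_linear[OF bounded_linear_compose[OF bounded_linear_vec_nth bounded_linear_vec_nth] \<Omega> that] by simp
  have uC: "C_k_on r (u i a) \<Omega>" if "C_k_on r \<psi> \<Omega>" for r i a
  proof (cases "a = 1")
    case True
    then show ?thesis
      using C_k_on_linear[OF bounded_linear_cnj \<Omega> comp[OF that, of i a]] by (simp add: u_def spinor_comp_def[abs_def])
  next
    case False
    then show ?thesis using comp[OF that, of i a] by (simp add: u_def spinor_comp_def[abs_def])
  qed
  have SC: "C_k_on r g \<Omega>" if "C_k_on r \<psi> \<Omega>" "g \<in> S" for r g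
    using uC[OF that(1)] that(2) by (auto simp: S_def)
  have \<psi>1: "C_k_on (Suc 0) \<psi> \<Omega>" by (rule \<psi>C[OF H1])
  have d\<psi>: "\<psi> differentiable (at z)" if "z \<in> \<Omega>" for z using C_k_on_partials(3)[OF \<psi>1 that] .
  have dbar_u: "dbar (u i a) z = (if a = 1 then - cnj (dirac_rhs H \<psi> i 2 z) else dirac_rhs H \<psi> i 1 z)" if "z \<in> \<Omega>" for i a z
    unfolding u_def by (rule dbar_spinor_comp[OF d\<psi>[OF that] sol that])

  define T where "T z = (\<Sum>g\<in>S. norm (g z))" for z
  have \<psi>T: "norm (\<psi> z $ i $ a) \<le> T z" for z i a
  proof -
    have "norm (\<psi> z $ i $ a) = norm (u i a z)" by (simp add: u_def spinor_comp_def)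
    also have "\<dots> \<le> T z" unfolding T_def by (rule norm_le_sum_norm[OF fin uS])
    finally show ?thesis .
  qed
  have T0: "0 \<le> T z" for z unfolding T_def by (intro sum_nonneg) auto
  have T\<psi>: "T z \<le> real (card S) * norm (\<psi> z)" for z
    unfolding T_def
  proof (rule sum_bounded_above)
    fix g assume "g \<in> S"
    then obtain i a where "g = u i a" by (auto simp: S_def)
    then have "norm (g z) = norm (\<psi> z $ i $ a)" by (simp add: u_def spinor_comp_def)
    also have "\<dots> \<le> norm (\<psi> z $ i)" by (rule Finite_Cartesian_Product.norm_nth_le)
    also have "\<dots> \<le> norm (\<psi> z)" by (rule Finite_Cartesian_Product.norm_nth_le)
    finally show "norm (g z) \<le> norm (\<psi> z)" .
  qed
  have C1S: "C1_on g (ball 0 1 - {0})" if "g \<in> S" for g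
    using C_k_on_imp_C1_on[OF SC[OF \<psi>1 that]] by (simp add: \<Omega>_def B_def)
  have DS: "norm (dbar g z) \<le> (2 * real CARD('n) ^ 3 * M) * (\<Sum>g\<in>S. norm (g z)) ^ 3"
    if "g \<in> S" "z \<in> ball 0 1 - {0}" for g z
  proof -
    have z: "z \<in> \<Omega>" "z \<in> B" using that(2) by (simp_all add: \<Omega>_def B_def)
    note g = that(1)
    have b: "norm (dirac_rhs H \<psi> i a z) \<le> 2 * real CARD('n) ^ 3 * M * T z ^ 3" for i a
      by (rule dirac_rhs_bound) (rule M[OF z(2)], rule \<psi>T)
    obtain i a where "g = u i a" using g by (auto simp: S_def)
    then show ?thesis using dbar_u[OF z(1), of i a] b by (simp add: T_def)
  qed
  have L4: "set_integrable lborel (ball 0 1) (\<lambda>z. (\<Sum>g\<in>S. norm (g z)) ^ 4)"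
    unfolding set_integrable_def T_def[symmetric]
  proof (rule Bochner_Integration.integrable_bound)
    show "integrable lborel (\<lambda>z. real (card S) ^ 4 * (indicator (ball 0 1) z *\<^sub>R norm (\<psi> z) ^ 4))"
      using assms(5) unfolding UB B_def set_integrable_def by (rule integrable_mult_right)
    have "continuous_on \<Omega> (\<lambda>z. T z ^ 4)"
      unfolding T_def using C1S by (intro continuous_intros C1_on_continuous) (simp add: \<Omega>_def B_def)
    then have "(\<lambda>z. indicator \<Omega> z *\<^sub>R T z ^ 4) \<in> borel_measurable borel"
      using \<Omega> by (intro borel_measurable_continuous_on_indicator) auto
    then have "(\<lambda>z. indicator (ball 0 1) z *\<^sub>R T z ^ 4) \<in> borel_measurable borel"
      by (rule measurable_discrete_difference[where X = "{0}"]) (auto simp: \<Omega>_def B_def split: split_indicator)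
    then show "(\<lambda>z. indicator (ball 0 1) z *\<^sub>R T z ^ 4) \<in> borel_measurable lborel" by simp
    have "T z ^ 4 \<le> (real (card S) * norm (\<psi> z)) ^ 4" for z by (rule power_mono[OF T\<psi> T0])
    then show "AE z in lborel. norm (indicator (ball 0 1) z *\<^sub>R T z ^ 4) \<le> norm (real (card S) ^ 4 * (indicator (ball 0 1) z *\<^sub>R norm (\<psi> z) ^ 4))"
      using T0 by (auto simp: power_mult_distrib split: split_indicator)
  qed
  have K0: "0 \<le> 2 * real CARD('n) ^ 3 * M" using M0 by simp
  obtain \<rho> M' where \<rho>: "0 < \<rho>" "\<rho> \<le> 1" "\<And>g z. g \<in> S \<Longrightarrow> z \<in> ball 0 \<rho> - {0} \<Longrightarrow> norm (g z) \<le> M'"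
    using removable_bounded[OF fin zero_less_one K0 C1S DS L4] by blast

  have lim: "\<exists>l. (g \<longlongrightarrow> l) (at 0)"
    if r: "1 \<le> r" and H: "\<And>j k l. C_k_on r (H j k l) B" and g: "g \<in> derivs r S" for r g
  proof (rule derivs_limits[OF fin zero_less_one _ r \<rho>(1,2) _ _ g])
    show "norm (h z) \<le> M'" if "h \<in> S" "z \<in> ball 0 \<rho> - {0}" for h z by (rule \<rho>(3)[OF that])
    show "C_k_on r u (ball 0 1 - {0})" if "u \<in> S" for u
      using SC[OF \<psi>C[OF H] that] by (simp add: \<Omega>_def B_def)
    fix k d \<rho>' and v
    assume k: "k < r" and dd: "\<And>z z'. dist z z' \<le> d z z'" and \<rho>': "0 < \<rho>'" "\<rho>' < 1"
      and c: "\<And>u. u \<in> S \<Longrightarrow> ctrl k d (ball 0 \<rho>' - {0}) u" and v: "v \<in> S"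
    have d0: "0 \<le> d z z'" for z z' by (rule order_trans[OF zero_le_dist dd])
    have o: "open (ball (0::real \<times> real) \<rho>' - {0})" by (simp add: open_delete)
    have Hc: "ctrl k d (ball 0 \<rho>' - {0}) (\<lambda>z. of_real (H j k' l z $ i))" for i j k' l
    proof (rule C_k_on_imp_ctrl[OF dd \<rho>'(2)])
      have "C_k_on (Suc k) (H j k' l) B" by (rule C_k_on_le[OF H]) (use k in simp)
      from C_k_on_linear[OF bounded_linear_compose[OF bounded_linear_of_real bounded_linear_vec_nth] B this]
      show "C_k_on (Suc k) (\<lambda>z. complex_of_real (H j k' l z $ i)) (ball 0 1)" by (simp only: B_def)
    qed
    have uc: "ctrl k d (ball 0 \<rho>' - {0}) (spinor_comp \<psi> i a)" for i a using c[OF uS[of i a]] by (simp add: u_def)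
    have rc: "ctrl k d (ball 0 \<rho>' - {0}) (dirac_rhs H \<psi> i a)" for i a
      by (rule dirac_rhs_ctrl[OF d0 o]) (rule Hc, rule uc)
    obtain i a where via: "v = u i a" using v by (auto simp: S_def)
    have in\<Omega>: "z \<in> \<Omega>" if "z \<in> ball 0 \<rho>' - {0}" for z using that \<rho>' by (simp add: \<Omega>_def B_def)
    show "ctrl k d (ball 0 \<rho>' - {0}) (dbar v)"
    proof (cases "a = 1")
      case True
      have "ctrl k d (ball 0 \<rho>' - {0}) (\<lambda>z. (-1) * cnj (dirac_rhs H \<psi> i 2 z))"
        by (rule ctrl_mult[OF d0 o ctrl_const[OF d0] ctrl_cnj[OF o rc]])
      then show ?thesis
        by (subst ctrl_cong[OF o, of "dbar v" "\<lambda>z. (-1) * cnj (dirac_rhs H \<psi> i 2 z)"])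
          (use dbar_u[OF in\<Omega>, of _ i a] True in \<open>auto simp: via\<close>)
    next
      case False
      show ?thesis
        by (subst ctrl_cong[OF o, of "dbar v" "dirac_rhs H \<psi> i 1"])
          (use dbar_u[OF in\<Omega>, of _ i a] False rc in \<open>auto simp: via\<close>)
    qed
  qed

  have "\<exists>l. ((\<lambda>z. \<psi> z $ i $ a) \<longlongrightarrow> l) (at 0)" for i a
  proof -
    have "u i a \<in> derivs (Suc 0) S" using uS by simp
    from lim[OF _ H1 this] obtain l where l: "(u i a \<longlongrightarrow> l) (at 0)" by auto
    show ?thesis
    proof (cases "a = 1")
      case True
      then show ?thesis using tendsto_cnj[OF l] by (auto simp: u_def spinor_comp_def)
    next
      case False
      then show ?thesis using l by (auto simp: u_def spinor_comp_def[abs_def])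
    qed
  qed
  then obtain l where l: "\<And>i a. ((\<lambda>z. \<psi> z $ i $ a) \<longlongrightarrow> l i a) (at 0)" by metis
  define \<phi> where "\<phi> z = (if z = 0 then (\<chi> i a. l i a) else \<psi> z)" for z
  have \<phi>\<psi>: "\<phi> z = \<psi> z" if "z \<in> \<Omega>" for z using that by (simp add: \<phi>_def \<Omega>_def)
  have c\<phi>: "isCont (\<lambda>z. \<phi> z $ i $ a) 0" for i a
  proof -
    have "((\<lambda>z. \<phi> z $ i $ a) \<longlongrightarrow> l i a) (at 0)"
      by (rule Lim_transform_eventually[OF l]) (simp add: eventually_at_filter \<phi>_def)
    then show ?thesis by (simp add: isCont_def \<phi>_def)
  qed
  have \<phi>comp: "C_k_on r (\<lambda>z. \<phi> z $ i $ a) B" if r: "1 \<le> r" and H: "\<And>j k l. C_k_on r (H j k l) B" for r i a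
    unfolding B_def
  proof (rule C_k_on_puncture[OF zero_less_one _ c\<phi>])
    note \<psi>r = \<psi>C[OF H]
    show "C_k_on r (\<lambda>z. \<phi> z $ i $ a) (ball 0 1 - {0})"
      using C_k_on_cong[OF \<Omega>, of "\<lambda>z. \<phi> z $ i $ a" "\<lambda>z. \<psi> z $ i $ a"] comp[OF \<psi>r] \<phi>\<psi> by (simp add: \<Omega>_def B_def)
    fix g assume g: "g \<in> derivs r {\<lambda>z. \<phi> z $ i $ a}"
    define L :: "complex \<Rightarrow> complex" where "L = (if a = 1 then cnj else (\<lambda>x. x))"
    have L: "bounded_linear L" by (simp add: L_def bounded_linear_cnj bounded_linear_ident)
    have rel: "\<exists>g'\<in>S. \<forall>w\<in>\<Omega>. g w = L (g' w)" if "g \<in> {\<lambda>z. \<phi> z $ i $ a}" for g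
      using that uS[of i a] \<phi>\<psi> by (intro bexI[of _ "u i a"]) (auto simp: L_def u_def spinor_comp_def)
    obtain g' where g': "g' \<in> derivs r S" "\<And>w. w \<in> \<Omega> \<Longrightarrow> g w = L (g' w)"
      using derivs_related[OF \<Omega> L SC[OF \<psi>r] rel order_refl g] by blast
    obtain m where m: "(g' \<longlongrightarrow> m) (at 0)" using lim[OF r H g'(1)] by blast
    have "((\<lambda>w. L (g' w)) \<longlongrightarrow> L m) (at 0)" by (rule bounded_linear.tendsto[OF L m])
    moreover have "\<forall>\<^sub>F w in at 0. L (g' w) = g w"
      unfolding eventually_at_topological
      by (intro exI[of _ B]) (use g'(2) B in \<open>auto simp: \<Omega>_def B_def\<close>)
    ultimately show "\<exists>l. (g \<longlongrightarrow> l) (at 0)" using Lim_transform_eventually by blast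
  qed
  have \<phi>C: "C_k_on r \<phi> B" if "1 \<le> r" "\<And>j k l. C_k_on r (H j k l) B" for r
    using C_k_on_components[OF B \<phi>comp[OF that]] .
  have \<phi>1: "C_k_on (Suc 0) \<phi> B" using \<phi>C[of "Suc 0"] H1 by simp
  \<comment> \<open>the case \<open>r = 0\<close> is contained in \<open>r = 1\<close>\<close>
  have \<phi>all: "C_k_on r \<phi> B" if "\<And>j k l. C_k_on r (H j k l) B" for r
  proof (cases "1 \<le> r")
    case False
    then have "r \<le> Suc 0" by simp
    then show ?thesis by (rule C_k_on_le[OF \<phi>1])
  qed (use \<phi>C that in blast)

  have sol\<Omega>: "solves_dirac H \<Omega> \<phi>"
    using sol dirac_cong[OF \<Omega>, of _ "\<lambda>w. \<phi> w $ _" "\<lambda>w. \<psi> w $ _"] \<phi>\<psi> unfolding solves_dirac_def by simp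
  have d\<phi>: "\<phi> differentiable (at z)" if "z \<in> B" for z using C_k_on_partials(3)[OF \<phi>1 that] .
  \<comment> \<open>the equation at the origin holds by continuity\<close>
  have at0: "f 0 = g 0" if "continuous_on B f" "continuous_on B g" "\<And>z. z \<in> \<Omega> \<Longrightarrow> f z = g z" for f g :: "real \<times> real \<Rightarrow> complex"
  proof -
    have "(f \<longlongrightarrow> f 0) (at 0)" "(g \<longlongrightarrow> g 0) (at 0)"
      using that(1,2) B B0 by (simp_all add: continuous_on_eq_continuous_at isCont_def)
    moreover have "\<forall>\<^sub>F z in at 0. f z = g z"
      unfolding eventually_at_topological
      by (intro exI[of _ B]) (use that(3) B in \<open>auto simp: \<Omega>_def B_def\<close>)
    ultimately have "(g \<longlongrightarrow> f 0) (at 0)" "(g \<longlongrightarrow> g 0) (at 0)" using Lim_transform_eventually by blast+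
    then show ?thesis using LIM_unique by blast
  qed
  have c1: "C1_on (\<lambda>z. \<phi> z $ i $ a) B" for i a
    using C_k_on_imp_C1_on[OF \<phi>comp[of "Suc 0" i a]] H1 by simp
  have px: "continuous_on B (partial_x (\<lambda>z. \<phi> z $ i $ a))" "continuous_on B (partial_y (\<lambda>z. \<phi> z $ i $ a))"
    "continuous_on B (\<lambda>z. \<phi> z $ i $ a)" for i a
    using c1 C1_on_continuous[OF c1] by (auto simp: C1_on_def)
  have cH: "continuous_on B (\<lambda>z. H j k l z $ i)" for i j k l
    using C_k_on_SucD[OF H1[of j k l]] by (intro continuous_intros) simp
  have crhs: "continuous_on B (dirac_rhs H \<phi> i a)" for i a
    unfolding dirac_rhs_def[abs_def] by (intro continuous_intros px cH)
  have comps: "dirac (\<lambda>w. \<phi> w $ i) z $ a = dirac_rhs H \<phi> i a z" if "z \<in> \<Omega>" for i a z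
    using sol\<Omega> that unfolding solves_dirac_def by (simp only: dirac_rhs_component)
  have "dirac (\<lambda>w. \<phi> w $ i) z $ a = dirac_rhs H \<phi> i a z" if z: "z \<in> B" for i a z
  proof (cases "z = 0")
    case True
    have cd: "continuous_on B (\<lambda>z. dirac (\<lambda>w. \<phi> w $ i) z $ b)" for b
    proof -
      have di: "(\<lambda>w. \<phi> w $ i) differentiable (at z)" if "z \<in> B" for z by (rule partial_component(3)[OF d\<phi>[OF that]])
      have "b = 1 \<or> b = 2" by (rule exhaust_2)
      then show ?thesis
      proof
        assume b: "b = 1"
        have "continuous_on B (\<lambda>z. partial_x (\<lambda>w. \<phi> w $ i $ 2) z + \<i> * partial_y (\<lambda>w. \<phi> w $ i $ 2) z)"
          by (intro continuous_intros px)
        then show ?thesis unfolding b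
          by (rule continuous_on_eq) (simp add: dirac_components(1)[OF di])
      next
        assume b: "b = 2"
        have "continuous_on B (\<lambda>z. - partial_x (\<lambda>w. \<phi> w $ i $ 1) z + \<i> * partial_y (\<lambda>w. \<phi> w $ i $ 1) z)"
          by (intro continuous_intros px)
        then show ?thesis unfolding b
          by (rule continuous_on_eq) (simp add: dirac_components(2)[OF di])
      qed
    qed
    show ?thesis unfolding True by (rule at0[OF cd crhs comps])
  next
    case False
    then show ?thesis using comps z by (simp add: \<Omega>_def)
  qed
  then have "solves_dirac H B \<phi>"
    unfolding solves_dirac_def by (simp add: vec_eq_iff dirac_rhs_component del: sum_component)
  then have "smooth_solution H B \<phi>"
    unfolding smooth_solution_def One_nat_def using \<phi>1 \<phi>all by blast
  then show ?thesis using \<phi>\<psi> unfolding UB \<Omega>_def by blast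
qed

end
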